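(* For all fixed integers $t\ge 2$ and $k\ge 2$, we have $$C_{2(t-1)}(n,tk)=(1+o(1))\,\frac{\binom{n}{k}}{\binom{tk-1}{k-1}}\qquad\text{as } n\to\infty .$$
   Context: An $r$-uniform hypergraph ($r$-graph) is a family (without repeated members) of $r$-element subsets, called edges, of a finite vertex set. For an integer $t\ge 1$, an $r$-graph $\mathcal{H}$ is called $t$-cancellative if for any $t+2$ distinct edges $A_1,\ldots,A_t,B,C\in\mathcal{H}$ one has $(\bigcup_{i=1}^t A_i)\cup B\ne(\bigcup_{i=1}^t A_i)\cup C$. $C_t(n,r)$ denotes the maximum number of edges in a $t$-cancellative $r$-graph on $n$ vertices. Thus $C_{2(t-1)}(n,tk)$ is the maximum number of edges of a $2(t-1)$-cancellative $tk$-graph on $n$ vertices. The parameters $t,k$ are fixed and $o(1)$ denotes a quantity tending to $0$ as $n\to\infty$. *)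

theory Defs
  imports Complex_Main "HOL-Library.Landau_Symbols"
begin

text \<open>An \<open>r\<close>-graph on the vertex set \<open>V\<close> is identified with its set of edges.\<close>

definition uniform_hypergraph :: "'a set \<Rightarrow> nat \<Rightarrow> 'a set set \<Rightarrow> bool" where
  "uniform_hypergraph V r H \<longleftrightarrow> finite V \<and> (\<forall>e\<in>H. e \<subseteq> V \<and> card e = r)"

text \<open>
  The injectivity premise and the three premises after it say that the \<open>t + 2\<close> edges
  \<open>A 1, \<dots>, A t, B, C\<close> are pairwise distinct.
\<close>

definition cancellative :: "nat \<Rightarrow> 'a set set \<Rightarrow> bool" where
  "cancellative t H \<longleftrightarrow>
     (\<forall>A :: nat \<Rightarrow> 'a set. \<forall>B\<in>H. \<forall>C\<in>H.
        (\<forall>i\<in>{1..t}. A i \<in> H) \<longrightarrow>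
        inj_on A {1..t} \<longrightarrow> B \<notin> A ` {1..t} \<longrightarrow> C \<notin> A ` {1..t} \<longrightarrow> B \<noteq> C \<longrightarrow>
        (\<Union>i\<in>{1..t}. A i) \<union> B \<noteq> (\<Union>i\<in>{1..t}. A i) \<union> C)"

definition max_cancellative :: "nat \<Rightarrow> nat \<Rightarrow> nat \<Rightarrow> nat" where
  "max_cancellative t n r =
     Max {card H | H. uniform_hypergraph {..<n} r H \<and> cancellative t H}"

text \<open>The maximum is taken over a finite nonempty set, so it is a genuine maximum.\<close>

lemma finite_cancellative_sizes:
  "finite {card H | H. uniform_hypergraph {..<n::nat} r H \<and> cancellative t H}"
proof -
  have "{H. uniform_hypergraph {..<n} r H \<and> cancellative t H} \<subseteq> Pow (Pow {..<n})"
    by (auto simp: uniform_hypergraph_def)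
  then have "finite {H. uniform_hypergraph {..<n} r H \<and> cancellative t H}"
    by (rule finite_subset) simp
  then show ?thesis
    by simp
qed

lemma zero_in_cancellative_sizes:
  "0 \<in> {card H | H. uniform_hypergraph {..<n::nat} r H \<and> cancellative t H}"
  by (auto simp: uniform_hypergraph_def cancellative_def intro!: exI[of _ "{}"])

end

(* Upper bound. Charge to an edge B the k-subsets of B lying in no other edge, together with the parts
   of those partitions of B into t sets of size k all of whose parts lie in other edges. By
   cancellativity no k-set is charged twice, and every partition of B has a charged part, so B is
   charged at least ((tk) choose k) / t = ((tk-1) choose (k-1)) times.

   Lower bound. Take a family T of (tk-1)-sets on w points with many more than w^k members in which any
   e <= 2t members span at least e(tk-1) - (e-1)k points, and add a private new vertex to each member.
   This gadget has about ((tk-1) choose (k-1)) k-sets in its shadow per edge, because the k-sets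
   avoiding all private vertices are negligible. Pack copies of the gadget into n points such that their
   shadows are disjoint and almost cover the k-sets, few copies never overlap too much, and the k-sets
   inside a copy that do not belong to its shadow lie in no shadow at all. The last condition is reached
   by reserving a sparse random collection of k-sets and using only those copies whose non-shadow k-sets
   are all reserved while no shadow k-set is. A sparse random choice of such copies leaves, after a few
   deletions, a linear hypergraph on the unreserved k-sets whose degrees are almost all close to a large
   constant; by the Roedl nibble it has a nearly perfect matching. Counting the vertices that
   2(t-1) further edges can cover shows that the union of the packed gadgets is cancellative. *)

theory Submission
  imports Defs "HOL-Library.FuncSet" "HOL-Library.Disjoint_Sets"
begin

section \<open>Random subsets of a finite set\<close>

text \<open>Only expectations are used, never concentration: regularity of degrees is measured in
  mean square, so it can join all other losses in one real cost, and an outcome of at most average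
  cost does everything at once. The family of all copies is regular but far from linear. Thinning it
  to a constant expected degree \<open>D\<close> leaves only O(n^(k-1)) pairs sharing more than
  \<open>k\<close> points, against order n^k \<open>k\<close>-sets, while the relative variance of a
  degree is about \<open>1 / D\<close>; so \<open>D\<close> need only be large in terms of the
  error, and need not grow with \<open>n\<close>. The sparseness threshold is the one for which
  \<open>2 * (t - 1)\<close> covering edges just fail: the same count, over edges of a gadget and
  over gadgets of the packing, bounds \<open>2 * t * k\<close> by itself. Across two gadgets
  strictness comes from \<open>B\<close> and \<open>C\<close> sharing fewer than \<open>k\<close>
  points. Inside one gadget the count allows equality, and the private vertex of \<open>B\<close>
  decides; this is its second purpose. Reservation is needed because an edge could otherwise meet a
  foreign gadget in \<open>k\<close> points that lie in no single edge of it; disjoint shadows do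
  not prevent this, and the count needs at most \<open>k - 1\<close> points per foreign
  edge.\<close>

definition bern :: "('a \<Rightarrow> real) \<Rightarrow> 'a set \<Rightarrow> ('a set \<Rightarrow> real) \<Rightarrow> real" where
  "bern p \<Omega> f = (\<Sum>X\<in>Pow \<Omega>. (\<Prod>i\<in>X. p i) * (\<Prod>i\<in>\<Omega> - X. 1 - p i) * f X)"

lemma bern_add: "bern p \<Omega> (\<lambda>X. f X + g X) = bern p \<Omega> f + bern p \<Omega> g"
  by (simp add: bern_def distrib_left sum.distrib)

lemma bern_diff: "bern p \<Omega> (\<lambda>X. f X - g X) = bern p \<Omega> f - bern p \<Omega> g"
  by (simp add: bern_def right_diff_distrib sum_subtractf)

lemma bern_cmult: "bern p \<Omega> (\<lambda>X. c * f X) = c * bern p \<Omega> f"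
  by (simp add: bern_def sum_distrib_left mult.left_commute)

lemma bern_sum: "bern p \<Omega> (\<lambda>X. \<Sum>i\<in>I. f i X) = (\<Sum>i\<in>I. bern p \<Omega> (f i))"
  unfolding bern_def by (subst sum.swap) (simp add: sum_distrib_left)

lemma bern_cong:
  assumes "\<And>X. X \<subseteq> \<Omega> \<Longrightarrow> f X = g X"
  shows "bern p \<Omega> f = bern p \<Omega> g"
  unfolding bern_def by (rule sum.cong) (use assms in auto)

text \<open>Setting the inclusion weight to 0 on \<open>B\<close> and the exclusion weight to 0 on
  \<open>A\<close> kills every \<open>X\<close> violating the event, so the sum is the expansion of
  the product of all \<open>f i + g i\<close>, whose factors outside \<open>A\<close> and
  \<open>B\<close> are 1. The exact probabilities below come from this formula.\<close>

lemma bern_avoid: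
  assumes fin: "finite \<Omega>" and sub: "A \<subseteq> \<Omega>" "B \<subseteq> \<Omega>" and disj: "A \<inter> B = {}"
  shows "bern p \<Omega> (\<lambda>X. of_bool (A \<subseteq> X \<and> X \<inter> B = {})) = (\<Prod>i\<in>A. p i) * (\<Prod>i\<in>B. 1 - p i)"
proof -
  define f where "f i = (if i \<in> B then 0 else p i)" for i
  define g where "g i = (if i \<in> A then 0 else 1 - p i)" for i
  have "bern p \<Omega> (\<lambda>X. of_bool (A \<subseteq> X \<and> X \<inter> B = {})) = (\<Sum>X\<in>Pow \<Omega>. prod f X * prod g (\<Omega> - X))"
    unfolding bern_def
  proof (rule sum.cong[OF refl])
    fix X assume "X \<in> Pow \<Omega>"
    then have X: "X \<subseteq> \<Omega>" "finite X" "finite (\<Omega> - X)"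
      using fin by (auto intro: finite_subset)
    show "(\<Prod>i\<in>X. p i) * (\<Prod>i\<in>\<Omega> - X. 1 - p i) * of_bool (A \<subseteq> X \<and> X \<inter> B = {})
        = prod f X * prod g (\<Omega> - X)"
    proof (cases "A \<subseteq> X \<and> X \<inter> B = {}")
      case True
      have "prod f X = prod p X"
        by (rule prod.cong) (use True in \<open>auto simp: f_def\<close>)
      moreover have "prod g (\<Omega> - X) = (\<Prod>i\<in>\<Omega> - X. 1 - p i)"
        by (rule prod.cong) (use True in \<open>auto simp: g_def\<close>)
      ultimately show ?thesis using True by simp
    next
      case False
      then have "(\<exists>i\<in>X. f i = 0) \<or> (\<exists>i\<in>\<Omega> - X. g i = 0)"
        using sub by (auto simp: f_def g_def)
      then have "prod f X * prod g (\<Omega> - X) = 0"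
        using X by auto
      moreover have "of_bool (A \<subseteq> X \<and> X \<inter> B = {}) = (0::real)"
        using False by (simp only: of_bool_eq_0_iff not_False_eq_True)
      ultimately show ?thesis by (simp only: mult_zero_right)
    qed
  qed
  also have "\<dots> = (\<Prod>i\<in>\<Omega>. f i + g i)"
    by (rule prod_add[OF fin, symmetric])
  also have "\<dots> = (\<Prod>i\<in>A \<union> B. f i + g i)"
    by (rule prod.mono_neutral_right) (use fin sub in \<open>auto simp: f_def g_def\<close>)
  also have "\<dots> = (\<Prod>i\<in>A. f i + g i) * (\<Prod>i\<in>B. f i + g i)"
    by (rule prod.union_disjoint) (use fin sub disj in \<open>auto intro: finite_subset\<close>)
  also have "(\<Prod>i\<in>A. f i + g i) = (\<Prod>i\<in>A. p i)"
    by (rule prod.cong) (use disj in \<open>auto simp: f_def g_def\<close>)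
  also have "(\<Prod>i\<in>B. f i + g i) = (\<Prod>i\<in>B. 1 - p i)"
    by (rule prod.cong) (use disj in \<open>auto simp: f_def g_def\<close>)
  finally show ?thesis .
qed

lemma bern_subset:
  assumes "finite \<Omega>" "A \<subseteq> \<Omega>"
  shows "bern p \<Omega> (\<lambda>X. of_bool (A \<subseteq> X)) = (\<Prod>i\<in>A. p i)"
  using bern_avoid[OF assms, of "{}" p] by simp

lemma bern_const: "finite \<Omega> \<Longrightarrow> bern p \<Omega> (\<lambda>X. c) = c"
  using bern_avoid[of \<Omega> "{}" "{}" p] bern_cmult[of p \<Omega> c "\<lambda>_. 1"] by simp

lemma bern_mono:
  assumes "\<And>i. i \<in> \<Omega> \<Longrightarrow> 0 \<le> p i \<and> p i \<le> 1" and "\<And>X. X \<subseteq> \<Omega> \<Longrightarrow> f X \<le> g X"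
  shows "bern p \<Omega> f \<le> bern p \<Omega> g"
  unfolding bern_def
  by (intro sum_mono mult_left_mono mult_nonneg_nonneg prod_nonneg) (use assms in auto)

text \<open>First-moment method: an average is at least the minimum.\<close>

lemma bern_le_witness:
  assumes fin: "finite \<Omega>" and p: "\<And>i. i \<in> \<Omega> \<Longrightarrow> 0 \<le> p i \<and> p i \<le> 1" and b: "bern p \<Omega> f \<le> c"
  obtains X where "X \<subseteq> \<Omega>" and "f X \<le> c"
proof (rule ccontr)
  assume neg: "\<not> thesis"
  define m where "m = Min (f ` Pow \<Omega>)"
  have m: "m \<in> f ` Pow \<Omega>" "\<And>X. X \<subseteq> \<Omega> \<Longrightarrow> m \<le> f X"
    unfolding m_def using fin by (auto intro!: Min_in Min_le)
  obtain Y where Y: "Y \<subseteq> \<Omega>" "m = f Y" using m(1) by auto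
  have "m > c" using neg that[of Y] Y by (meson not_le_imp_less)
  moreover have "m \<le> bern p \<Omega> f"
    using bern_mono[of \<Omega> p "\<lambda>_. m" f, OF p m(2)] by (simp add: bern_const[OF fin])
  ultimately show False using b by simp
qed

section \<open>The nibble\<close>

definition hdeg :: "'v set set \<Rightarrow> 'v \<Rightarrow> nat" where
  "hdeg E v = card {e \<in> E. v \<in> e}"

definition irregularity :: "'v set \<Rightarrow> 'v set set \<Rightarrow> real \<Rightarrow> real" where
  "irregularity V E D = (\<Sum>v\<in>V. (hdeg E v / D - 1)\<^sup>2)"

definition linear_hypergraph :: "nat \<Rightarrow> 'v set \<Rightarrow> 'v set set \<Rightarrow> bool" where
  "linear_hypergraph d V E \<longleftrightarrow> uniform_hypergraph V d E \<and> (\<forall>e\<in>E. \<forall>f\<in>E. e \<noteq> f \<longrightarrow> card (e \<inter> f) \<le> 1)"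

text \<open>\<open>coverable d a\<close> says that a proportion \<open>a\<close> of uncovered vertices can be reached, up to an error
  linear in the irregularity of the degrees. Since the error is quadratic in the deviations, it can be
  averaged over a random step.\<close>

definition covers :: "'v itself \<Rightarrow> nat \<Rightarrow> real \<Rightarrow> real \<Rightarrow> real \<Rightarrow> real \<Rightarrow> bool" where
  "covers _ d a b D0 K \<longleftrightarrow> (\<forall>(V :: 'v set) E D.
     linear_hypergraph d V E \<longrightarrow> D \<ge> D0 \<longrightarrow> D > 0 \<longrightarrow> (\<forall>v\<in>V. real (hdeg E v) \<le> K * D) \<longrightarrow>
     (\<exists>M\<subseteq>E. disjoint M \<and> card (V - \<Union>M) \<le> a * real (card V) + b * irregularity V E D))"

definition coverable :: "'v itself \<Rightarrow> nat \<Rightarrow> real \<Rightarrow> bool" where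
  "coverable T d a \<longleftrightarrow> (\<forall>K. \<exists>b\<ge>0. \<exists>D0. covers T d a b D0 K)"

lemma coversD:
  assumes "covers TYPE('v) d a b D0 K" "linear_hypergraph d (V :: 'v set) E" "D \<ge> D0" "D > 0"
    "\<And>v. v \<in> V \<Longrightarrow> real (hdeg E v) \<le> K * D"
  shows "\<exists>M\<subseteq>E. disjoint M \<and> card (V - \<Union>M) \<le> a * real (card V) + b * irregularity V E D"
  using assms unfolding covers_def by blast

text \<open>The slope of \<open>exp (- x)\<close> is at most 1 in absolute value for nonnegative
  \<open>x\<close>; only \<open>1 + u \<le> exp u\<close> is used. It turns deviations of degrees
  into additive errors of survival probabilities.\<close>

lemma exp_minus_lipschitz:
  fixes x y :: real
  assumes "0 \<le> x" "0 \<le> y"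
  shows "exp (- x) \<le> exp (- y) + \<bar>x - y\<bar>"
proof (cases "y \<le> x")
  case True
  then have "exp (- x) \<le> exp (- y)" by simp
  then show ?thesis by linarith
next
  case False
  have "exp (- x) * (1 - (y - x)) \<le> exp (- x) * exp (- (y - x))"
    using exp_ge_add_one_self[of "- (y - x)"] by (intro mult_left_mono) (linarith, simp)
  also have "\<dots> = exp (- y)" by (simp add: mult_exp_exp)
  finally have "exp (- x) \<le> exp (- y) + exp (- x) * (y - x)" by (simp add: algebra_simps)
  also have "exp (- x) * (y - x) \<le> 1 * (y - x)"
    using False assms by (intro mult_right_mono) auto
  finally show ?thesis using False by simp
qed

section \<open>Edges meeting a vertex set in a linear hypergraph\<close>

definition meeting :: "'v set set \<Rightarrow> 'v set \<Rightarrow> 'v set set" where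
  "meeting E A = {f \<in> E. f \<inter> A \<noteq> {}}"

lemma linear_hypergraph_finite:
  assumes "linear_hypergraph d V E"
  shows "finite V" "finite E" "\<And>e. e \<in> E \<Longrightarrow> e \<subseteq> V \<and> card e = d \<and> finite e"
proof -
  show V: "finite V" using assms by (simp add: linear_hypergraph_def uniform_hypergraph_def)
  show *: "\<And>e. e \<in> E \<Longrightarrow> e \<subseteq> V \<and> card e = d \<and> finite e"
    using assms finite_subset[OF _ V] by (simp add: linear_hypergraph_def uniform_hypergraph_def)
  have "E \<subseteq> Pow V" using * by auto
  then show "finite E" by (rule finite_subset) (simp add: V)
qed

lemma codegree_le_one:
  assumes lin: "linear_hypergraph d V E" and "v \<noteq> w"
  shows "card {f \<in> E. v \<in> f \<and> w \<in> f} \<le> 1"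
proof -
  have "e = f" if "e \<in> E" "f \<in> E" "v \<in> e" "w \<in> e" "v \<in> f" "w \<in> f" for e f
  proof (rule ccontr)
    assume "e \<noteq> f"
    then have "card (e \<inter> f) \<le> 1" using lin that by (auto simp: linear_hypergraph_def)
    moreover have "{v, w} \<subseteq> e \<inter> f" "finite (e \<inter> f)"
      using that linear_hypergraph_finite(3)[OF lin] by auto
    then have "card {v, w} \<le> card (e \<inter> f)" by (rule card_mono[rotated])
    ultimately show False using \<open>v \<noteq> w\<close> by simp
  qed
  moreover have "finite {f \<in> E. v \<in> f \<and> w \<in> f}" using linear_hypergraph_finite(2)[OF lin] by simp
  ultimately show ?thesis by (simp add: card_le_Suc0_iff_eq)
qed

text \<open>The degree sum counts an edge once for each of its points in \<open>A\<close>. As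
  codegrees are at most 1, the excess is at most one for each pair of points of \<open>A\<close>,
  crudely \<open>card A * card A\<close>.\<close>

lemma meeting_bounds:
  assumes lin: "linear_hypergraph d V E" and A: "finite A"
  shows "card (meeting E A) \<le> (\<Sum>w\<in>A. hdeg E w)"
    and "(\<Sum>w\<in>A. hdeg E w) \<le> card (meeting E A) + card A * card A"
proof -
  have finE: "finite E" using linear_hypergraph_finite(2)[OF lin] .
  have "card (meeting E A) \<le> (\<Sum>w\<in>A. hdeg E w) \<and>
        (\<Sum>w\<in>A. hdeg E w) \<le> card (meeting E A) + card A * card A"
    using A
  proof (induction A)
    case empty
    then show ?case by (simp add: meeting_def)
  next
    case (insert x A)
    let ?I = "{f \<in> E. x \<in> f}"
    have un: "meeting E (insert x A) = meeting E A \<union> ?I"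
      by (auto simp: meeting_def)
    have fin: "finite (meeting E A)" "finite ?I" using finE by (auto simp: meeting_def)
    have eq: "meeting E A \<inter> ?I = (\<Union>w\<in>A. {f \<in> E. x \<in> f \<and> w \<in> f})"
      unfolding meeting_def by blast
    have "card (meeting E A \<inter> ?I) \<le> (\<Sum>w\<in>A. card {f \<in> E. x \<in> f \<and> w \<in> f})"
      unfolding eq by (rule card_UN_le[OF \<open>finite A\<close>])
    also have "\<dots> \<le> (\<Sum>w\<in>A. 1)"
      by (intro sum_mono codegree_le_one[OF lin]) (use insert in auto)
    finally have i: "card (meeting E A \<inter> ?I) \<le> card A" by simp
    have "card (meeting E A) + card ?I = card (meeting E A \<union> ?I) + card (meeting E A \<inter> ?I)"
      by (rule card_Un_Int[OF fin])
    with i insert un show ?case by (simp add: hdeg_def)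
  qed
  then show "card (meeting E A) \<le> (\<Sum>w\<in>A. hdeg E w)"
    and "(\<Sum>w\<in>A. hdeg E w) \<le> card (meeting E A) + card A * card A" by auto
qed

lemma sum_incidences:
  assumes "finite V" "finite E" "\<And>e. e \<in> E \<Longrightarrow> e \<subseteq> V"
  shows "(\<Sum>v\<in>V. \<Sum>e | e \<in> E \<and> v \<in> e. g e) = (\<Sum>e\<in>E. of_nat (card e) * (g e :: real))"
    and "(\<Sum>e\<in>E. \<Sum>v\<in>e. h v) = (\<Sum>v\<in>V. of_nat (hdeg E v) * (h v :: real))"
proof -
  have "(\<Sum>v\<in>V. \<Sum>e | e \<in> E \<and> v \<in> e. g e) = (\<Sum>e\<in>E. \<Sum>v | v \<in> V \<and> v \<in> e. g e)"
    by (rule sum.swap_restrict) (use assms in auto)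
  also have "\<dots> = (\<Sum>e\<in>E. of_nat (card e) * g e)"
  proof (rule sum.cong[OF refl])
    fix e assume "e \<in> E"
    then have "{v. v \<in> V \<and> v \<in> e} = e" using assms by auto
    then show "(\<Sum>v | v \<in> V \<and> v \<in> e. g e) = of_nat (card e) * g e" by simp
  qed
  finally show "(\<Sum>v\<in>V. \<Sum>e | e \<in> E \<and> v \<in> e. g e) = (\<Sum>e\<in>E. of_nat (card e) * g e)" .
  have "(\<Sum>e\<in>E. \<Sum>v\<in>e. h v) = (\<Sum>e\<in>E. \<Sum>v | v \<in> V \<and> v \<in> e. h v)"
  proof (rule sum.cong[OF refl])
    fix e assume "e \<in> E"
    then have "{v. v \<in> V \<and> v \<in> e} = e" using assms by auto
    then show "(\<Sum>v\<in>e. h v) = (\<Sum>v | v \<in> V \<and> v \<in> e. h v)" by simp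
  qed
  also have "\<dots> = (\<Sum>v\<in>V. \<Sum>e | e \<in> E \<and> v \<in> e. h v)"
    by (rule sum.swap_restrict[symmetric]) (use assms in auto)
  finally show "(\<Sum>e\<in>E. \<Sum>v\<in>e. h v) = (\<Sum>v\<in>V. of_nat (hdeg E v) * h v)"
    by (simp add: hdeg_def)
qed

section \<open>Expectations in a single nibble\<close>

text \<open>One nibble picks each edge with probability \<open>1 - exp (- \<eta> / D)\<close>, so that a set of vertices met by
  \<open>j\<close> edges is avoided with probability exactly \<open>exp (- \<eta> * j / D)\<close>. All vertices in picked edges are
  discarded, and those in clashing picked edges are lost.\<close>

locale nibble_step =
  fixes V :: "'v set" and E :: "'v set set" and d :: nat and D \<eta> K :: real
  assumes lin: "linear_hypergraph d V E" and D_pos: "D > 0" and eps_pos: "\<eta> > 0"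
    and d_pos: "d \<ge> 1" and K_nonneg: "K \<ge> 0" and deg_le: "\<And>v. v \<in> V \<Longrightarrow> real (hdeg E v) \<le> K * D"
begin

lemmas fin = linear_hypergraph_finite[OF lin]

definition dev :: "'v \<Rightarrow> real" where "dev v = hdeg E v / D - 1"

definition expect :: "('v set set \<Rightarrow> real) \<Rightarrow> real" where
  "expect f = bern (\<lambda>_. 1 - exp (- (\<eta> / D))) E f"

definition rest :: "'v set set \<Rightarrow> 'v set set" where
  "rest X = {f \<in> E. f \<inter> \<Union>X = {}}"

lemma prob_bounds: "0 \<le> 1 - exp (- (\<eta> / D)) \<and> 1 - exp (- (\<eta> / D)) \<le> 1"
  using D_pos eps_pos by simp

lemma expect_avoid:
  "expect (\<lambda>X. of_bool (A \<inter> \<Union>X = {})) = exp (- (\<eta> * (card (meeting E A) / D)))"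
proof -
  have "expect (\<lambda>X. of_bool (A \<inter> \<Union>X = {}))
      = bern (\<lambda>_. 1 - exp (- (\<eta> / D))) E (\<lambda>X. of_bool ({} \<subseteq> X \<and> X \<inter> meeting E A = {}))"
    unfolding expect_def
  proof (rule bern_cong)
    fix X assume "X \<subseteq> E"
    then have "(A \<inter> \<Union>X = {}) = ({} \<subseteq> X \<and> X \<inter> meeting E A = {})"
      by (auto simp: meeting_def)
    then show "of_bool (A \<inter> \<Union>X = {}) = (of_bool ({} \<subseteq> X \<and> X \<inter> meeting E A = {}) :: real)"
      by simp
  qed
  also have "\<dots> = exp (- (\<eta> / D)) ^ card (meeting E A)"
    by (subst bern_avoid) (auto simp: fin meeting_def)
  also have "\<dots> = exp (- (\<eta> * (card (meeting E A) / D)))"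
    by (simp add: exp_of_nat_mult[symmetric])
  finally show ?thesis .
qed

lemma meeting_dev:
  assumes "finite A"
  shows "card (meeting E A) / D \<le> card A + (\<Sum>w\<in>A. dev w)"
    and "card A + (\<Sum>w\<in>A. dev w) \<le> card (meeting E A) / D + card A * card A / D"
proof -
  have eq: "card A + (\<Sum>w\<in>A. dev w) = (\<Sum>w\<in>A. hdeg E w) / D"
    by (simp add: dev_def sum_subtractf sum_divide_distrib)
  have "real (card (meeting E A)) \<le> real (\<Sum>w\<in>A. hdeg E w)"
    using meeting_bounds(1)[OF lin assms] by linarith
  then show "card (meeting E A) / D \<le> card A + (\<Sum>w\<in>A. dev w)"
    unfolding eq using D_pos by (simp add: divide_right_mono)
  have "real (\<Sum>w\<in>A. hdeg E w) \<le> real (card (meeting E A) + card A * card A)"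
    using meeting_bounds(2)[OF lin assms] by linarith
  then have "real (\<Sum>w\<in>A. hdeg E w) / D \<le> real (card (meeting E A) + card A * card A) / D"
    using D_pos by (simp add: divide_right_mono)
  then show "card A + (\<Sum>w\<in>A. dev w) \<le> card (meeting E A) / D + card A * card A / D"
    unfolding eq by (simp add: add_divide_distrib)
qed

text \<open>The exponential is the value for a \<open>D\<close>-regular hypergraph in which no edge
  meets \<open>A\<close> twice. The last term pays for edges that do: they lower the number of edges
  able to hit \<open>A\<close>.\<close>

lemma expect_avoid_upper:
  assumes "finite A"
  shows "expect (\<lambda>X. of_bool (A \<inter> \<Union>X = {}))
    \<le> exp (- (\<eta> * card A)) + \<eta> * (\<Sum>w\<in>A. \<bar>dev w\<bar>) + \<eta> * (card A * card A / D)"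
proof -
  let ?m = "card (meeting E A) / D"
  have "exp (- (\<eta> * ?m)) \<le> exp (- (\<eta> * card A)) + \<bar>\<eta> * ?m - \<eta> * card A\<bar>"
    by (rule exp_minus_lipschitz) (use D_pos eps_pos in auto)
  also have "\<bar>\<eta> * ?m - \<eta> * card A\<bar> = \<eta> * \<bar>?m - card A\<bar>"
    using eps_pos by (simp only: abs_mult abs_of_pos right_diff_distrib[symmetric])
  also have "\<bar>?m - card A\<bar> \<le> (\<Sum>w\<in>A. \<bar>dev w\<bar>) + card A * card A / D"
    using meeting_dev[OF assms] sum_abs[of dev A] D_pos by (auto simp: abs_le_iff)
  finally show ?thesis
    using eps_pos by (simp add: expect_avoid algebra_simps)
qed

text \<open>No quadratic error here: edges meeting \<open>A\<close> repeatedly can only make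
  avoidance more likely.\<close>

lemma expect_avoid_lower:
  assumes "finite A"
  shows "exp (- (\<eta> * card A)) - \<eta> * (\<Sum>w\<in>A. \<bar>dev w\<bar>) \<le> expect (\<lambda>X. of_bool (A \<inter> \<Union>X = {}))"
proof -
  let ?m = "card (meeting E A) / D" and ?s = "card A + (\<Sum>w\<in>A. dev w)"
  have "?m \<ge> 0" using D_pos by simp
  then have s: "?s \<ge> 0" "?m \<le> ?s" using meeting_dev(1)[OF assms] by linarith+
  have "exp (- (\<eta> * card A)) \<le> exp (- (\<eta> * ?s)) + \<bar>\<eta> * card A - \<eta> * ?s\<bar>"
    by (rule exp_minus_lipschitz) (use s eps_pos in auto)
  also have "\<bar>\<eta> * card A - \<eta> * ?s\<bar> = \<eta> * \<bar>\<Sum>w\<in>A. dev w\<bar>"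
    using eps_pos by (simp add: abs_mult flip: right_diff_distrib)
  also have "\<bar>\<Sum>w\<in>A. dev w\<bar> \<le> (\<Sum>w\<in>A. \<bar>dev w\<bar>)" by (rule sum_abs)
  also have "exp (- (\<eta> * ?s)) \<le> exp (- (\<eta> * ?m))"
    unfolding exp_le_cancel_iff neg_le_iff_le by (intro mult_left_mono s) (use eps_pos in simp)
  finally show ?thesis using eps_pos by (simp add: expect_avoid)
qed

text \<open>Exactly \<open>hdeg E v\<close> edges meet a single point, so only the deviation of that
  degree enters.\<close>

lemma expect_avoid_single:
  "expect (\<lambda>X. of_bool ({v} \<inter> \<Union>X = {})) \<le> exp (- \<eta>) + \<eta> * \<bar>dev v\<bar>"
proof -
  have "expect (\<lambda>X. of_bool ({v} \<inter> \<Union>X = {})) = exp (- (\<eta> * (hdeg E v / D)))"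
    by (simp only: expect_avoid hdeg_def meeting_def) (simp add: Int_commute)
  also have "\<dots> \<le> exp (- \<eta>) + \<bar>\<eta> * (hdeg E v / D) - \<eta>\<bar>"
    by (rule exp_minus_lipschitz) (use eps_pos D_pos in auto)
  also have "\<bar>\<eta> * (hdeg E v / D) - \<eta>\<bar> = \<eta> * \<bar>dev v\<bar>"
  proof -
    have "\<eta> * (hdeg E v / D) - \<eta> = \<eta> * dev v" by (simp add: dev_def algebra_simps)
    then show ?thesis using eps_pos by (simp add: abs_mult)
  qed
  finally show ?thesis .
qed

text \<open>Once \<open>v\<close> survives, an edge through \<open>v\<close> survives if its other
  \<open>d - 1\<close> points do, with probability about \<open>s\<close>; so the new degree should
  be near \<open>s * D\<close>. In the expanded square the main terms recombine to
  \<open>exp (- \<eta>)\<close> times the old squared deviation, so irregularity does not grow. What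
  remains is linear in the deviations or of order \<open>1 / D\<close>.\<close>

lemma expect_vertex:
  assumes v: "v \<in> V"
  defines "s \<equiv> exp (- (\<eta> * (real d - 1)))" and "I \<equiv> {f \<in> E. v \<in> f}"
  defines "Z \<equiv> (\<Sum>f\<in>I. \<Sum>w\<in>f. \<bar>dev w\<bar>)"
  shows "expect (\<lambda>X. of_bool ({v} \<inter> \<Union>X = {}) * (hdeg (rest X) v / (s * D) - 1)\<^sup>2)
    \<le> (dev v)\<^sup>2 + Z * ((2 * \<eta> * K / s\<^sup>2 + 2 * \<eta> / s) / D)
      + (4 * \<eta> * d\<^sup>2 * K\<^sup>2 + K) / (s\<^sup>2 * D) + \<eta> * \<bar>dev v\<bar>"
proof -
  define n where "n = hdeg E v"
  define Y where "Y f = (\<Sum>w\<in>f. \<bar>dev w\<bar>)" for f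
  let ?a = "\<lambda>A X. of_bool (A \<inter> \<Union>X = {}) :: real"
  have s: "s > 0" by (simp add: s_def)
  have finI: "finite I" and cardI: "card I = n" using fin by (auto simp: I_def n_def hdeg_def)
  have I: "f \<in> E" "v \<in> f" "finite f" "card f = d" if "f \<in> I" for f
    using that fin by (auto simp: I_def)
  have n_le: "n \<le> K * D" using deg_le[OF v] by (simp add: n_def)
  have Y0: "Y f \<ge> 0" for f by (simp add: Y_def sum_nonneg)
  \<comment> \<open>An edge through \<open>v\<close> avoiding the picked edges forces
    \<open>v\<close> to avoid them, so the indicator of \<open>v\<close> is absorbed on the
    right.\<close>
  have deg: "?a {v} X * real (hdeg (rest X) v) = (\<Sum>f\<in>I. ?a f X)" for X
  proof (cases "v \<in> \<Union>X")
    case True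
    then have "?a f X = 0" if "f \<in> I" for f using I(2)[OF that] by auto
    then have "(\<Sum>f\<in>I. ?a f X) = 0" by (intro sum.neutral) auto
    with True show ?thesis by simp
  next
    case False
    have "{f \<in> rest X. v \<in> f} = {f \<in> I. f \<inter> \<Union>X = {}}" by (auto simp: I_def rest_def)
    then show ?thesis using False finI by (simp add: hdeg_def of_bool_def sum.If_cases Int_def)
  qed
  have expand: "of_bool ({v} \<inter> \<Union>X = {}) * (hdeg (rest X) v / (s * D) - 1)\<^sup>2
      = 1 / (s\<^sup>2 * D\<^sup>2) * (\<Sum>f\<in>I. \<Sum>g\<in>I. ?a (f \<union> g) X) - 2 / (s * D) * (\<Sum>f\<in>I. ?a f X) + ?a {v} X" for X
  proof -
    let ?b = "?a {v} X" and ?h = "real (hdeg (rest X) v)"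
    have b: "?b * ?b = ?b" by (cases "v \<in> \<Union>X") auto
    have "(\<Sum>f\<in>I. \<Sum>g\<in>I. ?a (f \<union> g) X) = (\<Sum>f\<in>I. ?a f X) * (\<Sum>g\<in>I. ?a g X)"
      by (auto simp: sum_product of_bool_conj[symmetric] intro!: sum.cong arg_cong[where f=of_bool])
    also have "\<dots> = ?b * (?h * ?h)" unfolding deg[symmetric] using b by (metis mult.assoc mult.left_commute)
    finally have "1 / (s\<^sup>2 * D\<^sup>2) * (\<Sum>f\<in>I. \<Sum>g\<in>I. ?a (f \<union> g) X) - 2 / (s * D) * (\<Sum>f\<in>I. ?a f X) + ?b
      = 1 / (s\<^sup>2 * D\<^sup>2) * (?b * (?h * ?h)) - 2 / (s * D) * (?b * ?h) + ?b"
      unfolding deg[symmetric] by simp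
    also have "\<dots> = ?b * (?h / (s * D) - 1)\<^sup>2"
      using s D_pos by (simp add: power2_eq_square field_simps)
    finally show ?thesis by simp
  qed
  \<comment> \<open>Distinct edges through \<open>v\<close> share nothing else, so their union has
    \<open>2 * d - 1\<close> points. The diagonal gets the trivial bound 1.\<close>
  have pair: "expect (?a (f \<union> g)) \<le> exp (- (\<eta> * (2 * real d - 1))) + \<eta> * (Y f + Y g) + 4 * \<eta> * d\<^sup>2 / D + of_bool (f = g)"
    if f: "f \<in> I" and g: "g \<in> I" for f g
  proof (cases "f = g")
    case True
    have "expect (?a (f \<union> g)) \<le> 1"
      using eps_pos D_pos by (simp add: expect_avoid)
    moreover have "0 \<le> exp (- (\<eta> * (2 * real d - 1))) + \<eta> * (Y f + Y g) + 4 * \<eta> * d\<^sup>2 / D"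
      using eps_pos D_pos Y0 by (intro add_nonneg_nonneg mult_nonneg_nonneg divide_nonneg_nonneg) auto
    ultimately show ?thesis using True by simp
  next
    case False
    have "card (f \<inter> g) \<le> 1" using lin False I[OF f] I[OF g] by (auto simp: linear_hypergraph_def)
    moreover have "card (f \<inter> g) > 0" using I[OF f] I[OF g] by (auto simp: card_gt_0_iff)
    ultimately have "card (f \<union> g) = 2 * d - 1"
      using card_Un_Int[of f g] I[OF f] I[OF g] by simp
    then have c: "real (card (f \<union> g)) = 2 * real d - 1" using d_pos by (simp add: of_nat_diff)
    have "card (f \<union> g) \<le> 2 * d" using \<open>card (f \<union> g) = 2 * d - 1\<close> by simp
    then have "card (f \<union> g) * card (f \<union> g) \<le> (2 * d) * (2 * d)" by (intro mult_mono) auto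
    then have "real (card (f \<union> g) * card (f \<union> g)) \<le> real ((2 * d) * (2 * d))" by linarith
    then have c2: "\<eta> * (card (f \<union> g) * card (f \<union> g) / D) \<le> 4 * \<eta> * d\<^sup>2 / D"
      using eps_pos D_pos by (simp add: field_simps power2_eq_square)
    have "(\<Sum>w\<in>f \<union> g. \<bar>dev w\<bar>) \<le> Y f + Y g"
      unfolding Y_def using I[OF f] I[OF g] by (subst sum.union_inter[symmetric]) (auto intro: sum_nonneg)
    then have "\<eta> * (\<Sum>w\<in>f \<union> g. \<bar>dev w\<bar>) \<le> \<eta> * (Y f + Y g)"
      using eps_pos by simp
    then show ?thesis
      using expect_avoid_upper[of "f \<union> g"] I[OF f] I[OF g] False c2 by (simp add: c)
  qed
  have pairs: "(\<Sum>f\<in>I. \<Sum>g\<in>I. expect (?a (f \<union> g)))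
      \<le> exp (- (\<eta> * (2 * real d - 1))) * n\<^sup>2 + 2 * \<eta> * n * Z + 4 * \<eta> * d\<^sup>2 / D * n\<^sup>2 + n"
  proof -
    have "(\<Sum>f\<in>I. \<Sum>g\<in>I. expect (?a (f \<union> g)))
      \<le> (\<Sum>f\<in>I. \<Sum>g\<in>I. exp (- (\<eta> * (2 * real d - 1))) + \<eta> * (Y f + Y g) + 4 * \<eta> * d\<^sup>2 / D + of_bool (f = g))"
      by (intro sum_mono pair)
    also have "\<dots> = exp (- (\<eta> * (2 * real d - 1))) * n\<^sup>2 + 2 * \<eta> * n * Z + 4 * \<eta> * d\<^sup>2 / D * n\<^sup>2 + n"
      using finI by (simp add: sum.distrib cardI Z_def Y_def[symmetric] sum_distrib_left[symmetric]
          distrib_left power2_eq_square of_bool_def sum.delta' algebra_simps)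
    finally show ?thesis .
  qed
  have singles: "exp (- (\<eta> * d)) * n - \<eta> * Z \<le> (\<Sum>f\<in>I. expect (?a f))"
  proof -
    have "exp (- (\<eta> * d)) * n - \<eta> * Z = (\<Sum>f\<in>I. exp (- (\<eta> * d)) - \<eta> * Y f)"
      by (simp add: sum_subtractf cardI Z_def Y_def sum_distrib_left)
    also have "\<dots> \<le> (\<Sum>f\<in>I. expect (?a f))"
    proof (rule sum_mono)
      fix f assume f: "f \<in> I"
      show "exp (- (\<eta> * d)) - \<eta> * Y f \<le> expect (?a f)"
        using expect_avoid_lower[OF I(3)[OF f]] unfolding I(4)[OF f] Y_def .
    qed
    finally show ?thesis .
  qed
  have one: "expect (?a {v}) \<le> exp (- \<eta>) + \<eta> * \<bar>dev v\<bar>" by (rule expect_avoid_single)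
  have Z0: "Z \<ge> 0" by (simp add: Z_def sum_nonneg)
  \<comment> \<open>With these factorisations all three main terms carry
    \<open>exp (- \<eta>)\<close> and add up to
    \<open>exp (- \<eta>) * (n / D - 1)^2\<close>.\<close>
  have e1: "exp (- (\<eta> * (2 * real d - 1))) = exp (- \<eta>) * s\<^sup>2" and e2: "exp (- (\<eta> * d)) = exp (- \<eta>) * s"
    by (simp_all add: s_def power2_eq_square mult_exp_exp algebra_simps)
  have "expect (\<lambda>X. of_bool ({v} \<inter> \<Union>X = {}) * (hdeg (rest X) v / (s * D) - 1)\<^sup>2)
     = 1 / (s\<^sup>2 * D\<^sup>2) * (\<Sum>f\<in>I. \<Sum>g\<in>I. expect (?a (f \<union> g))) - 2 / (s * D) * (\<Sum>f\<in>I. expect (?a f)) + expect (?a {v})"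
    unfolding expand expect_def by (simp only: bern_add bern_diff bern_cmult bern_sum)
  also have "\<dots> \<le> 1 / (s\<^sup>2 * D\<^sup>2) * (exp (- (\<eta> * (2 * real d - 1))) * n\<^sup>2 + 2 * \<eta> * n * Z + 4 * \<eta> * d\<^sup>2 / D * n\<^sup>2 + n)
     - 2 / (s * D) * (exp (- (\<eta> * d)) * n - \<eta> * Z) + (exp (- \<eta>) + \<eta> * \<bar>dev v\<bar>)"
    by (intro add_mono diff_mono mult_left_mono pairs singles one) (use s D_pos in auto)
  also have "\<dots> = exp (- \<eta>) * (dev v)\<^sup>2 + Z * ((2 * \<eta> * (n / D) / s\<^sup>2 + 2 * \<eta> / s) / D)
      + (4 * \<eta> * d\<^sup>2 * (n / D)\<^sup>2 + n / D) / (s\<^sup>2 * D) + \<eta> * \<bar>dev v\<bar>"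
    unfolding e1 e2 dev_def n_def[symmetric] using s D_pos by (simp add: field_simps power2_eq_square)
  also have "\<dots> \<le> (dev v)\<^sup>2 + Z * ((2 * \<eta> * K / s\<^sup>2 + 2 * \<eta> / s) / D)
      + (4 * \<eta> * d\<^sup>2 * K\<^sup>2 + K) / (s\<^sup>2 * D) + \<eta> * \<bar>dev v\<bar>"
  proof -
    have nD: "n / D \<le> K" "0 \<le> n / D" using n_le D_pos by (auto simp: field_simps)
    have "exp (- \<eta>) * (dev v)\<^sup>2 \<le> 1 * (dev v)\<^sup>2" using eps_pos by (intro mult_right_mono) auto
    then show ?thesis
      using nD s D_pos eps_pos Z0
      by (intro add_mono mult_left_mono divide_right_mono power_mono mult_nonneg_nonneg) auto
  qed
  finally show ?thesis .
qed

lemma irregularity_dev: "irregularity V E D = (\<Sum>v\<in>V. (dev v)\<^sup>2)"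
  by (simp add: irregularity_def dev_def)

text \<open>The errors collected along edges are summed by double counting: a vertex passes its
  deviation on through at most \<open>K * D\<close> edges, to \<open>d\<close> vertices each, which
  cancels the factor \<open>1 / D\<close> in front.\<close>

lemma expect_irregularity:
  defines "s \<equiv> exp (- (\<eta> * (real d - 1)))"
  shows "expect (\<lambda>X. irregularity (V - \<Union>X) (rest X) (s * D))
    \<le> irregularity V E D + (\<Sum>v\<in>V. \<bar>dev v\<bar>) * (\<eta> + d * K * (2 * \<eta> * K / s\<^sup>2 + 2 * \<eta> / s))
      + card V * ((4 * \<eta> * d\<^sup>2 * K\<^sup>2 + K) / (s\<^sup>2 * D))"
proof -
  define c where "c = 2 * \<eta> * K / s\<^sup>2 + 2 * \<eta> / s"
  define c' where "c' = (4 * \<eta> * d\<^sup>2 * K\<^sup>2 + K) / (s\<^sup>2 * D)"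
  define Z where "Z v = (\<Sum>f | f \<in> E \<and> v \<in> f. \<Sum>w\<in>f. \<bar>dev w\<bar>)" for v
  define Y where "Y = (\<Sum>v\<in>V. \<bar>dev v\<bar>)"
  have s: "s > 0" by (simp add: s_def)
  have c: "c \<ge> 0" using eps_pos K_nonneg s by (simp add: c_def)
  have "irregularity (V - \<Union>X) (rest X) (s * D)
      = (\<Sum>v\<in>V. of_bool ({v} \<inter> \<Union>X = {}) * (hdeg (rest X) v / (s * D) - 1)\<^sup>2)" for X
    unfolding irregularity_def
    by (rule sum.mono_neutral_cong_left) (use fin in auto)
  then have "expect (\<lambda>X. irregularity (V - \<Union>X) (rest X) (s * D))
     = (\<Sum>v\<in>V. expect (\<lambda>X. of_bool ({v} \<inter> \<Union>X = {}) * (hdeg (rest X) v / (s * D) - 1)\<^sup>2))"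
    unfolding expect_def by (simp only: bern_sum)
  also have "\<dots> \<le> (\<Sum>v\<in>V. (dev v)\<^sup>2 + Z v * (c / D) + c' + \<eta> * \<bar>dev v\<bar>)"
    unfolding c_def c'_def s_def Z_def by (intro sum_mono expect_vertex)
  also have "\<dots> = irregularity V E D + (\<Sum>v\<in>V. Z v) * (c / D) + card V * c' + \<eta> * Y"
    by (simp add: sum.distrib irregularity_dev Y_def sum_distrib_left sum_distrib_right sum_divide_distrib)
  also have "(\<Sum>v\<in>V. Z v) = (\<Sum>f\<in>E. real (card f) * (\<Sum>w\<in>f. \<bar>dev w\<bar>))"
    unfolding Z_def by (rule sum_incidences(1)) (use fin in auto)
  also have "\<dots> = d * (\<Sum>f\<in>E. \<Sum>w\<in>f. \<bar>dev w\<bar>)"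
    unfolding sum_distrib_left by (rule sum.cong) (use fin in auto)
  also have "(\<Sum>f\<in>E. \<Sum>w\<in>f. \<bar>dev w\<bar>) = (\<Sum>v\<in>V. real (hdeg E v) * \<bar>dev v\<bar>)"
    by (rule sum_incidences(2)) (use fin in auto)
  also have "irregularity V E D + d * (\<Sum>v\<in>V. real (hdeg E v) * \<bar>dev v\<bar>) * (c / D) + card V * c' + \<eta> * Y
      \<le> irregularity V E D + d * (K * D * Y) * (c / D) + card V * c' + \<eta> * Y"
  proof -
    have "(\<Sum>v\<in>V. real (hdeg E v) * \<bar>dev v\<bar>) \<le> K * D * Y"
      unfolding Y_def sum_distrib_left by (intro sum_mono mult_right_mono deg_le) auto
    then have "d * (\<Sum>v\<in>V. real (hdeg E v) * \<bar>dev v\<bar>) * (c / D) \<le> d * (K * D * Y) * (c / D)"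
      using c D_pos by (intro mult_right_mono mult_left_mono) auto
    then show ?thesis by linarith
  qed
  also have "\<dots> = irregularity V E D + Y * (\<eta> + d * K * c) + card V * c'"
    using D_pos by (simp add: field_simps)
  finally show ?thesis unfolding c_def c'_def Y_def .
qed

lemma expect_rest_size:
  "expect (\<lambda>X. real (card (V - \<Union>X))) \<le> exp (- \<eta>) * card V + \<eta> * (\<Sum>v\<in>V. \<bar>dev v\<bar>)"
proof -
  have "real (card (V - \<Union>X)) = (\<Sum>v\<in>V. of_bool ({v} \<inter> \<Union>X = {}))" for X
  proof -
    have "(\<Sum>v\<in>V - \<Union>X. 1) = (\<Sum>v\<in>V. of_bool ({v} \<inter> \<Union>X = {}) :: real)"
      by (rule sum.mono_neutral_cong_left) (use fin in auto)
    then show ?thesis by simp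
  qed
  then have "expect (\<lambda>X. real (card (V - \<Union>X))) = (\<Sum>v\<in>V. expect (\<lambda>X. of_bool ({v} \<inter> \<Union>X = {})))"
    unfolding expect_def by (simp only: bern_sum)
  also have "\<dots> \<le> (\<Sum>v\<in>V. exp (- \<eta>) + \<eta> * \<bar>dev v\<bar>)"
    by (intro sum_mono expect_avoid_single)
  also have "\<dots> = exp (- \<eta>) * card V + \<eta> * (\<Sum>v\<in>V. \<bar>dev v\<bar>)"
    by (simp add: sum.distrib sum_distrib_left)
  finally show ?thesis .
qed

definition clashes :: "('v set \<times> 'v set) set" where
  "clashes = {(e, f). e \<in> E \<and> f \<in> E \<and> e \<noteq> f \<and> e \<inter> f \<noteq> {}}"

lemma finite_clashes: "finite clashes"
  by (rule finite_subset[of _ "E \<times> E"]) (use fin in \<open>auto simp: clashes_def\<close>)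

text \<open>Clashing edges share a vertex, so the ordered clashes number at most the sum of the
  squared degrees, and each is picked with probability at most the square of
  \<open>\<eta> / D\<close>. The loss is quadratic in \<open>\<eta>\<close> while the progress of a
  step is linear; hence short steps lose little.\<close>

lemma expect_clashes:
  "expect (\<lambda>X. real (card {(e, f) \<in> clashes. e \<in> X \<and> f \<in> X})) \<le> \<eta>\<^sup>2 * (2 * card V + 2 * irregularity V E D)"
proof -
  let ?p = "1 - exp (- (\<eta> / D))"
  have "real (card {(e, f) \<in> clashes. e \<in> X \<and> f \<in> X}) = (\<Sum>x\<in>clashes. of_bool (fst x \<in> X \<and> snd x \<in> X))" for X
  proof -
    have "{(e, f) \<in> clashes. e \<in> X \<and> f \<in> X} = clashes \<inter> {x. fst x \<in> X \<and> snd x \<in> X}" by auto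
    then show ?thesis using finite_clashes by (simp add: of_bool_def sum.If_cases)
  qed
  then have "expect (\<lambda>X. real (card {(e, f) \<in> clashes. e \<in> X \<and> f \<in> X}))
    = (\<Sum>x\<in>clashes. expect (\<lambda>X. of_bool (fst x \<in> X \<and> snd x \<in> X)))"
    unfolding expect_def by (simp only: bern_sum)
  also have "\<dots> = (\<Sum>x\<in>clashes. ?p\<^sup>2)"
  proof (rule sum.cong[OF refl])
    fix x assume x: "x \<in> clashes"
    have "expect (\<lambda>X. of_bool (fst x \<in> X \<and> snd x \<in> X))
       = bern (\<lambda>_. ?p) E (\<lambda>X. of_bool ({fst x, snd x} \<subseteq> X \<and> X \<inter> {} = {}))"
      unfolding expect_def by simp
    also have "\<dots> = ?p ^ card {fst x, snd x}"
      using x by (subst bern_avoid) (auto simp: fin clashes_def)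
    also have "card {fst x, snd x} = 2"
      using x by (simp add: clashes_def case_prod_beta)
    finally show "expect (\<lambda>X. of_bool (fst x \<in> X \<and> snd x \<in> X)) = ?p\<^sup>2" .
  qed
  also have "\<dots> = card clashes * ?p\<^sup>2" by simp
  also have "\<dots> \<le> (\<Sum>v\<in>V. (real (hdeg E v))\<^sup>2) * (\<eta> / D)\<^sup>2"
  proof (rule mult_mono)
    have "?p \<le> \<eta> / D" using exp_ge_add_one_self[of "- (\<eta> / D)"] by linarith
    then show "?p\<^sup>2 \<le> (\<eta> / D)\<^sup>2" using prob_bounds by (intro power_mono) auto
    let ?I = "\<lambda>v. {f \<in> E. v \<in> f}"
    have "clashes \<subseteq> (\<Union>v\<in>V. ?I v \<times> ?I v)"
    proof
      fix x assume "x \<in> clashes"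
      then obtain v where v: "fst x \<in> E" "snd x \<in> E" "v \<in> fst x" "v \<in> snd x"
        by (auto simp: clashes_def)
      then have "v \<in> V" using fin(3) by blast
      with v show "x \<in> (\<Union>v\<in>V. ?I v \<times> ?I v)" by (auto simp: mem_Times_iff)
    qed
    then have "card clashes \<le> card (\<Union>v\<in>V. ?I v \<times> ?I v)"
      by (intro card_mono) (use fin in auto)
    also have "\<dots> \<le> (\<Sum>v\<in>V. card (?I v \<times> ?I v))" by (rule card_UN_le[OF fin(1)])
    also have "\<dots> = (\<Sum>v\<in>V. (hdeg E v)\<^sup>2)" by (simp add: hdeg_def power2_eq_square card_cartesian_product)
    finally have "real (card clashes) \<le> real (\<Sum>v\<in>V. (hdeg E v)\<^sup>2)" by linarith
    then show "real (card clashes) \<le> (\<Sum>v\<in>V. (real (hdeg E v))\<^sup>2)" by simp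
  qed (auto intro: sum_nonneg)
  also have "\<dots> = \<eta>\<^sup>2 * (\<Sum>v\<in>V. (1 + dev v)\<^sup>2)"
    by (simp add: dev_def power_divide sum_divide_distrib[symmetric])
  also have "\<dots> \<le> \<eta>\<^sup>2 * (\<Sum>v\<in>V. 2 + 2 * (dev v)\<^sup>2)"
  proof (intro mult_left_mono sum_mono)
    fix v show "(1 + dev v)\<^sup>2 \<le> 2 + 2 * (dev v)\<^sup>2"
      using zero_le_power2[of "1 - dev v"] by (simp add: power2_eq_square algebra_simps)
  qed simp
  also have "\<dots> = \<eta>\<^sup>2 * (2 * card V + 2 * irregularity V E D)"
    by (simp add: sum.distrib irregularity_dev sum_distrib_left)
  finally show ?thesis .
qed

definition isolated :: "'v set set \<Rightarrow> 'v set set" where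
  "isolated X = {e \<in> X. \<forall>f\<in>X. f \<noteq> e \<longrightarrow> e \<inter> f = {}}"

text \<open>Every picked edge that is not isolated is the first component of some clash and wastes
  at most \<open>d\<close> vertices.\<close>

lemma isolated_loss:
  assumes "X \<subseteq> E"
  shows "card (\<Union>X - \<Union>(isolated X)) \<le> d * card {(e, f) \<in> clashes. e \<in> X \<and> f \<in> X}"
proof -
  let ?C = "{(e, f) \<in> clashes. e \<in> X \<and> f \<in> X}"
  have finX: "finite X" using assms fin(2) by (rule finite_subset)
  have finC: "finite ?C" by (rule finite_subset[OF _ finite_clashes]) auto
  have "X - isolated X \<subseteq> fst ` ?C"
  proof
    fix e assume "e \<in> X - isolated X"
    then obtain f where "e \<in> X" "f \<in> X" "f \<noteq> e" "e \<inter> f \<noteq> {}" by (auto simp: isolated_def)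
    then have "(e, f) \<in> ?C" using assms by (auto simp: clashes_def)
    then show "e \<in> fst ` ?C" by force
  qed
  then have c: "card (X - isolated X) \<le> card ?C" by (rule surj_card_le[OF finC])
  have "card (\<Union>X - \<Union>(isolated X)) \<le> card (\<Union>(X - isolated X))"
    using finX fin(3) assms by (intro card_mono finite_Union) auto
  also have "\<dots> \<le> (\<Sum>e\<in>X - isolated X. card e)"
    by (rule card_Union_le_sum_card)
  also have "\<dots> = (\<Sum>e\<in>X - isolated X. d)"
    by (rule sum.cong) (use fin(3) assms in auto)
  also have "\<dots> \<le> d * card ?C" using c by simp
  finally show ?thesis .
qed

end

text \<open>A nibble multiplies the uncovered proportion by about \<open>exp (- \<eta>)\<close> and
  loses \<open>2 * d * \<eta>^2\<close> to clashes; the hypothesis then covers the hypergraph that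
  remains. The cost \<open>F\<close> adds clashes, uncovered vertices and new irregularity, weighted
  as the final bound needs them, so one outcome controls all three.\<close>

lemma coverable_step:
  fixes a a' \<eta> :: real
  assumes a: "coverable TYPE('v) d a" "a \<ge> 0" and d: "d \<ge> 1" and e: "\<eta> > 0"
    and a': "exp (- \<eta>) * a + 2 * d * \<eta>\<^sup>2 < a'"
  shows "coverable TYPE('v) d a'"
  unfolding coverable_def
proof
  fix K0 :: real
  define K where "K = max K0 0"
  define s where "s = exp (- (\<eta> * (real d - 1)))"
  have s: "s > 0" by (simp add: s_def)
  \<comment> \<open>Degrees only fall while the target drops to \<open>s * D\<close>, so the degree
    ratio is bounded by \<open>K / s\<close> in the next round.\<close>
  obtain b D0 where b: "b \<ge> 0" and cov: "covers TYPE('v) d a b D0 (K / s)"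
    using a(1) unfolding coverable_def by blast
  \<comment> \<open>The slack is spent in halves: one on \<open>R * \<theta>\<close>, the other on
    the term of order \<open>1 / D\<close>.\<close>
  define gap where "gap = a' - (exp (- \<eta>) * a + 2 * d * \<eta>\<^sup>2)"
  define C1 where "C1 = \<eta> + d * K * (2 * \<eta> * K / s\<^sup>2 + 2 * \<eta> / s)"
  define C2 where "C2 = (4 * \<eta> * d\<^sup>2 * K\<^sup>2 + K) / s\<^sup>2"
  define R where "R = a * \<eta> + b * C1"
  define \<theta> where "\<theta> = gap / (2 * (R + 1))"
  have K: "K \<ge> 0" by (simp add: K_def)
  have gap: "gap > 0" using a' by (simp add: gap_def)
  have C: "C1 \<ge> 0" "C2 \<ge> 0" using K e s by (simp_all add: C1_def C2_def)
  have R: "R \<ge> 0" using a(2) e b C by (simp add: R_def)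
  have \<theta>: "\<theta> > 0" "R * \<theta> \<le> gap / 2" using gap R by (simp_all add: \<theta>_def field_simps)
  show "\<exists>b\<ge>0. \<exists>D0. covers TYPE('v) d a' b D0 K0"
    unfolding covers_def
  \<comment> \<open>The first lower bound on \<open>D\<close> makes \<open>s * D\<close> admissible
    for the remaining hypergraph; the second makes \<open>b * C2 / D\<close> at most
    \<open>gap / 2\<close>.\<close>
  proof (rule exI[of _ "2 * d * \<eta>\<^sup>2 + b + R / \<theta>"], rule conjI[rotated],
      rule exI[of _ "max (D0 / s) (2 * b * C2 / gap)"], intro allI impI)
    show "2 * d * \<eta>\<^sup>2 + b + R / \<theta> \<ge> 0" using b R \<theta> by simp
    fix V :: "'v set" and E and D :: real
    assume lin: "linear_hypergraph d V E" and D: "max (D0 / s) (2 * b * C2 / gap) \<le> D" "D > 0"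
      and deg: "\<forall>v\<in>V. real (hdeg E v) \<le> K0 * D"
    have degK: "real (hdeg E v) \<le> K * D" if "v \<in> V" for v
    proof -
      have "real (hdeg E v) \<le> K0 * D" using deg that by blast
      also have "\<dots> \<le> K * D" using D(2) by (simp add: K_def)
      finally show ?thesis .
    qed
    interpret nibble_step V E d D \<eta> K
      using lin D(2) e d K degK by unfold_locales auto
    define Y where "Y = (\<Sum>v\<in>V. \<bar>dev v\<bar>)"
    define Q where "Q = irregularity V E D"
    define N where "N = real (card V)"
    define cl where "cl X = real (card {(e, f) \<in> clashes. e \<in> X \<and> f \<in> X})" for X
    define F where "F X = d * cl X + a * real (card (V - \<Union>X)) + b * irregularity (V - \<Union>X) (rest X) (s * D)" for X
    have Q0: "Q \<ge> 0" by (simp add: Q_def irregularity_def sum_nonneg)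
    \<comment> \<open>Errors are linear in the deviations, but only squares may appear in the
      result. The inequality \<open>\<bar>x\<bar> \<le> \<theta> + x^2 / \<theta>\<close> trades
      them for a small multiple of \<open>N\<close> and a large multiple of
      \<open>Q\<close>.\<close>
    have Y: "Y \<le> \<theta> * N + Q / \<theta>"
    proof -
      have "Y \<le> (\<Sum>v\<in>V. \<theta> + (dev v)\<^sup>2 / \<theta>)"
        unfolding Y_def
      proof (rule sum_mono)
        fix v
        have "\<bar>dev v\<bar> * \<theta> \<le> \<theta>\<^sup>2 + (dev v)\<^sup>2"
        proof -
          have "0 \<le> (\<bar>dev v\<bar> - \<theta>)\<^sup>2" by simp
          also have "\<dots> = \<theta>\<^sup>2 + (dev v)\<^sup>2 - 2 * (\<bar>dev v\<bar> * \<theta>)" by (simp add: power2_diff)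
          finally have "2 * (\<bar>dev v\<bar> * \<theta>) \<le> \<theta>\<^sup>2 + (dev v)\<^sup>2" by simp
          moreover have "0 \<le> \<bar>dev v\<bar> * \<theta>" using \<theta> by simp
          ultimately show ?thesis by linarith
        qed
        then show "\<bar>dev v\<bar> \<le> \<theta> + (dev v)\<^sup>2 / \<theta>"
          using \<theta>(1) by (simp add: field_simps power2_eq_square)
      qed
      then show ?thesis by (simp add: sum.distrib N_def Q_def irregularity_dev sum_divide_distrib mult.commute)
    qed
    have "expect F = d * expect cl + a * expect (\<lambda>X. real (card (V - \<Union>X)))
        + b * expect (\<lambda>X. irregularity (V - \<Union>X) (rest X) (s * D))"
      unfolding F_def expect_def by (simp only: bern_add bern_cmult)
    also have "\<dots> \<le> d * (\<eta>\<^sup>2 * (2 * N + 2 * Q)) + a * (exp (- \<eta>) * N + \<eta> * Y)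
       + b * (Q + Y * C1 + N * (C2 / D))"
      using expect_clashes expect_rest_size expect_irregularity a(2) b
      unfolding N_def Q_def Y_def C1_def C2_def s_def cl_def divide_divide_eq_left
      by (intro add_mono mult_left_mono) auto
    also have "\<dots> = (2 * d * \<eta>\<^sup>2 + exp (- \<eta>) * a) * N + R * Y + b * C2 / D * N + (2 * d * \<eta>\<^sup>2 + b) * Q"
      by (simp add: R_def algebra_simps)
    also have "\<dots> \<le> (2 * d * \<eta>\<^sup>2 + exp (- \<eta>) * a) * N + R * (\<theta> * N + Q / \<theta>) + gap / 2 * N + (2 * d * \<eta>\<^sup>2 + b) * Q"
    proof -
      have "2 * b * C2 / gap \<le> D" using D(1) by simp
      then have "b * C2 / D \<le> gap / 2" using gap D(2) by (simp add: field_simps)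
      then have "b * C2 / D * N \<le> gap / 2 * N" by (rule mult_right_mono) (simp add: N_def)
      moreover have "R * Y \<le> R * (\<theta> * N + Q / \<theta>)" by (rule mult_left_mono[OF Y R])
      ultimately show ?thesis by linarith
    qed
    also have "R * (\<theta> * N + Q / \<theta>) = R * \<theta> * N + R / \<theta> * Q" by (simp add: algebra_simps)
    also have "(2 * d * \<eta>\<^sup>2 + exp (- \<eta>) * a) * N + (R * \<theta> * N + R / \<theta> * Q) + gap / 2 * N + (2 * d * \<eta>\<^sup>2 + b) * Q
        \<le> (2 * d * \<eta>\<^sup>2 + exp (- \<eta>) * a) * N + (gap / 2 * N + R / \<theta> * Q) + gap / 2 * N + (2 * d * \<eta>\<^sup>2 + b) * Q"
      using \<theta>(2) by (intro add_mono mult_right_mono order_refl) (auto simp: N_def)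
    also have "\<dots> = a' * N + (2 * d * \<eta>\<^sup>2 + b + R / \<theta>) * Q"
      by (simp add: gap_def algebra_simps)
    finally have "expect F \<le> a' * N + (2 * d * \<eta>\<^sup>2 + b + R / \<theta>) * Q" .
    then obtain X where X: "X \<subseteq> E" "F X \<le> a' * N + (2 * d * \<eta>\<^sup>2 + b + R / \<theta>) * Q"
      unfolding expect_def using bern_le_witness[OF fin(2)] prob_bounds by metis
    have rest: "linear_hypergraph d (V - \<Union>X) (rest X)"
      using lin by (auto simp: linear_hypergraph_def uniform_hypergraph_def rest_def)
    have "\<exists>M\<subseteq>rest X. disjoint M \<and> card ((V - \<Union>X) - \<Union>M)
        \<le> a * real (card (V - \<Union>X)) + b * irregularity (V - \<Union>X) (rest X) (s * D)"
    proof (rule coversD[OF cov rest])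
      show "D0 \<le> s * D" using D(1) s by (simp add: field_simps)
      show "0 < s * D" using D(2) s by simp
      fix v assume "v \<in> V - \<Union>X"
      have "hdeg (rest X) v \<le> hdeg E v"
        unfolding hdeg_def by (rule card_mono) (use fin(2) in \<open>auto simp: rest_def\<close>)
      also have "real (hdeg E v) \<le> K / s * (s * D)" using degK \<open>v \<in> V - \<Union>X\<close> s by simp
      finally show "real (hdeg (rest X) v) \<le> K / s * (s * D)" by simp
    qed
    then obtain M where M: "M \<subseteq> rest X" "disjoint M" "card ((V - \<Union>X) - \<Union>M)
        \<le> a * real (card (V - \<Union>X)) + b * irregularity (V - \<Union>X) (rest X) (s * D)" by blast
    show "\<exists>M\<subseteq>E. disjoint M \<and> card (V - \<Union>M) \<le> a' * real (card V) + (2 * d * \<eta>\<^sup>2 + b + R / \<theta>) * irregularity V E D"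
    proof (intro exI[of _ "isolated X \<union> M"] conjI)
      show "isolated X \<union> M \<subseteq> E" using X(1) M(1) by (auto simp: isolated_def rest_def)
      show "disjoint (isolated X \<union> M)"
      proof (rule disjointI)
        fix e f assume "e \<in> isolated X \<union> M" "f \<in> isolated X \<union> M" "e \<noteq> f"
        moreover have "g \<inter> h = {}" if "g \<in> isolated X" "h \<in> M" for g h
          using that M(1) unfolding isolated_def rest_def by blast
        ultimately show "e \<inter> f = {}"
          using disjointD[OF M(2), of e f] unfolding isolated_def by blast
      qed
      have "V - \<Union>(isolated X \<union> M) \<subseteq> (\<Union>X - \<Union>(isolated X)) \<union> ((V - \<Union>X) - \<Union>M)" by auto
      then have "card (V - \<Union>(isolated X \<union> M)) \<le> card ((\<Union>X - \<Union>(isolated X)) \<union> ((V - \<Union>X) - \<Union>M))"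
      proof (rule card_mono[rotated])
        have "\<Union>X \<subseteq> V" using X(1) fin(3) by blast
        then show "finite ((\<Union>X - \<Union>(isolated X)) \<union> ((V - \<Union>X) - \<Union>M))"
          using fin(1) finite_subset by blast
      qed
      also have "\<dots> \<le> card (\<Union>X - \<Union>(isolated X)) + card ((V - \<Union>X) - \<Union>M)" by (rule card_Un_le)
      finally have "real (card (V - \<Union>(isolated X \<union> M))) \<le> real (card (\<Union>X - \<Union>(isolated X))) + real (card ((V - \<Union>X) - \<Union>M))"
        by linarith
      also have "\<dots> \<le> d * cl X + (a * real (card (V - \<Union>X)) + b * irregularity (V - \<Union>X) (rest X) (s * D))"
      proof (rule add_mono[OF _ M(3)])
        have "real (card (\<Union>X - \<Union>(isolated X))) \<le> real (d * card {(e, f) \<in> clashes. e \<in> X \<and> f \<in> X})"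
          using isolated_loss[OF X(1)] by linarith
        then show "real (card (\<Union>X - \<Union>(isolated X))) \<le> d * cl X" by (simp add: cl_def)
      qed
      also have "\<dots> = F X" by (simp add: F_def)
      also note X(2)
      finally show "card (V - \<Union>(isolated X \<union> M)) \<le> a' * real (card V) + (2 * d * \<eta>\<^sup>2 + b + R / \<theta>) * irregularity V E D"
        by (simp add: N_def Q_def)
    qed
  qed
qed

text \<open>Instead of iterating the step: the infimum \<open>m\<close> of all admissible \<open>a\<close> satisfies
  \<open>m \<le> exp (- \<eta>) * m + 2 * d * \<eta>\<^sup>2\<close> for every \<open>\<eta>\<close>, hence is \<open>0\<close>.\<close>

lemma coverable_all:
  assumes d: "d \<ge> 1" and a: "a > 0"
  shows "coverable TYPE('v) d a"
proof -
  define S where "S = {a. 0 \<le> a \<and> coverable TYPE('v) d a}"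
  have one: "1 \<in> S"
    unfolding S_def coverable_def covers_def
    by (auto intro!: exI[of _ "0 :: real"] exI[of _ "{}"])
  have bdd: "bdd_below S" by (auto simp: S_def bdd_below_def)
  define m where "m = Inf S"
  have m0: "m \<ge> 0"
    unfolding m_def
  proof (rule cInf_greatest)
    show "S \<noteq> {}" using one by blast
  qed (simp add: S_def)
  have "m = 0"
  proof (rule ccontr)
    assume "m \<noteq> 0"
    with m0 have m: "m > 0" by simp
    \<comment> \<open>By \<open>\<eta> * (8 * d) \<le> m\<close> the clash loss is at most
      \<open>m * \<eta> / 4\<close>, half of the gain \<open>m * \<eta> / 2\<close> that comes from
      \<open>exp (- \<eta>) \<le> 1 - \<eta> / 2\<close>.\<close>
    define \<eta> where "\<eta> = min 1 (m / (8 * d))"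
    have e: "\<eta> > 0" "\<eta> \<le> 1" "\<eta> * (8 * d) \<le> m"
      using m d by (auto simp: \<eta>_def min_def field_simps)
    have ex: "exp (- \<eta>) \<le> 1 - \<eta> / 2"
    proof -
      have "1 \<le> (1 - \<eta> / 2) * (1 + \<eta>)"
        using e by (simp add: algebra_simps mult_le_cancel_left1)
      also have "\<dots> \<le> (1 - \<eta> / 2) * exp \<eta>"
        using e by (intro mult_left_mono exp_ge_add_one_self) auto
      finally have "1 / exp \<eta> \<le> 1 - \<eta> / 2" by (simp add: field_simps)
      then show ?thesis by (simp add: exp_minus inverse_eq_divide)
    qed
    \<comment> \<open>An approximation of the infimum this close uses up only another quarter of the
      gain, so one step leads strictly below \<open>m\<close>.\<close>
    define \<delta> where "\<delta> = m * \<eta> / 8"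
    have "\<delta> > 0" using m e by (simp add: \<delta>_def)
    then have "Inf S < m + \<delta>" by (simp add: m_def)
    then obtain a where aS: "a \<in> S" and am: "a < m + \<delta>"
      using cInf_lessD[of S "m + \<delta>"] one by auto
    have "exp (- \<eta>) * a + 2 * d * \<eta>\<^sup>2 \<le> (1 - \<eta> / 2) * (m + \<delta>) + m * \<eta> / 4"
    proof (rule add_mono)
      show "exp (- \<eta>) * a \<le> (1 - \<eta> / 2) * (m + \<delta>)"
        using ex am aS e by (intro mult_mono) (auto simp: S_def)
      have "2 * d * \<eta>\<^sup>2 = \<eta> * (8 * d) * \<eta> / 4" by (simp add: power2_eq_square)
      also have "\<dots> \<le> m * \<eta> / 4" using e by (intro divide_right_mono mult_right_mono) auto
      finally show "2 * d * \<eta>\<^sup>2 \<le> m * \<eta> / 4" .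
    qed
    also have "\<dots> < m - m * \<eta> / 16"
    proof -
      have "m * \<eta> > 0" "m * (\<eta> * \<eta>) > 0" using m e by simp_all
      then show ?thesis by (simp add: \<delta>_def algebra_simps)
    qed
    finally have "coverable TYPE('v) d (m - m * \<eta> / 16)"
      using coverable_step[of d a \<eta> "m - m * \<eta> / 16"] aS d e by (auto simp: S_def)
    moreover have "m - m * \<eta> / 16 \<ge> 0" using e m by (simp add: field_simps mult_le_cancel_left1)
    ultimately have "m - m * \<eta> / 16 \<in> S" by (simp add: S_def)
    then have "m \<le> m - m * \<eta> / 16" unfolding m_def using bdd by (intro cInf_lower)
    moreover have "m * \<eta> > 0" using m e by simp
    ultimately show False by simp
  qed
  then have "Inf S < a" using a by (simp add: m_def)
  then obtain a0 where a0: "a0 \<in> S" "a0 < a" using cInf_lessD[of S a] one by auto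
  show ?thesis
    unfolding coverable_def
  proof
    fix K
    obtain b D0 where b: "b \<ge> 0" and cov: "covers TYPE('v) d a0 b D0 K"
      using a0(1) unfolding S_def coverable_def by blast
    have "covers TYPE('v) d a b D0 K"
      unfolding covers_def
    proof (intro allI impI)
      fix V :: "'v set" and E and D :: real
      assume "linear_hypergraph d V E" "D0 \<le> D" "0 < D" "\<forall>v\<in>V. real (hdeg E v) \<le> K * D"
      then obtain M where "M \<subseteq> E" "disjoint M" "card (V - \<Union>M) \<le> a0 * real (card V) + b * irregularity V E D"
        using coversD[OF cov] by blast
      moreover have "a0 * real (card V) \<le> a * real (card V)"
        using a0(2) by (simp add: mult_right_mono)
      ultimately show "\<exists>M\<subseteq>E. disjoint M \<and> card (V - \<Union>M) \<le> a * real (card V) + b * irregularity V E D"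
        by (intro exI[of _ M]) auto
    qed
    with b show "\<exists>b\<ge>0. \<exists>D0. covers TYPE('v) d a b D0 K" by blast
  qed
qed

text \<open>Adapts the nibble to a hypergraph without maximum degree bound and linear only outside
  \<open>B\<close>. Indices in \<open>B\<close> or touching a vertex of degree above
  \<open>2 * D\<close> are discarded; the irregularity and \<open>card B / D\<close> already pay for
  them. The family is indexed because different copies of a pattern may have the same edge.\<close>

lemma nearly_perfect_matching:
  fixes a :: real
  assumes d: "d \<ge> 2" and a: "a > 0"
  obtains b D0 :: real where "b \<ge> 0"
    and "\<And>(V :: 'v set) (I :: 'i set) h B D.
      finite V \<Longrightarrow> finite I \<Longrightarrow> (\<And>i. i \<in> I \<Longrightarrow> h i \<subseteq> V \<and> card (h i) = d) \<Longrightarrow> B \<subseteq> I \<Longrightarrow>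
      (\<And>i j. i \<in> I - B \<Longrightarrow> j \<in> I - B \<Longrightarrow> i \<noteq> j \<Longrightarrow> card (h i \<inter> h j) \<le> 1) \<Longrightarrow> D \<ge> D0 \<Longrightarrow> D > 0 \<Longrightarrow>
      \<exists>J\<subseteq>I - B. disjoint_family_on h J \<and>
        real (card V) - real d * real (card J)
        \<le> a * real (card V) + b * ((\<Sum>v\<in>V. (card {i \<in> I. v \<in> h i} / D - 1)\<^sup>2) + card B / D)"
proof -
  have "coverable TYPE('v) d a" using d a by (intro coverable_all) auto
  then obtain b D0 where b: "b \<ge> 0" and cov: "covers TYPE('v) d a b D0 2"
    unfolding coverable_def by blast
  show ?thesis
  proof (rule that[of "b * (2 + 8 * d)" D0])
    show "b * (2 + 8 * d) \<ge> 0" using b by simp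
    fix V :: "'v set" and I :: "'i set" and h B and D :: real
    assume V: "finite V" and I: "finite I" and h: "\<And>i. i \<in> I \<Longrightarrow> h i \<subseteq> V \<and> card (h i) = d" and B: "B \<subseteq> I"
      and lin: "\<And>i j. i \<in> I - B \<Longrightarrow> j \<in> I - B \<Longrightarrow> i \<noteq> j \<Longrightarrow> card (h i \<inter> h j) \<le> 1"
      and D: "D \<ge> D0" "D > 0"
    define deg where "deg v = real (card {i \<in> I. v \<in> h i})" for v
    define L where "L = {v \<in> V. deg v \<le> 2 * D}"
    define I' where "I' = {i \<in> I - B. h i \<subseteq> L}"
    define Q where "Q = (\<Sum>v\<in>V. (deg v / D - 1)\<^sup>2)"
    have I': "I' \<subseteq> I - B" "finite I'" using I by (auto simp: I'_def)
    \<comment> \<open>Two indices with the same edge would share \<open>d \<ge> 2\<close> points,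
      against linearity outside \<open>B\<close>.\<close>
    have inj: "inj_on h I'"
    proof (rule inj_onI, rule ccontr)
      fix i j assume ij: "i \<in> I'" "j \<in> I'" "h i = h j" "i \<noteq> j"
      then have "card (h i \<inter> h j) \<le> 1" using lin I' by blast
      then show False using ij h[of j] I' d by auto
    qed
    have lh: "linear_hypergraph d V (h ` I')"
      using lin h I' V unfolding linear_hypergraph_def uniform_hypergraph_def by blast
    have deg': "hdeg (h ` I') v = card {i \<in> I'. v \<in> h i}" for v
    proof -
      have "{e \<in> h ` I'. v \<in> e} = h ` {i \<in> I'. v \<in> h i}" by auto
      moreover have "inj_on h {i \<in> I'. v \<in> h i}" using inj by (rule inj_on_subset) auto
      ultimately show ?thesis by (simp add: hdeg_def card_image)
    qed
    have deg'_le: "real (hdeg (h ` I') v) \<le> deg v" for v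
      unfolding deg' deg_def using I I' by (intro of_nat_mono card_mono) auto
    have deg'_0: "hdeg (h ` I') v = 0" if "v \<in> V - L" for v
      proof -
      have "{i \<in> I'. v \<in> h i} = {}" using that by (auto simp: I'_def)
      then show ?thesis by (simp only: deg' card.empty)
    qed
    \<comment> \<open>A degree above \<open>2 * D\<close> is at most \<open>2 * D\<close> times the
      squared relative deviation of its vertex, so the irregularity bounds the indices lost at heavy
      vertices.\<close>
    have lost: "real (card (I - I')) \<le> card B + 2 * D * Q"
    proof -
      have "I - I' \<subseteq> B \<union> (\<Union>v\<in>V - L. {i \<in> I. v \<in> h i})"
      proof
        fix i assume i: "i \<in> I - I'"
        show "i \<in> B \<union> (\<Union>v\<in>V - L. {i \<in> I. v \<in> h i})"
        proof (cases "i \<in> B")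
          case False
          then obtain v where v: "v \<in> h i" "v \<notin> L" using i by (auto simp: I'_def)
          then have "v \<in> V" using h[of i] i by auto
          with v i show ?thesis by blast
        qed simp
      qed
      then have "card (I - I') \<le> card (B \<union> (\<Union>v\<in>V - L. {i \<in> I. v \<in> h i}))"
        using I V B by (intro card_mono) (auto intro: finite_subset)
      also have "\<dots> \<le> card B + card (\<Union>v\<in>V - L. {i \<in> I. v \<in> h i})" by (rule card_Un_le)
      also have "\<dots> \<le> card B + (\<Sum>v\<in>V - L. card {i \<in> I. v \<in> h i})"
        using V by (intro add_left_mono card_UN_le) auto
      finally have "real (card (I - I')) \<le> real (card B + (\<Sum>v\<in>V - L. card {i \<in> I. v \<in> h i}))"
        by linarith
      also have "\<dots> = card B + (\<Sum>v\<in>V - L. deg v)" by (simp add: deg_def)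
      also have "(\<Sum>v\<in>V - L. deg v) \<le> (\<Sum>v\<in>V - L. 2 * D * (deg v / D - 1)\<^sup>2)"
      proof (rule sum_mono)
        fix v assume v: "v \<in> V - L"
        define y where "y = deg v / D - 1"
        have "y \<ge> 1" using v D(2) by (auto simp: L_def y_def field_simps)
        then have "1 * 1 \<le> y * y" "1 * y \<le> y * y" by (intro mult_mono; simp)+
        then have "1 + y \<le> 2 * (y * y)" by linarith
        moreover have "deg v = D * (1 + y)" using D(2) by (simp add: y_def)
        ultimately show "deg v \<le> 2 * D * (deg v / D - 1)\<^sup>2"
          unfolding y_def[symmetric] using D(2) by (simp add: power2_eq_square)
      qed
      also have "\<dots> \<le> (\<Sum>v\<in>V. 2 * D * (deg v / D - 1)\<^sup>2)"
        using V D by (intro sum_mono2) auto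
      also have "\<dots> = 2 * D * Q" by (simp add: Q_def sum_distrib_left)
      finally show ?thesis by simp
    qed
    \<comment> \<open>A vertex of relative degree \<open>x \<le> 2\<close> that loses
      \<open>r\<close> satisfies \<open>(x - r - 1)^2 \<le> 2 * (x - 1)^2 + 4 * r\<close>. A heavy
      vertex loses all its edges, and its new term 1 is below the old one. Each lost index is
      charged at \<open>d\<close> vertices.\<close>
    have irr: "irregularity V (h ` I') D \<le> (2 + 8 * d) * (Q + card B / D)"
    proof -
      have "irregularity V (h ` I') D \<le> (\<Sum>v\<in>V. 2 * (deg v / D - 1)\<^sup>2 + 4 / D * card {i \<in> I - I'. v \<in> h i})"
        unfolding irregularity_def
      proof (rule sum_mono)
        fix v assume v: "v \<in> V"
        define x where "x = deg v / D"
        define r where "r = card {i \<in> I - I'. v \<in> h i} / D"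
        have r0: "r \<ge> 0" using D by (simp add: r_def)
        show "(hdeg (h ` I') v / D - 1)\<^sup>2 \<le> 2 * (deg v / D - 1)\<^sup>2 + 4 / D * card {i \<in> I - I'. v \<in> h i}"
        proof (cases "v \<in> L")
          case True
          have "{i \<in> I. v \<in> h i} = {i \<in> I'. v \<in> h i} \<union> {i \<in> I - I'. v \<in> h i}" using I' by auto
          then have "card {i \<in> I. v \<in> h i} = card {i \<in> I'. v \<in> h i} + card {i \<in> I - I'. v \<in> h i}"
            using I I' by (simp add: card_Un_disjoint disjoint_iff)
          then have "deg v = real (hdeg (h ` I') v) + card {i \<in> I - I'. v \<in> h i}"
            unfolding deg_def deg' by simp
          then have eq: "hdeg (h ` I') v / D = x - r" by (simp add: x_def r_def diff_divide_distrib[symmetric])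
          have "x \<le> 2" using True D by (simp add: x_def L_def field_simps)
          moreover have "x - r \<ge> 0" using eq D by (metis divide_nonneg_pos of_nat_0_le_iff)
          ultimately have "r * r \<le> 2 * r" using r0 by (intro mult_right_mono) auto
          moreover have "0 \<le> (x - 1 + r)\<^sup>2" by simp
          ultimately have "(x - r - 1)\<^sup>2 \<le> 2 * (x - 1)\<^sup>2 + 4 * r"
            by (simp add: power2_eq_square algebra_simps)
          then show ?thesis unfolding eq x_def by (simp add: r_def)
        next
          case False
          then have "x > 2" using v D by (auto simp: x_def L_def field_simps)
          then have "1 * 1 \<le> (x - 1) * (x - 1)" by (intro mult_mono) auto
          then have "(x - 1)\<^sup>2 \<ge> 1" by (simp add: power2_eq_square)
          moreover have "4 / D * card {i \<in> I - I'. v \<in> h i} \<ge> 0" using D by simp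
          moreover have "hdeg (h ` I') v = 0" using False v deg'_0 by blast
          ultimately show ?thesis by (simp add: x_def)
        qed
      qed
      also have "\<dots> = 2 * Q + 4 / D * (\<Sum>v\<in>V. real (card {i \<in> I - I'. v \<in> h i}))"
        by (simp add: sum.distrib Q_def sum_distrib_left)
      also have "(\<Sum>v\<in>V. real (card {i \<in> I - I'. v \<in> h i})) = (\<Sum>v\<in>V. \<Sum>i | i \<in> I - I' \<and> v \<in> h i. 1)"
        by simp
      also have "\<dots> = (\<Sum>i\<in>I - I'. \<Sum>v | v \<in> V \<and> v \<in> h i. 1)"
        by (rule sum.swap_restrict) (use V I in auto)
      also have "\<dots> = (\<Sum>i\<in>I - I'. real d)"
      proof (rule sum.cong[OF refl])
        fix i assume "i \<in> I - I'"
        then have "{v. v \<in> V \<and> v \<in> h i} = h i" "card (h i) = d" using h by auto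
        then show "(\<Sum>v | v \<in> V \<and> v \<in> h i. 1) = real d" by simp
      qed
      also have "\<dots> = d * real (card (I - I'))" by simp
      also have "2 * Q + 4 / D * (d * real (card (I - I'))) \<le> 2 * Q + 4 / D * (d * (card B + 2 * D * Q))"
        using lost D by (intro add_left_mono mult_left_mono) auto
      also have "\<dots> = (2 + 8 * d) * Q + 4 * d * (card B / D)" using D by (simp add: field_simps)
      also have "\<dots> \<le> (2 + 8 * d) * Q + (2 + 8 * d) * (card B / D)"
        using D by (intro add_left_mono mult_right_mono) auto
      finally show ?thesis by (simp add: distrib_left)
    qed
    have deg_le: "real (hdeg (h ` I') v) \<le> 2 * D" if "v \<in> V" for v
      using deg'_le[of v] deg'_0[of v] D(2) that by (cases "v \<in> L") (auto simp: L_def)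
    obtain M where M: "M \<subseteq> h ` I'" "disjoint M" "card (V - \<Union>M) \<le> a * real (card V) + b * irregularity V (h ` I') D"
      using coversD[OF cov lh D deg_le] by blast
    define J where "J = {i \<in> I'. h i \<in> M}"
    have MJ: "M = h ` J" using M(1) by (auto simp: J_def)
    have J: "J \<subseteq> I - B" "finite J" using I' by (auto simp: J_def)
    have disj: "disjoint_family_on h J"
      unfolding disjoint_family_on_def
    proof (intro ballI impI)
      fix i j assume ij: "i \<in> J" "j \<in> J" "i \<noteq> j"
      then have "h i \<noteq> h j" using inj by (auto simp: J_def inj_on_def)
      then show "h i \<inter> h j = {}" using ij disjointD[OF M(2)] by (auto simp: J_def)
    qed
    have "card (\<Union>M) \<le> (\<Sum>i\<in>J. card (h i))"
      unfolding MJ by (rule card_UN_le[OF J(2)])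
    also have "\<dots> = d * card J" using h J by (subst sum.cong[where h="\<lambda>_. d"]) auto
    finally have cM: "card (\<Union>M) \<le> d * card J" .
    have "\<Union>M \<subseteq> V" using M(1) h I' by blast
    then have "card V = card (V - \<Union>M) + card (\<Union>M)"
      using V card_Diff_subset[of "\<Union>M" V] card_mono[of V "\<Union>M"] finite_subset by fastforce
    with cM have "card V \<le> card (V - \<Union>M) + d * card J" by simp
    then have "real (card V) \<le> real (card (V - \<Union>M) + d * card J)" by (rule of_nat_mono)
    then have "real (card V) - real d * real (card J) \<le> card (V - \<Union>M)" by simp
    also have "\<dots> \<le> a * real (card V) + b * ((2 + 8 * d) * (Q + card B / D))"
      using M(3) mult_left_mono[OF irr b] by linarith
    finally show "\<exists>J\<subseteq>I - B. disjoint_family_on h J \<and>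
        real (card V) - real d * real (card J)
        \<le> a * real (card V) + b * (2 + 8 * d) * ((\<Sum>v\<in>V. (card {i \<in> I. v \<in> h i} / D - 1)\<^sup>2) + card B / D)"
      using J disj unfolding Q_def deg_def mult.assoc by blast
  qed
qed

section \<open>Sparse families\<close>

text \<open>The threshold is chosen such that a random family of \<open>r\<close>-sets of density \<open>n powr (k - r)\<close>, which has
  about \<open>n ^ k\<close> members, contains only \<open>O(n ^ (k - 1))\<close> dense configurations in expectation.\<close>

definition dense_configs :: "nat \<Rightarrow> nat \<Rightarrow> nat \<Rightarrow> ('i \<Rightarrow> 'v set) \<Rightarrow> 'i set \<Rightarrow> 'i set set" where
  "dense_configs r k m V I =
     {J. J \<subseteq> I \<and> finite J \<and> J \<noteq> {} \<and> card J \<le> m \<and> card (\<Union>(V ` J)) + card J * k < card J * r + k}"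

text \<open>Free of truncated subtraction, the condition says that any \<open>j\<close> members,
  \<open>1 \<le> j \<le> m\<close>, span at least \<open>j * r - (j - 1) * k\<close> points, as if
  each new one shared exactly \<open>k\<close> points with those before it.\<close>

definition sparse :: "nat \<Rightarrow> nat \<Rightarrow> nat \<Rightarrow> ('i \<Rightarrow> 'v set) \<Rightarrow> 'i set \<Rightarrow> bool" where
  "sparse r k m V I \<longleftrightarrow> dense_configs r k m V I = {}"

lemma sparseD:
  "sparse r k m V I \<Longrightarrow> J \<subseteq> I \<Longrightarrow> finite J \<Longrightarrow> J \<noteq> {} \<Longrightarrow> card J \<le> m \<Longrightarrow>
    card J * r + k \<le> card (\<Union>(V ` J)) + card J * k"
  unfolding sparse_def dense_configs_def by (simp add: not_less[symmetric]) blast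

text \<open>A dense configuration of \<open>j\<close> members fits into
  \<open>j * (r - k) + (k - 1)\<close> points. There are at most \<open>n\<close> to that power such
  point sets, each holding at most \<open>2 ^ c\<close> subfamilies; the weight \<open>p ^ j\<close>
  absorbs \<open>n ^ (r - k)\<close> once per member, leaving \<open>n ^ (k - 1)\<close>.\<close>

lemma dense_configs_weight:
  fixes p \<kappa> :: real and V :: "'i \<Rightarrow> nat set"
  assumes fin: "finite I" and V: "\<And>i. i \<in> I \<Longrightarrow> V i \<subseteq> {..<n}"
    and c: "\<And>U. U \<subseteq> {..<n} \<Longrightarrow> card U \<le> m * r \<Longrightarrow> card {i \<in> I. V i \<subseteq> U} \<le> c"
    and k: "1 \<le> k" "k \<le> r" and m: "m \<ge> 1" and n: "m * r \<le> n"
    and p: "0 \<le> p" "p * real n ^ (r - k) \<le> \<kappa>"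
  shows "(\<Sum>J\<in>dense_configs r k m V I. p ^ card J) \<le> (\<Sum>j\<le>m. \<kappa> ^ j) * 2 ^ c * real n ^ (k - 1)"
proof -
  define Dj where "Dj j = {J \<in> dense_configs r k m V I. card J = j}" for j
  have finD: "finite (dense_configs r k m V I)"
    by (rule finite_subset[of _ "Pow I"]) (use fin in \<open>auto simp: dense_configs_def\<close>)
  have "dense_configs r k m V I = (\<Union>j\<in>{..m}. Dj j)"
    by (auto simp: Dj_def dense_configs_def)
  then have "(\<Sum>J\<in>dense_configs r k m V I. p ^ card J) = (\<Sum>j\<le>m. \<Sum>J\<in>Dj j. p ^ card J)"
    using finD by (simp only:) (subst sum.UNION_disjoint, auto simp: Dj_def)
  also have "\<dots> \<le> (\<Sum>j\<le>m. \<kappa> ^ j * (2 ^ c * real n ^ (k - 1)))"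
  proof (rule sum_mono)
    fix j assume "j \<in> {..m}"
    then have j: "j \<le> m" by simp
    have \<kappa>: "\<kappa> \<ge> 0" using p by (meson mult_nonneg_nonneg of_nat_0_le_iff order_trans zero_le_power)
    \<comment> \<open>The largest span of a dense configuration. It is at most
      \<open>m * r \<le> n\<close>, so the union can be enlarged to exactly \<open>v\<close>
      points.\<close>
    define v where "v = j * (r - k) + (k - 1)"
    have "j * (r - k) \<le> m * (r - k)" using j by (rule mult_right_mono) simp
    moreover have "m * (r - k) + m * k = m * r" using k by (simp flip: distrib_left)
    moreover have "k \<le> m * k" using m by simp
    ultimately have vm: "v \<le> m * r" unfolding v_def by linarith
    let ?W = "{U. U \<subseteq> {..<n} \<and> card U = v}"
    have "Dj j \<subseteq> (\<Union>U\<in>?W. Pow {i \<in> I. V i \<subseteq> U})"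
    proof
      fix J assume J: "J \<in> Dj j"
      then have J': "J \<subseteq> I" "card J = j" "card (\<Union>(V ` J)) + j * k < j * r + k"
        by (auto simp: Dj_def dense_configs_def)
      have "j * (r - k) + j * k = j * r" using k by (simp flip: distrib_left)
      then have "card (\<Union>(V ` J)) \<le> v" using J'(3) k by (simp add: v_def)
      moreover have "\<Union>(V ` J) \<subseteq> {..<n}" using V J' by blast
      ultimately obtain U where "\<Union>(V ` J) \<subseteq> U" "U \<subseteq> {..<n}" "card U = v"
        using exists_subset_between[of "\<Union>(V ` J)" v "{..<n}"] vm n by auto
      then show "J \<in> (\<Union>U\<in>?W. Pow {i \<in> I. V i \<subseteq> U})" using J' by blast
    qed
    then have "card (Dj j) \<le> card (\<Union>U\<in>?W. Pow {i \<in> I. V i \<subseteq> U})"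
      by (rule card_mono[rotated]) (use fin in auto)
    also have "\<dots> \<le> (\<Sum>U\<in>?W. card (Pow {i \<in> I. V i \<subseteq> U}))"
      by (rule card_UN_le) simp
    also have "\<dots> \<le> (\<Sum>U\<in>?W. 2 ^ c)"
      by (rule sum_mono) (use c vm fin in \<open>auto simp: card_Pow\<close>)
    also have "\<dots> = (n choose v) * 2 ^ c" by (simp add: n_subsets)
    also have "\<dots> \<le> n ^ v * 2 ^ c" using vm n by (intro mult_right_mono binomial_le_pow) auto
    finally have "real (card (Dj j)) \<le> real (n ^ v * 2 ^ c)" by (rule of_nat_mono)
    then have "(\<Sum>J\<in>Dj j. p ^ card J) \<le> real (n ^ v * 2 ^ c) * p ^ j"
      using p by (simp add: Dj_def mult_right_mono)
    also have "\<dots> = (p * real n ^ (r - k)) ^ j * (2 ^ c * real n ^ (k - 1))"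
      by (simp add: v_def power_add power_mult_distrib mult.commute[of j] flip: power_mult)
    also have "\<dots> \<le> \<kappa> ^ j * (2 ^ c * real n ^ (k - 1))"
      using p by (intro mult_right_mono power_mono) auto
    finally show "(\<Sum>J\<in>Dj j. p ^ card J) \<le> \<kappa> ^ j * (2 ^ c * real n ^ (k - 1))" .
  qed
  also have "\<dots> = (\<Sum>j\<le>m. \<kappa> ^ j) * 2 ^ c * real n ^ (k - 1)"
    by (simp add: sum_distrib_right mult.assoc)
  finally show ?thesis .
qed

section \<open>Cancellative unions of gadgets\<close>

lemma card_Int_UN_le:
  assumes "finite A" "\<And>X. X \<in> A \<Longrightarrow> card (X \<inter> Y) \<le> c"
  shows "card (Y \<inter> \<Union>A) \<le> card A * c"
proof -
  have eq: "Y \<inter> \<Union>A = (\<Union>X\<in>A. X \<inter> Y)" by auto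
  have "card (Y \<inter> \<Union>A) \<le> (\<Sum>X\<in>A. card (X \<inter> Y))"
    unfolding eq by (rule card_UN_le[OF assms(1)])
  also have "\<dots> \<le> (\<Sum>X\<in>A. c)" using assms by (intro sum_mono)
  finally show ?thesis by simp
qed

lemma sparse_pair:
  assumes "sparse r k m V I" "m \<ge> 2" "i \<in> I" "j \<in> I" "i \<noteq> j" "finite (V i)" "finite (V j)"
    "card (V i) = r" "card (V j) = r"
  shows "card (V i \<inter> V j) \<le> k"
proof -
  have "card {i, j} * r + k \<le> card (\<Union>(V ` {i, j})) + card {i, j} * k"
    by (rule sparseD[OF assms(1)]) (use assms in auto)
  then show ?thesis using card_Un_Int[of "V i" "V j"] assms by simp
qed

text \<open>\<open>own\<close> is the private vertex. \<open>cross\<close> compares an edge with the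
  whole vertex set of another gadget, so it also limits what that edge covers of a union
  \<open>B \<union> C\<close> inside the gadget.\<close>

locale gadget_family =
  fixes t k \<gamma> :: nat and M :: "'i set" and V :: "'i \<Rightarrow> 'v set" and \<G> :: "'i \<Rightarrow> 'v set set"
  assumes t: "t \<ge> 2" and k: "k \<ge> 1"
    and V: "\<And>g. g \<in> M \<Longrightarrow> finite (V g) \<and> card (V g) = \<gamma>"
    and edges: "\<And>g B. g \<in> M \<Longrightarrow> B \<in> \<G> g \<Longrightarrow> B \<subseteq> V g \<and> card B = t * k"
    and own: "\<And>g B. g \<in> M \<Longrightarrow> B \<in> \<G> g \<Longrightarrow> \<exists>x\<in>B. \<forall>A\<in>\<G> g. x \<in> A \<longrightarrow> A = B"
    and inner: "\<And>g. g \<in> M \<Longrightarrow> sparse (t * k) k (2 * t) (\<lambda>B. B) (\<G> g)"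
    and outer: "sparse \<gamma> k (2 * t) V M"
    and cross: "\<And>g h A. g \<in> M \<Longrightarrow> h \<in> M \<Longrightarrow> g \<noteq> h \<Longrightarrow> A \<in> \<G> h \<Longrightarrow> card (A \<inter> V g) < k"
begin

lemma edge_finite: "g \<in> M \<Longrightarrow> B \<in> \<G> g \<Longrightarrow> finite B"
  by (rule finite_subset[of B "V g"]) (simp_all add: edges V)

lemma disjoint_gadgets: "g \<in> M \<Longrightarrow> h \<in> M \<Longrightarrow> g \<noteq> h \<Longrightarrow> A \<in> \<G> g \<Longrightarrow> A \<notin> \<G> h"
proof
  assume *: "g \<in> M" "h \<in> M" "g \<noteq> h" "A \<in> \<G> g" "A \<in> \<G> h"
  then have "card (A \<inter> V g) < k" using cross by blast
  moreover have "A \<inter> V g = A" "card A = t * k" using edges * by auto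
  ultimately show False using t by simp
qed

text \<open>Sparseness of \<open>B\<close>, \<open>C\<close> and \<open>A1\<close> bounds what
  \<open>A1\<close> can cover of \<open>B \<union> C\<close>, and each foreign edge covers at most
  \<open>k - 1\<close> points. The sizes of \<open>B \<union> C\<close> cancel, leaving \<open>2 *
  (t * k) + card A2 \<le> (card A + 2) * k \<le> 2 * (t * k)\<close>. So there is no foreign edge,
  and the private vertex of \<open>B\<close> stays uncovered.\<close>

lemma same_gadget:
  assumes g: "g \<in> M" and B: "B \<in> \<G> g" and C: "C \<in> \<G> g" and ne: "B \<noteq> C"
    and A: "finite A" "card A \<le> 2 * t - 2" "A \<subseteq> (\<Union>g\<in>M. \<G> g)" "B \<notin> A" "C \<notin> A"
    and cov: "B - C \<subseteq> \<Union>A" "C - B \<subseteq> \<Union>A"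
  shows False
proof -
  define A1 where "A1 = A \<inter> \<G> g"
  define A2 where "A2 = A - \<G> g"
  have fin: "finite A1" "finite A2" using A by (auto simp: A1_def A2_def)
  have cA: "card A = card A1 + card A2"
    using A(1) card_Un_disjoint[OF fin] by (simp add: A1_def A2_def Int_Diff_Un Int_Diff_disjoint)
  have B': "finite B" "card B = t * k" "B \<subseteq> V g" and C': "finite C" "card C = t * k" "C \<subseteq> V g"
    using edges[OF g] edge_finite[OF g] B C by auto
  have BC: "card (B \<union> C) + card (B \<inter> C) = 2 * (t * k)"
    using card_Un_Int[of B C] B' C' by simp
  have s: "card (B \<inter> C) \<le> k"
    using sparse_pair[OF inner[OF g], of B C] B C ne B' C' t by simp
  have A1: "finite (\<Union>A1)" "card (\<Union>A1) \<le> card A1 * (t * k)"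
  proof -
    show "finite (\<Union>A1)" using fin edge_finite[OF g] by (auto simp: A1_def)
    have "card (\<Union>A1) \<le> (\<Sum>X\<in>A1. card X)" by (rule card_Union_le_sum_card)
    also have "\<dots> = (\<Sum>X\<in>A1. t * k)" by (rule sum.cong) (use edges[OF g] in \<open>auto simp: A1_def\<close>)
    finally show "card (\<Union>A1) \<le> card A1 * (t * k)" by simp
  qed
  have "card ({B, C} \<union> A1) = card A1 + 2"
    using ne A fin by (simp add: A1_def)
  moreover have "card A1 + 2 \<le> 2 * t" using cA A(2) t by simp
  ultimately have "(card A1 + 2) * (t * k) + k \<le> card (\<Union>((\<lambda>B. B) ` ({B, C} \<union> A1))) + (card A1 + 2) * k"
    using sparseD[OF inner[OF g], of "{B, C} \<union> A1"] B C fin by (simp add: A1_def)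
  moreover have "\<Union>((\<lambda>B. B) ` ({B, C} \<union> A1)) = (B \<union> C) \<union> \<Union>A1" by auto
  ultimately have J: "(card A1 + 2) * (t * k) + k \<le> card ((B \<union> C) \<union> \<Union>A1) + (card A1 + 2) * k" by simp
  have UI: "card (B \<union> C) + card (\<Union>A1) = card ((B \<union> C) \<union> \<Union>A1) + card ((B \<union> C) \<inter> \<Union>A1)"
    by (rule card_Un_Int) (use B' C' A1 in auto)
  have o: "card ((B \<union> C) \<inter> \<Union>A2) \<le> card A2 * (k - 1)"
  proof (rule card_Int_UN_le[OF fin(2)])
    fix X assume "X \<in> A2"
    then obtain h where h: "h \<in> M" "X \<in> \<G> h" "h \<noteq> g" using A(3) by (auto simp: A2_def)
    have "card (X \<inter> (B \<union> C)) \<le> card (X \<inter> V g)"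
      by (rule card_mono) (use V[OF g] B' C' in auto)
    also have "\<dots> < k" using cross[OF g h(1)] h by blast
    finally show "card (X \<inter> (B \<union> C)) \<le> k - 1" by simp
  qed
  have "B \<union> C \<subseteq> (B \<inter> C) \<union> ((B \<union> C) \<inter> \<Union>A1) \<union> ((B \<union> C) \<inter> \<Union>A2)"
    using cov by (auto simp: A1_def A2_def)
  then have "card (B \<union> C) \<le> card ((B \<inter> C) \<union> ((B \<union> C) \<inter> \<Union>A1) \<union> ((B \<union> C) \<inter> \<Union>A2))"
    by (rule card_mono[rotated]) (use B' C' in auto)
  also have "\<dots> \<le> card (B \<inter> C) + card ((B \<union> C) \<inter> \<Union>A1) + card ((B \<union> C) \<inter> \<Union>A2)"
    by (meson add_le_mono1 card_Un_le order_trans)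
  finally have main: "card (B \<union> C) \<le> card (B \<inter> C) + card ((B \<union> C) \<inter> \<Union>A1) + card A2 * (k - 1)"
    using o by linarith
  define q where "q = card A2 * (k - 1)"
  have q: "q + card A2 = card A2 * k" using k by (cases k) (simp_all add: q_def)
  have "card ((B \<union> C) \<union> \<Union>A1) \<le> card (B \<inter> C) + card (\<Union>A1) + q"
    using main UI unfolding q_def[symmetric] by linarith
  then have "card ((B \<union> C) \<union> \<Union>A1) \<le> k + card A1 * (t * k) + q" using s A1(2) by linarith
  then have "2 * (t * k) \<le> card A1 * k + 2 * k + q" using J by (simp add: distrib_right)
  then have "2 * (t * k) + card A2 \<le> card A1 * k + 2 * k + card A2 * k" using q by linarith
  moreover have "card A1 * k + 2 * k + card A2 * k \<le> 2 * (t * k)"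
  proof -
    have "(card A1 + 2 + card A2) * k \<le> (2 * t) * k" using cA A(2) t by (intro mult_right_mono) auto
    then show ?thesis by (simp add: distrib_right)
  qed
  ultimately have "card A2 = 0" by linarith
  then have sub: "A \<subseteq> \<G> g" using fin by (auto simp: A2_def)
  obtain x where x: "x \<in> B" "\<And>X. X \<in> \<G> g \<Longrightarrow> x \<in> X \<Longrightarrow> X = B" using own[OF g B] by blast
  then have "x \<in> B - C" using C ne by blast
  then obtain X where "X \<in> A" "x \<in> X" using cov by blast
  then show False using x sub A(4) by blast
qed

text \<open>A point of \<open>B \<union> C\<close> lies in \<open>B\<close> and an edge of
  \<open>A1\<close>, in \<open>C\<close> and an edge of \<open>A2\<close>, in both
  \<open>V g\<close> and \<open>V h\<close>, or in a third gadget. Inner sparseness allows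
  \<open>k\<close> points per edge in the first two cases; outer sparseness allows
  \<open>(card J + 1) * k\<close> in the last two together. Since
  \<open>card (B \<inter> C) < k\<close>, this is too few by less than \<open>k\<close>, which the
  bound on \<open>card A\<close> turns into a contradiction.\<close>

lemma different_gadgets:
  assumes g: "g \<in> M" and h: "h \<in> M" and gh: "g \<noteq> h" and B: "B \<in> \<G> g" and C: "C \<in> \<G> h"
    and A: "finite A" "card A \<le> 2 * t - 2" "A \<subseteq> (\<Union>g\<in>M. \<G> g)" "B \<notin> A" "C \<notin> A"
    and cov: "B - C \<subseteq> \<Union>A" "C - B \<subseteq> \<Union>A"
  shows False
proof -
  define A1 where "A1 = A \<inter> \<G> g"
  define A2 where "A2 = A \<inter> \<G> h"
  define A3 where "A3 = A - \<G> g - \<G> h"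
  have fin: "finite A1" "finite A2" "finite A3" using A by (auto simp: A1_def A2_def A3_def)
  have cA: "card A = card A1 + card A2 + card A3"
  proof -
    have "A = A1 \<union> A2 \<union> A3" by (auto simp: A1_def A2_def A3_def)
    moreover have "A1 \<inter> A2 = {}" using disjoint_gadgets[OF g h gh] by (auto simp: A1_def A2_def)
    moreover have "(A1 \<union> A2) \<inter> A3 = {}" by (auto simp: A1_def A2_def A3_def)
    ultimately show ?thesis using fin by (metis card_Un_disjoint finite_UnI)
  qed
  have B': "finite B" "card B = t * k" "B \<subseteq> V g" and C': "finite C" "card C = t * k" "C \<subseteq> V h"
    using edges[OF g B] edge_finite[OF g B] edges[OF h C] edge_finite[OF h C] by auto
  have BC: "card (B \<union> C) + card (B \<inter> C) = 2 * (t * k)"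
    using card_Un_Int[of B C] B' C' by simp
  have "card (B \<inter> C) \<le> card (B \<inter> V h)"
    by (rule card_mono) (use B' C' in auto)
  also have "\<dots> < k" using cross[OF h g _ B] gh by blast
  finally have s: "card (B \<inter> C) < k" .
  have o1: "card (B \<inter> \<Union>A1) \<le> card A1 * k"
  proof (rule card_Int_UN_le[OF fin(1)])
    fix X assume "X \<in> A1"
    then have X: "X \<in> \<G> g" "X \<noteq> B" using A by (auto simp: A1_def)
    show "card (X \<inter> B) \<le> k"
      using sparse_pair[OF inner[OF g], of X B] X B t edges[OF g] edge_finite[OF g] by simp
  qed
  have o2: "card (C \<inter> \<Union>A2) \<le> card A2 * k"
  proof (rule card_Int_UN_le[OF fin(2)])
    fix X assume "X \<in> A2"
    then have X: "X \<in> \<G> h" "X \<noteq> C" using A by (auto simp: A2_def)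
    show "card (X \<inter> C) \<le> k"
      using sparse_pair[OF inner[OF h], of X C] X C t edges[OF h] edge_finite[OF h] by simp
  qed
  \<comment> \<open>One gadget is chosen for each remaining edge; several edges may share it, so
    \<open>J\<close> can be smaller than \<open>A3\<close>.\<close>
  have "\<forall>X\<in>A3. \<exists>i. i \<in> M \<and> X \<in> \<G> i" using A(3) by (auto simp: A3_def)
  then obtain f where f: "\<And>X. X \<in> A3 \<Longrightarrow> f X \<in> M \<and> X \<in> \<G> (f X)" by metis
  define J where "J = f ` A3"
  have J: "finite J" "J \<subseteq> M" "card J \<le> card A3" "g \<notin> J" "h \<notin> J"
    using fin f by (auto simp: J_def card_image_le) (use f in \<open>auto simp: A3_def\<close>)
  define W where "W = \<Union>(V ` J)"
  have Vg: "finite (V g)" "card (V g) = \<gamma>" "finite (V h)" "card (V h) = \<gamma>" using V g h by auto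
  have W: "finite W" "card W \<le> card J * \<gamma>"
  proof -
    show "finite W" using J V by (auto simp: W_def)
    have "card W \<le> (\<Sum>i\<in>J. card (V i))" unfolding W_def by (rule card_UN_le[OF J(1)])
    also have "\<dots> = (\<Sum>i\<in>J. \<gamma>)" by (rule sum.cong) (use V J in auto)
    finally show "card W \<le> card J * \<gamma>" by simp
  qed
  have "card ({g, h} \<union> J) = card J + 2" using J gh by simp
  moreover have "card J + 2 \<le> 2 * t" using J cA A(2) t by simp
  ultimately have "(card J + 2) * \<gamma> + k \<le> card (\<Union>(V ` ({g, h} \<union> J))) + (card J + 2) * k"
    using sparseD[OF outer, of "{g, h} \<union> J"] g h J by simp
  moreover have "\<Union>(V ` ({g, h} \<union> J)) = (V g \<union> V h) \<union> W" by (auto simp: W_def)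
  ultimately have out: "(card J + 2) * \<gamma> + k \<le> card ((V g \<union> V h) \<union> W) + (card J + 2) * k" by simp
  have UI: "card (V g \<union> V h) + card W = card ((V g \<union> V h) \<union> W) + card ((V g \<union> V h) \<inter> W)"
    by (rule card_Un_Int) (use Vg W in auto)
  have UI2: "2 * \<gamma> = card (V g \<union> V h) + card (V g \<inter> V h)"
    using card_Un_Int[of "V g" "V h"] Vg by simp
  have "B \<union> C \<subseteq> (B \<inter> \<Union>A1) \<union> (C \<inter> \<Union>A2) \<union> (V g \<inter> V h) \<union> ((V g \<union> V h) \<inter> W)"
  proof
    fix x assume x: "x \<in> B \<union> C"
    show "x \<in> (B \<inter> \<Union>A1) \<union> (C \<inter> \<Union>A2) \<union> (V g \<inter> V h) \<union> ((V g \<union> V h) \<inter> W)"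
    proof (cases "x \<in> B \<and> x \<in> C")
      case True
      then show ?thesis using B' C' by blast
    next
      case False
      then obtain X where X: "X \<in> A" "x \<in> X" using x cov by blast
      consider "X \<in> A1" | "X \<in> A2" | "X \<in> A3" using X by (auto simp: A1_def A2_def A3_def)
      then show ?thesis
      proof cases
        case 1
        then have "x \<in> V g" using X edges[OF g] by (auto simp: A1_def)
        then show ?thesis using 1 X x C' by blast
      next
        case 2
        then have "x \<in> V h" using X edges[OF h] by (auto simp: A2_def)
        then show ?thesis using 2 X x B' by blast
      next
        case 3
        then have "x \<in> V (f X)" using X edges f by blast
        then have "x \<in> W" using 3 by (auto simp: W_def J_def)
        then show ?thesis using x B' C' by blast
      qed
    qed
  qed
  then have "card (B \<union> C) \<le> card ((B \<inter> \<Union>A1) \<union> (C \<inter> \<Union>A2) \<union> (V g \<inter> V h) \<union> ((V g \<union> V h) \<inter> W))"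
    by (rule card_mono[rotated]) (use B' C' Vg in auto)
  also have "\<dots> \<le> card (B \<inter> \<Union>A1) + card (C \<inter> \<Union>A2) + card (V g \<inter> V h) + card ((V g \<union> V h) \<inter> W)"
    by (meson add_le_mono1 card_Un_le order_trans)
  finally have main: "card (B \<union> C) \<le> card A1 * k + card A2 * k + card (V g \<inter> V h) + card ((V g \<union> V h) \<inter> W)"
    using o1 o2 by linarith
  have "card ((V g \<union> V h) \<union> W) + card (B \<union> C) \<le> card A1 * k + card A2 * k + 2 * \<gamma> + card J * \<gamma>"
    using main UI UI2 W(2) by linarith
  then have "k + card (B \<union> C) \<le> card A1 * k + card A2 * k + (card J * k + 2 * k)"
    using out by (simp add: distrib_right)
  then have "2 * (t * k) < card A1 * k + card A2 * k + card J * k + 2 * k"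
    using BC s by linarith
  moreover have "card A1 * k + card A2 * k + card J * k + 2 * k \<le> 2 * (t * k)"
  proof -
    have "(card A1 + card A2 + card J + 2) * k \<le> (2 * t) * k" using cA A(2) t J by (intro mult_right_mono) auto
    then show ?thesis by (simp add: distrib_right)
  qed
  ultimately show False by linarith
qed

lemma cancellative_gadgets: "cancellative (2 * (t - 1)) (\<Union>g\<in>M. \<G> g)"
  unfolding cancellative_def
proof (intro allI ballI impI notI)
  fix A :: "nat \<Rightarrow> 'v set" and B C
  assume B: "B \<in> (\<Union>g\<in>M. \<G> g)" and C: "C \<in> (\<Union>g\<in>M. \<G> g)"
    and A: "\<forall>i\<in>{1..2 * (t - 1)}. A i \<in> (\<Union>g\<in>M. \<G> g)" "B \<notin> A ` {1..2 * (t - 1)}" "C \<notin> A ` {1..2 * (t - 1)}"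
    and ne: "B \<noteq> C" and eq: "(\<Union>i\<in>{1..2 * (t - 1)}. A i) \<union> B = (\<Union>i\<in>{1..2 * (t - 1)}. A i) \<union> C"
  define \<A> where "\<A> = A ` {1..2 * (t - 1)}"
  have "card \<A> \<le> card {1..2 * (t - 1)}" unfolding \<A>_def by (rule card_image_le) simp
  then have c: "finite \<A>" "card \<A> \<le> 2 * t - 2" by (simp_all add: \<A>_def)
  have sub: "\<A> \<subseteq> (\<Union>g\<in>M. \<G> g)" unfolding \<A>_def using A(1) by blast
  have "\<Union>\<A> \<union> B = \<Union>\<A> \<union> C" using eq by (simp only: \<A>_def)
  then have cov: "B - C \<subseteq> \<Union>\<A>" "C - B \<subseteq> \<Union>\<A>" by blast+
  have notin: "B \<notin> \<A>" "C \<notin> \<A>" using A(2,3) by (simp_all only: \<A>_def not_False_eq_True)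
  obtain g where g: "g \<in> M" "B \<in> \<G> g" using B by (rule UN_E)
  obtain h where h: "h \<in> M" "C \<in> \<G> h" using C by (rule UN_E)
  show False
  proof (cases "g = h")
    case True
    then show False using same_gadget[OF g _ ne c sub notin cov] h by blast
  next
    case False
    then show False using different_gadgets[OF g(1) h(1) _ g(2) h(2) c sub notin cov] by blast
  qed
qed

end

section \<open>The upper bound\<close>

definition k_sets :: "'a set \<Rightarrow> nat \<Rightarrow> 'a set set" where
  "k_sets X k = {S. S \<subseteq> X \<and> card S = k}"

lemma k_sets_finite: "finite X \<Longrightarrow> finite (k_sets X k)"
  by (simp add: k_sets_def)

lemma k_sets_mono: "A \<subseteq> B \<Longrightarrow> k_sets A k \<subseteq> k_sets B k"
  unfolding k_sets_def by blast

lemma card_k_sets: "finite X \<Longrightarrow> card (k_sets X k) = card X choose k"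
  by (simp add: k_sets_def n_subsets)

definition k_partition :: "'a set \<Rightarrow> nat \<Rightarrow> 'a set set \<Rightarrow> bool" where
  "k_partition X k P \<longleftrightarrow> P \<subseteq> k_sets X k \<and> disjoint P \<and> \<Union>P = X"

text \<open>In a random partition a fixed \<open>k\<close>-set is a part with probability
  \<open>t / ((t * k) choose k)\<close>, and a union bound over \<open>F\<close> must reach 1. The
  induction does this by counting: for \<open>S\<close> outside \<open>F\<close>, the members of
  \<open>F\<close> disjoint from \<open>S\<close> hit all partitions of \<open>X - S\<close>; double
  counting the disjoint pairs gives \<open>card N \<le> t * card F\<close>.\<close>

lemma hitting_partitions:
  assumes "t \<ge> 1" "k \<ge> 1" "finite X" "card X = t * k" "F \<subseteq> k_sets X k"
    and "\<And>P. k_partition X k P \<Longrightarrow> P \<inter> F \<noteq> {}"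
  shows "(t * k) choose k \<le> t * card F"
  using assms
proof (induction t arbitrary: X F rule: nat_induct_at_least)
  case base
  have "k_partition X k {X}" using base by (auto simp: k_partition_def k_sets_def)
  then have "F \<noteq> {}" using base by blast
  moreover have "finite F" using base k_sets_finite finite_subset by metis
  ultimately have "card F \<ge> 1" by (simp add: Suc_le_eq card_gt_0_iff)
  then show ?case by simp
next
  case (Suc t)
  define c where "c = (t * k) choose k"
  define N where "N = k_sets X k - F"
  have finX: "finite X" and finF: "finite F" and finN: "finite N"
    using Suc.prems k_sets_finite finite_subset unfolding N_def by (metis, metis, metis finite_Diff)
  have c: "c > 0" using mult_le_mono1[OF Suc.hyps, of k] by (simp add: c_def zero_less_binomial_iff)
  have cardD: "card (X - S) = t * k" if "S \<in> k_sets X k" for S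
    using that Suc.prems finX by (simp add: k_sets_def card_Diff_subset finite_subset[of S X])
  have each: "c \<le> t * card {T \<in> F. T \<inter> S = {}}" if S: "S \<in> N" for S
  proof -
    have Sk: "S \<in> k_sets X k" "S \<notin> F" using S by (auto simp: N_def)
    show ?thesis
      unfolding c_def
    proof (rule Suc.IH)
      show "finite (X - S)" using finX by simp
      show "card (X - S) = t * k" using cardD Sk by blast
      show "{T \<in> F. T \<inter> S = {}} \<subseteq> k_sets (X - S) k"
        using Suc.prems(4) by (auto simp: k_sets_def)
      fix P assume P: "k_partition (X - S) k P"
      have "k_partition X k (insert S P)"
        using P Sk(1) unfolding k_partition_def k_sets_def disjoint_def by (auto; blast)
      then have "insert S P \<inter> F \<noteq> {}" by (rule Suc.prems(5))
      then obtain T where T: "T \<in> P" "T \<in> F" using Sk by blast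
      then have "T \<inter> S = {}" using P by (auto simp: k_partition_def)
      then show "P \<inter> {T \<in> F. T \<inter> S = {}} \<noteq> {}" using T by blast
    qed (use Suc in auto)
  qed
  have "card N * c = (\<Sum>S\<in>N. c)" by simp
  also have "\<dots> \<le> (\<Sum>S\<in>N. t * card {T \<in> F. T \<inter> S = {}})" by (rule sum_mono) (rule each)
  also have "\<dots> = t * (\<Sum>S\<in>N. \<Sum>T | T \<in> F \<and> T \<inter> S = {}. 1)" by (simp add: sum_distrib_left)
  also have "(\<Sum>S\<in>N. \<Sum>T | T \<in> F \<and> T \<inter> S = {}. 1) = (\<Sum>T\<in>F. \<Sum>S | S \<in> N \<and> T \<inter> S = {}. 1)"
    by (rule sum.swap_restrict[OF finN finF])
  also have "\<dots> \<le> (\<Sum>T\<in>F. c)"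
  proof (rule sum_mono)
    fix T assume T: "T \<in> F"
    have "card {S. S \<in> N \<and> T \<inter> S = {}} \<le> card (k_sets (X - T) k)"
      by (rule card_mono) (use finX k_sets_finite[of "X - T"] in \<open>auto simp: N_def k_sets_def\<close>)
    also have "\<dots> = c" using cardD[of T] T Suc.prems(4) finX by (simp add: card_k_sets c_def subset_iff)
    finally show "(\<Sum>S | S \<in> N \<and> T \<inter> S = {}. 1) \<le> c" by simp
  qed
  finally have "card N * c \<le> t * (card F * c)" by simp
  then have "card N \<le> t * card F" using c by simp
  moreover have "card N = (Suc t * k choose k) - card F"
    unfolding N_def using Suc.prems finX finF by (simp add: card_Diff_subset card_k_sets)
  ultimately show ?case by simp
qed

lemma choose_multiple:
  assumes "t \<ge> 1" "k \<ge> 1"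
  shows "(t * k) choose k = t * ((t * k - 1) choose (k - 1))"
proof -
  have "k * ((t * k) choose k) = (t * k) * ((t * k - 1) choose (k - 1))"
    using Suc_times_binomial_eq[of "t * k - 1" "k - 1"] assms
    by (simp add: mult.commute)
  then have "k * ((t * k) choose k) = k * (t * ((t * k - 1) choose (k - 1)))"
    by (simp add: mult.assoc mult.left_commute)
  then show ?thesis using assms by simp
qed

text \<open>\<open>semi_own\<close> collects the \<open>k\<close>-sets charged to the edge \<open>B\<close>: those in no other edge, and those
  belonging to a partition of \<open>B\<close> all of whose parts lie in other edges. A set of the second kind that
  is charged to both \<open>B\<close> and \<open>C\<close> leaves \<open>t - 1\<close> parts on either side, which cover the symmetric
  difference of \<open>B\<close> and \<open>C\<close> by \<open>2 * (t - 1)\<close> edges.\<close>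

definition shared :: "'a set set \<Rightarrow> 'a set \<Rightarrow> 'a set \<Rightarrow> bool" where
  "shared H B S \<longleftrightarrow> (\<exists>C\<in>H. C \<noteq> B \<and> S \<subseteq> C)"

definition semi_own :: "'a set set \<Rightarrow> nat \<Rightarrow> 'a set \<Rightarrow> 'a set set" where
  "semi_own H k B = {S \<in> k_sets B k. \<not> shared H B S \<or> (\<exists>P. k_partition B k P \<and> (\<forall>T\<in>P. shared H B T) \<and> S \<in> P)}"

lemma card_semi_own:
  assumes "t \<ge> 1" "k \<ge> 1" "finite B" "card B = t * k"
  shows "(t * k - 1) choose (k - 1) \<le> card (semi_own H k B)"
proof -
  have "(t * k) choose k \<le> t * card (semi_own H k B)"
  proof (rule hitting_partitions[OF assms])
    show "semi_own H k B \<subseteq> k_sets B k" by (auto simp: semi_own_def)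
    fix P assume P: "k_partition B k P"
    have "B \<noteq> {}" using assms by auto
    then obtain T where T: "T \<in> P" using P by (auto simp: k_partition_def)
    show "P \<inter> semi_own H k B \<noteq> {}"
    proof (cases "\<forall>T\<in>P. shared H B T")
      case True
      then have "T \<in> semi_own H k B" using P T unfolding semi_own_def k_partition_def by blast
      with T show ?thesis by blast
    next
      case False
      then obtain T' where "T' \<in> P" "\<not> shared H B T'" by blast
      moreover from this have "T' \<in> semi_own H k B" using P unfolding semi_own_def k_partition_def by blast
      ultimately show ?thesis by blast
    qed
  qed
  then show ?thesis using choose_multiple[OF assms(1,2)] assms(1) by simp
qed

lemma partition_cover:
  assumes B: "finite B" "card B = t * k" "k \<ge> 1" and P: "k_partition B k P" "\<forall>T\<in>P. shared H B T"
    and S: "S \<in> P" "S \<subseteq> C"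
  obtains A where "A \<subseteq> H - {B}" "card A \<le> t - 1" "finite A" "B - C \<subseteq> \<Union>(A - {C})"
proof -
  have PB: "P \<subseteq> k_sets B k" "disjoint P" "\<Union>P = B" using P by (auto simp: k_partition_def)
  have finP: "finite P" using PB k_sets_finite[OF B(1)] finite_subset by blast
  have "card P * k = (\<Sum>T\<in>P. card T)" using PB by (subst sum.cong[where h="\<lambda>_. k"]) (auto simp: k_sets_def)
  also have "\<dots> = card (\<Union>P)"
    by (rule card_Union_disjoint[symmetric]) (use PB B in \<open>auto simp: k_sets_def disjoint_def pairwise_def disjnt_def intro: finite_subset\<close>)
  finally have cP: "card P = t" using B PB by simp
  obtain f where f: "\<And>T. T \<in> P \<Longrightarrow> f T \<in> H \<and> f T \<noteq> B \<and> T \<subseteq> f T"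
    using P(2) unfolding shared_def by metis
  show ?thesis
  proof (rule that[of "f ` (P - {S})"])
    show "f ` (P - {S}) \<subseteq> H - {B}" using f by blast
    have "card (f ` (P - {S})) \<le> card (P - {S})" using finP by (intro card_image_le) simp
    then show "card (f ` (P - {S})) \<le> t - 1" using cP S finP by simp
    show "finite (f ` (P - {S}))" using finP by simp
    show "B - C \<subseteq> \<Union>(f ` (P - {S}) - {C})"
    proof
      fix x assume x: "x \<in> B - C"
      then obtain T where T: "T \<in> P" "x \<in> T" using PB by blast
      then have "T \<noteq> S" "f T \<noteq> C" "x \<in> f T" using x S f by blast+
      then show "x \<in> \<Union>(f ` (P - {S}) - {C})" using T by blast
    qed
  qed
qed

text \<open>The definition speaks of exactly \<open>m\<close> distinct further edges. A smaller
  cover is padded with arbitrary edges, which keeps it a cover; \<open>m + 2 \<le> card H\<close>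
  provides enough of them.\<close>

lemma cancellativeD:
  assumes canc: "cancellative m H" and H: "finite H" "m + 2 \<le> card H"
    and BC: "B \<in> H" "C \<in> H" "B \<noteq> C" and A: "A \<subseteq> H - {B, C}" "card A \<le> m"
    and cov: "B - C \<subseteq> \<Union>A" "C - B \<subseteq> \<Union>A"
  shows False
proof -
  have "card (H - {B, C}) = card H - 2" using BC H by (simp add: card_Diff_subset)
  then have "m \<le> card (H - {B, C})" using H by simp
  then obtain A' where A': "A \<subseteq> A'" "A' \<subseteq> H - {B, C}" "card A' = m"
    using exists_subset_between[OF A(2) _ A(1)] H(1) by auto
  have "finite A'" by (rule finite_subset[OF A'(2)]) (use H in simp)
  then obtain h where h: "bij_betw h {1..m} A'" using ex_bij_betw_nat_finite_1[of A'] A'(3) by auto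
  then have im: "h ` {1..m} = A'" and inj: "inj_on h {1..m}" by (auto simp: bij_betw_def)
  have "\<forall>i\<in>{1..m}. h i \<in> H" using im A' by blast
  moreover have "B \<notin> h ` {1..m}" "C \<notin> h ` {1..m}" using im A' by auto
  ultimately have "\<Union>A' \<union> B \<noteq> \<Union>A' \<union> C"
    using canc BC inj unfolding cancellative_def im[symmetric] by blast
  then show False using cov A'(1) by blast
qed

lemma cancellative_upper_bound:
  assumes t: "t \<ge> 1" and k: "k \<ge> 1" and H: "uniform_hypergraph V (t * k) H"
    and canc: "cancellative (2 * (t - 1)) H" and card: "2 * t \<le> card H"
  shows "card H * ((t * k - 1) choose (k - 1)) \<le> card V choose k"
proof -
  have V: "finite V" using H by (simp add: uniform_hypergraph_def)
  have edge: "\<And>B. B \<in> H \<Longrightarrow> B \<subseteq> V \<and> card B = t * k \<and> finite B"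
    using H finite_subset[OF _ V] by (simp add: uniform_hypergraph_def)
  have finH: "finite H" using card t card_ge_0_finite[of H] by auto
  have disj: "semi_own H k B \<inter> semi_own H k C = {}" if BC: "B \<in> H" "C \<in> H" "B \<noteq> C" for B C
  proof (rule ccontr)
    assume "semi_own H k B \<inter> semi_own H k C \<noteq> {}"
    then obtain S where S: "S \<in> semi_own H k B" "S \<in> semi_own H k C" by blast
    \<comment> \<open>Lying in both edges, \<open>S\<close> is shared on either side, so only the
      partition clause of \<open>semi_own\<close> can have charged it.\<close>
    have sub: "S \<subseteq> B" "S \<subseteq> C" using S by (auto simp: semi_own_def k_sets_def)
    then have "shared H B S" "shared H C S" using BC unfolding shared_def by blast+
    then obtain P Q where P: "k_partition B k P" "\<forall>T\<in>P. shared H B T" "S \<in> P"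
      and Q: "k_partition C k Q" "\<forall>T\<in>Q. shared H C T" "S \<in> Q"
      using S unfolding semi_own_def by blast
    obtain A1 where A1: "A1 \<subseteq> H - {B}" "card A1 \<le> t - 1" "finite A1" "B - C \<subseteq> \<Union>(A1 - {C})"
      using partition_cover[of B t k P H S C] edge[OF BC(1)] k P sub by metis
    obtain A2 where A2: "A2 \<subseteq> H - {C}" "card A2 \<le> t - 1" "finite A2" "C - B \<subseteq> \<Union>(A2 - {B})"
      using partition_cover[of C t k Q H S B] edge[OF BC(2)] k Q sub by metis
    have "card ((A1 \<union> A2) - {B, C}) \<le> card (A1 \<union> A2)" using A1 A2 by (intro card_mono) auto
    also have "\<dots> \<le> 2 * (t - 1)" using card_Un_le[of A1 A2] A1 A2 by linarith
    finally have c: "card ((A1 \<union> A2) - {B, C}) \<le> 2 * (t - 1)" .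
    show False
    proof (rule cancellativeD[OF canc finH _ BC _ c])
      show "2 * (t - 1) + 2 \<le> card H" using card t by simp
      show "A1 \<union> A2 - {B, C} \<subseteq> H - {B, C}" using A1 A2 by blast
      have "A1 - {C} \<subseteq> A1 \<union> A2 - {B, C}" using A1(1) by blast
      then show "B - C \<subseteq> \<Union>(A1 \<union> A2 - {B, C})" by (rule order_trans[OF A1(4) Union_mono])
      have "A2 - {B} \<subseteq> A1 \<union> A2 - {B, C}" using A2(1) by blast
      then show "C - B \<subseteq> \<Union>(A1 \<union> A2 - {B, C})" by (rule order_trans[OF A2(4) Union_mono])
    qed
  qed
  have "card H * ((t * k - 1) choose (k - 1)) = (\<Sum>B\<in>H. (t * k - 1) choose (k - 1))" by simp
  also have "\<dots> \<le> (\<Sum>B\<in>H. card (semi_own H k B))"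
    using edge t k by (intro sum_mono card_semi_own) auto
  also have "\<dots> = card (\<Union>B\<in>H. semi_own H k B)"
  proof (rule card_UN_disjoint[symmetric])
    show "\<forall>B\<in>H. finite (semi_own H k B)"
    proof
      fix B assume "B \<in> H"
      then show "finite (semi_own H k B)"
        using k_sets_finite[of B k] edge unfolding semi_own_def by simp
    qed
  qed (use finH disj in auto)
  also have "\<dots> \<le> card (k_sets V k)"
  proof (rule card_mono[OF k_sets_finite[OF V]])
    show "(\<Union>B\<in>H. semi_own H k B) \<subseteq> k_sets V k" using edge by (auto simp: semi_own_def k_sets_def)
  qed
  also have "\<dots> = card V choose k" by (rule card_k_sets[OF V])
  finally show ?thesis .
qed

section \<open>Existence of the gadget\<close>

lemma finite_dense_configs: "finite I \<Longrightarrow> finite (dense_configs r k m V I)"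
  by (rule finite_subset[of _ "Pow I"]) (auto simp: dense_configs_def)

lemma dense_configs_subset:
  "X \<subseteq> I \<Longrightarrow> dense_configs r k m V X = {J \<in> dense_configs r k m V I. J \<subseteq> X}"
  by (auto simp: dense_configs_def)

lemma sparse_remove_dense: "sparse r k m V (X - \<Union>(dense_configs r k m V X))"
  unfolding sparse_def
proof (rule ccontr)
  assume "dense_configs r k m V (X - \<Union>(dense_configs r k m V X)) \<noteq> {}"
  then obtain J where J: "J \<in> dense_configs r k m V (X - \<Union>(dense_configs r k m V X))" by blast
  then have "J \<in> dense_configs r k m V X" "J \<noteq> {}" by (auto simp: dense_configs_def)
  then show False using J by (auto simp: dense_configs_def)
qed

lemma card_Union_dense: "finite X \<Longrightarrow> card (\<Union>(dense_configs r k m V X)) \<le> m * card (dense_configs r k m V X)"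
proof -
  assume X: "finite X"
  have "card (\<Union>(dense_configs r k m V X)) \<le> (\<Sum>J\<in>dense_configs r k m V X. card J)"
    by (rule card_Union_le_sum_card)
  also have "\<dots> \<le> (\<Sum>J\<in>dense_configs r k m V X. m)"
    by (rule sum_mono) (simp add: dense_configs_def)
  finally show ?thesis by (simp add: mult.commute)
qed

text \<open>Deletion method: the random family has at least \<open>2 * \<Lambda> * w ^ k\<close>
  expected members but only order \<open>w ^ (k - 1)\<close> expected dense configurations, so for
  large \<open>w\<close> removing all members of these costs at most half of that bound.\<close>

lemma sparse_family_exists:
  fixes \<Lambda> :: real
  assumes k: "1 \<le> k" "k < r" and m: "m \<ge> 1" and \<Lambda>: "\<Lambda> > 0"
  obtains w T where "w \<ge> 1" "T \<subseteq> k_sets {..<w} r" "sparse r k m (\<lambda>B. B) T" "\<Lambda> * real w ^ k \<le> card T"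
proof -
  \<comment> \<open>\<open>r ^ r\<close> compensates for the estimate \<open>(w / r) ^ r\<close> of
    \<open>w choose r\<close>; the factor 2 leaves room for the deletion.\<close>
  define \<kappa> where "\<kappa> = 2 * \<Lambda> * real r ^ r"
  define c :: nat where "c = 2 ^ (m * r)"
  define C where "C = (\<Sum>j\<le>m. \<kappa> ^ j) * 2 ^ c"
  have \<kappa>: "\<kappa> > 0" using \<Lambda> k by (simp add: \<kappa>_def)
  have C: "C \<ge> 0" using \<kappa> by (simp add: C_def sum_nonneg)
  \<comment> \<open>\<open>w \<ge> \<kappa>\<close> makes \<open>p\<close> a probability, because
    \<open>r - k \<ge> 1\<close>; \<open>w \<ge> m * C / \<Lambda>\<close> keeps the deletion below
    \<open>\<Lambda> * w ^ k\<close>.\<close>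
  define w where "w = nat \<lceil>max \<kappa> (m * C / \<Lambda>)\<rceil> + m * r + r + 1"
  have w: "real w \<ge> \<kappa>" "real w \<ge> m * C / \<Lambda>" "w \<ge> m * r" "w \<ge> r" "w \<ge> 1"
    unfolding w_def by linarith+
  define I where "I = k_sets {..<w} r"
  define p where "p = \<kappa> / real w ^ (r - k)"
  define Dn where "Dn = dense_configs r k m (\<lambda>B. B) I"
  have finI: "finite I" by (simp add: I_def k_sets_finite)
  have finD: "finite Dn" using finite_dense_configs[OF finI] by (simp add: Dn_def)
  have "real w ^ 1 \<le> real w ^ (r - k)" using w k by (intro power_increasing) auto
  then have "\<kappa> \<le> real w ^ (r - k)" unfolding power_one_right by (rule order_trans[OF w(1)])
  then have p: "0 \<le> p" "p \<le> 1" using w \<kappa> by (simp_all add: p_def)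
  have pw: "p * real w ^ (r - k) = \<kappa>" using w by (simp add: p_def)
  define f where "f X = real m * (\<Sum>J\<in>Dn. of_bool (J \<subseteq> X)) - (\<Sum>B\<in>I. of_bool ({B} \<subseteq> X) :: real)" for X
  have "bern (\<lambda>_. p) I f = m * (\<Sum>J\<in>Dn. p ^ card J) - p * card I"
  proof -
    have "bern (\<lambda>_. p) I f = m * (\<Sum>J\<in>Dn. bern (\<lambda>_. p) I (\<lambda>X. of_bool (J \<subseteq> X)))
        - (\<Sum>B\<in>I. bern (\<lambda>_. p) I (\<lambda>X. of_bool ({B} \<subseteq> X)))"
      unfolding f_def by (simp only: bern_diff bern_cmult bern_sum)
    also have "(\<Sum>J\<in>Dn. bern (\<lambda>_. p) I (\<lambda>X. of_bool (J \<subseteq> X))) = (\<Sum>J\<in>Dn. p ^ card J)"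
    proof (rule sum.cong[OF refl])
      fix J assume "J \<in> Dn"
      then have "J \<subseteq> I" by (simp add: Dn_def dense_configs_def)
      then show "bern (\<lambda>_. p) I (\<lambda>X. of_bool (J \<subseteq> X)) = p ^ card J" by (simp only: bern_subset[OF finI] prod_constant)
    qed
    also have "(\<Sum>B\<in>I. bern (\<lambda>_. p) I (\<lambda>X. of_bool ({B} \<subseteq> X))) = (\<Sum>B\<in>I. p)"
    proof (rule sum.cong[OF refl])
      fix B assume "B \<in> I"
      then have "{B} \<subseteq> I" by simp
      then have "bern (\<lambda>_. p) I (\<lambda>X. of_bool ({B} \<subseteq> X)) = p ^ card {B}" by (simp only: bern_subset[OF finI] prod_constant)
      then show "bern (\<lambda>_. p) I (\<lambda>X. of_bool ({B} \<subseteq> X)) = p" by simp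
    qed
    finally show ?thesis by simp
  qed
  also have "\<dots> \<le> m * (C * real w ^ (k - 1)) - 2 * \<Lambda> * real w ^ k"
  proof (rule diff_mono)
    have "(\<Sum>J\<in>Dn. p ^ card J) \<le> C * real w ^ (k - 1)"
      unfolding Dn_def C_def
    proof (rule dense_configs_weight[OF finI])
      fix U :: "nat set" assume U: "U \<subseteq> {..<w}" "card U \<le> m * r"
      have "finite U" using U(1) by (rule finite_subset) simp
      then have "card {i \<in> I. i \<subseteq> U} \<le> card (Pow U)" by (intro card_mono) auto
      also have "\<dots> \<le> c" using U \<open>finite U\<close> by (simp add: card_Pow c_def)
      finally show "card {i \<in> I. i \<subseteq> U} \<le> c" .
    qed (use k m w p pw in \<open>auto simp: I_def k_sets_def\<close>)
    then show "m * (\<Sum>J\<in>Dn. p ^ card J) \<le> m * (C * real w ^ (k - 1))" by (rule mult_left_mono) simp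
    have "(real w / real r) ^ r \<le> card I"
      using binomial_ge_n_over_k_pow_k[of r w, where 'a=real] w by (simp add: I_def card_k_sets)
    then have "p * (real w / real r) ^ r \<le> p * card I" using p by (intro mult_left_mono) auto
    moreover have "p * (real w / real r) ^ r = 2 * \<Lambda> * real w ^ k"
    proof -
      have "p * (real w / real r) ^ r = \<kappa> * (real w ^ r / real w ^ (r - k)) / real r ^ r"
        by (simp add: p_def power_divide)
      also have "real w ^ r / real w ^ (r - k) = real w ^ k"
        using w k by (simp flip: power_diff)
      finally show ?thesis using k by (simp add: \<kappa>_def)
    qed
    ultimately show "2 * \<Lambda> * real w ^ k \<le> p * card I" by simp
  qed
  also have "\<dots> \<le> - (\<Lambda> * real w ^ k)"
  proof -
    have "m * C \<le> \<Lambda> * w" using w(2) \<Lambda> by (simp add: field_simps)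
    then have "m * C * real w ^ (k - 1) \<le> \<Lambda> * w * real w ^ (k - 1)" by (intro mult_right_mono) auto
    also have "\<dots> = \<Lambda> * real w ^ k" using k by (cases k) auto
    finally show ?thesis by simp
  qed
  finally obtain X where X: "X \<subseteq> I" "f X \<le> - (\<Lambda> * real w ^ k)"
    using bern_le_witness[OF finI, of "\<lambda>_. p"] p by metis
  have finX: "finite X" using X(1) finI by (rule finite_subset)
  define T where "T = X - \<Union>(dense_configs r k m (\<lambda>B. B) X)"
  have "f X = m * real (card (dense_configs r k m (\<lambda>B. B) X)) - card X"
  proof -
    have "(\<Sum>J\<in>Dn. of_bool (J \<subseteq> X) :: real) = card (dense_configs r k m (\<lambda>B. B) X)"
      using finD unfolding dense_configs_subset[OF X(1)] Dn_def[symmetric]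
      by (simp add: of_bool_def sum.If_cases Int_def)
    moreover have "I \<inter> {B. B \<in> X} = X" using X(1) by auto
    then have "(\<Sum>B\<in>I. of_bool ({B} \<subseteq> X) :: real) = card X"
      using finI by (simp add: of_bool_def sum.If_cases)
    ultimately show ?thesis by (simp add: f_def)
  qed
  moreover have "card X \<le> card (T \<union> \<Union>(dense_configs r k m (\<lambda>B. B) X))"
  proof (rule card_mono)
    have "\<Union>(dense_configs r k m (\<lambda>B. B) X) \<subseteq> X" by (auto simp: dense_configs_def)
    then show "finite (T \<union> \<Union>(dense_configs r k m (\<lambda>B. B) X))"
      using finX by (auto simp: T_def intro: finite_subset)
  qed (auto simp: T_def)
  then have "card X \<le> card T + card (\<Union>(dense_configs r k m (\<lambda>B. B) X))"
    using card_Un_le order_trans by blast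
  then have "card X \<le> card T + m * card (dense_configs r k m (\<lambda>B. B) X)"
    using card_Union_dense[OF finX, of r k m "\<lambda>B. B"] by linarith
  then have "real (card X) \<le> real (card T + m * card (dense_configs r k m (\<lambda>B. B) X))" by (rule of_nat_mono)
  ultimately have "\<Lambda> * real w ^ k \<le> card T" using X(2) by simp
  moreover have "T \<subseteq> k_sets {..<w} r" using X(1) by (auto simp: T_def I_def)
  moreover have "sparse r k m (\<lambda>B. B) T" unfolding T_def by (rule sparse_remove_dense)
  ultimately show ?thesis using that w by blast
qed

lemma card_k_sets_containing:
  assumes "finite A" "x \<notin> A" "k \<ge> 1"
  shows "card {S \<in> k_sets (insert x A) k. x \<in> S} \<le> card A choose (k - 1)"
proof -
  have im: "(\<lambda>S. S - {x}) ` {S \<in> k_sets (insert x A) k. x \<in> S} \<subseteq> k_sets A (k - 1)"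
    by (auto simp: k_sets_def)
  have inj: "inj_on (\<lambda>S. S - {x}) {S \<in> k_sets (insert x A) k. x \<in> S}"
  proof (rule inj_onI)
    fix S S' assume "S \<in> {S \<in> k_sets (insert x A) k. x \<in> S}" "S' \<in> {S \<in> k_sets (insert x A) k. x \<in> S}"
      "S - {x} = S' - {x}"
    then show "S = S'" using insert_Diff[of x S] insert_Diff[of x S'] by simp
  qed
  have "card {S \<in> k_sets (insert x A) k. x \<in> S} \<le> card (k_sets A (k - 1))"
    by (rule card_inj_on_le[OF inj im k_sets_finite[OF assms(1)]])
  then show ?thesis by (simp add: card_k_sets[OF assms(1)])
qed

lemma gadget_exists:
  fixes e :: real
  assumes t: "t \<ge> 2" and k: "k \<ge> 2" and e: "e > 0"
  obtains \<G> :: "(nat + nat set) set set" where "finite \<G>" "\<G> \<noteq> {}"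
    "\<And>B. B \<in> \<G> \<Longrightarrow> finite B \<and> card B = t * k"
    "\<And>B. B \<in> \<G> \<Longrightarrow> \<exists>x\<in>B. \<forall>A\<in>\<G>. x \<in> A \<longrightarrow> A = B"
    "sparse (t * k) k (2 * t) (\<lambda>B. B) \<G>"
    "card (\<Union>B\<in>\<G>. k_sets B k) \<le> card \<G> * (((t * k - 1) choose (k - 1)) + e)"
proof -
  define r where "r = t * k - 1"
  have "2 * k \<le> t * k" using t by (rule mult_right_mono) simp
  then have rk: "r + 1 = t * k" "k < r" using k unfolding r_def by linarith+
  \<comment> \<open>With density \<open>1 / e\<close> the at most \<open>w ^ k\<close> shadow sets
    without private vertex amount to at most \<open>e\<close> per edge.\<close>
  obtain w T where w: "w \<ge> 1" and T: "T \<subseteq> k_sets {..<w} r" "sparse r k (2 * t) (\<lambda>B. B) T"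
    and cT: "1 / e * real w ^ k \<le> card T"
    using sparse_family_exists[of k r "2 * t" "1 / e"] k rk t e by auto
  have finT: "finite T" using T(1) k_sets_finite[of "{..<w}" r] by (auto intro: finite_subset)
  have Tm: "finite S" "card S = r" "S \<subseteq> {..<w}" if "S \<in> T" for S
    using that T(1) by (auto simp: k_sets_def intro: finite_subset)
  \<comment> \<open>The base set itself names the private vertex \<open>Inr S\<close>; the sum type
    separates it from the base points.\<close>
  define \<beta> :: "nat set \<Rightarrow> (nat + nat set) set" where "\<beta> S = insert (Inr S) (Inl ` S)" for S
  have own: "S = S'" if "Inr S \<in> \<beta> S'" for S S' using that by (auto simp: \<beta>_def)
  have inj: "inj_on \<beta> A" for A
    by (rule inj_onI) (metis own \<beta>_def insertI1)
  have c\<beta>: "finite (\<beta> S) \<and> card (\<beta> S) = t * k" if "S \<in> T" for S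
    using Tm[OF that] rk by (auto simp: \<beta>_def card_insert_if card_image)
  show ?thesis
  proof (rule that[of "\<beta> ` T"])
    show "finite (\<beta> ` T)" using finT by simp
    have "0 < 1 / e * real w ^ k" using w e by simp
    then have "card T > 0" using cT by linarith
    then show "\<beta> ` T \<noteq> {}" by auto
    show "finite B \<and> card B = t * k" if "B \<in> \<beta> ` T" for B using that c\<beta> by blast
    show "\<exists>x\<in>B. \<forall>A\<in>\<beta> ` T. x \<in> A \<longrightarrow> A = B" if B: "B \<in> \<beta> ` T" for B
    proof -
      obtain S where S: "B = \<beta> S" using B by blast
      show ?thesis
      proof (rule bexI[of _ "Inr S"])
        show "\<forall>A\<in>\<beta> ` T. Inr S \<in> A \<longrightarrow> A = B" unfolding S using own by blast
        show "Inr S \<in> B" by (simp add: S \<beta>_def)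
      qed
    qed
    show "sparse (t * k) k (2 * t) (\<lambda>B. B) (\<beta> ` T)"
      unfolding sparse_def
    proof (rule ccontr)
      assume "dense_configs (t * k) k (2 * t) (\<lambda>B. B) (\<beta> ` T) \<noteq> {}"
      then obtain J where J: "J \<subseteq> \<beta> ` T" "finite J" "J \<noteq> {}" "card J \<le> 2 * t"
        "card (\<Union>J) + card J * k < card J * (t * k) + k"
        by (auto simp: dense_configs_def)
      then obtain J' where J': "J' \<subseteq> T" "J = \<beta> ` J'" by (auto simp: subset_image_iff)
      have cJ: "card J = card J'" using J'(2) card_image[OF inj] by simp
      have finJ': "finite J'" using J'(1) finT by (rule finite_subset)
      have "card J' * r + k \<le> card (\<Union>J') + card J' * k"
        using sparseD[OF T(2) J'(1) finJ'] J cJ J'(2) by auto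
      \<comment> \<open>One private point per edge adds the same amount to both sides of the
        sparseness inequality, so the step from \<open>r\<close> to \<open>t * k = r + 1\<close>
        keeps it.\<close>
      moreover have "card (\<Union>J) = card (\<Union>J') + card J'"
      proof -
        have finU: "finite (\<Union>J')" using finJ' Tm(1) J'(1) by (intro finite_Union) auto
        have "\<Union>J = Inl ` \<Union>J' \<union> Inr ` J'" unfolding J'(2) \<beta>_def by auto
        moreover have "card (Inl ` \<Union>J' \<union> Inr ` J' :: (nat + nat set) set) = card (Inl ` \<Union>J' :: (nat + nat set) set) + card (Inr ` J' :: (nat + nat set) set)"
          by (rule card_Un_disjoint) (use finJ' finU in auto)
        ultimately show ?thesis by (simp add: card_image)
      qed
      moreover have "card J' * (t * k) = card J' * r + card J'" by (simp flip: rk(1))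
      ultimately show False using J(5) cJ by simp
    qed
    have "(\<Union>B\<in>\<beta> ` T. k_sets B k) \<subseteq> (\<Union>S\<in>T. {A \<in> k_sets (\<beta> S) k. Inr S \<in> A}) \<union> k_sets (Inl ` {..<w}) k"
    proof
      fix A assume "A \<in> (\<Union>B\<in>\<beta> ` T. k_sets B k)"
      then obtain S where S: "S \<in> T" "A \<in> k_sets (\<beta> S) k" by blast
      show "A \<in> (\<Union>S\<in>T. {A \<in> k_sets (\<beta> S) k. Inr S \<in> A}) \<union> k_sets (Inl ` {..<w}) k"
      proof (cases "Inr S \<in> A")
        case True
        then show ?thesis using S by blast
      next
        case False
        then have "A \<subseteq> Inl ` S" using S(2) unfolding k_sets_def \<beta>_def by blast
        also have "\<dots> \<subseteq> Inl ` {..<w}" by (rule image_mono[OF Tm(3)[OF S(1)]])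
        finally have "A \<subseteq> Inl ` {..<w}" .
        then show ?thesis using S(2) by (simp add: k_sets_def)
      qed
    qed
    then have "card (\<Union>B\<in>\<beta> ` T. k_sets B k) \<le> card ((\<Union>S\<in>T. {A \<in> k_sets (\<beta> S) k. Inr S \<in> A}) \<union> k_sets (Inl ` {..<w}) k)"
      by (rule card_mono[rotated]) (simp add: finT c\<beta> k_sets_finite)
    also have "\<dots> \<le> card (\<Union>S\<in>T. {A \<in> k_sets (\<beta> S) k. Inr S \<in> A}) + card (k_sets (Inl ` {..<w} :: (nat + nat set) set) k)"
      by (rule card_Un_le)
    also have "\<dots> \<le> card T * ((t * k - 1) choose (k - 1)) + w ^ k"
    proof (rule add_mono)
      have "card (\<Union>S\<in>T. {A \<in> k_sets (\<beta> S) k. Inr S \<in> A}) \<le> (\<Sum>S\<in>T. card {A \<in> k_sets (\<beta> S) k. Inr S \<in> A})"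
        by (rule card_UN_le[OF finT])
      also have "\<dots> \<le> (\<Sum>S\<in>T. (t * k - 1) choose (k - 1))"
      proof (rule sum_mono)
        fix S assume S: "S \<in> T"
        have "card {A \<in> k_sets (insert (Inr S) (Inl ` S)) k. Inr S \<in> A} \<le> card (Inl ` S :: (nat + nat set) set) choose (k - 1)"
          by (rule card_k_sets_containing) (use k Tm[OF S] in auto)
        then show "card {A \<in> k_sets (\<beta> S) k. Inr S \<in> A} \<le> (t * k - 1) choose (k - 1)"
          using Tm[OF S] by (simp add: \<beta>_def card_image r_def)
      qed
      finally show "card (\<Union>S\<in>T. {A \<in> k_sets (\<beta> S) k. Inr S \<in> A}) \<le> card T * ((t * k - 1) choose (k - 1))" by simp
      have "card (k_sets (Inl ` {..<w} :: (nat + nat set) set) k) = w choose k"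
        by (simp add: card_k_sets card_image)
      also have "\<dots> \<le> w ^ k"
        by (cases "k \<le> w") (simp_all add: binomial_le_pow binomial_eq_0)
      finally show "card (k_sets (Inl ` {..<w} :: (nat + nat set) set) k) \<le> w ^ k" .
    qed
    finally have "real (card (\<Union>B\<in>\<beta> ` T. k_sets B k)) \<le> real (card T * ((t * k - 1) choose (k - 1)) + w ^ k)"
      by (rule of_nat_mono)
    also have "\<dots> \<le> card T * ((t * k - 1) choose (k - 1)) + card T * e"
      using cT e by (simp add: field_simps)
    also have "\<dots> = card (\<beta> ` T) * (((t * k - 1) choose (k - 1)) + e)"
      by (simp add: card_image[OF inj] distrib_left)
    finally show "card (\<Union>B\<in>\<beta> ` T. k_sets B k) \<le> card (\<beta> ` T) * (((t * k - 1) choose (k - 1)) + e)" .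
  qed
qed

section \<open>Copies of a pattern\<close>

definition injections :: "'g set \<Rightarrow> nat \<Rightarrow> ('g \<Rightarrow> nat) set" where
  "injections Y n = {\<phi> \<in> Y \<rightarrow>\<^sub>E {..<n}. inj_on \<phi> Y}"

definition copies :: "'g set set \<Rightarrow> ('g \<Rightarrow> nat) \<Rightarrow> nat set set" where
  "copies P \<phi> = (\<lambda>S. \<phi> ` S) ` P"

lemma finite_injections: "finite Y \<Longrightarrow> finite (injections Y n)"
  by (simp add: injections_def finite_PiE)

lemma injections_image:
  assumes "\<phi> \<in> injections Y n"
  shows "\<phi> ` Y \<subseteq> {..<n}" "inj_on \<phi> Y" "card (\<phi> ` Y) = card Y"
  using assms by (auto simp: injections_def card_image)

lemma inj_on_image_sets: "inj_on \<phi> Y \<Longrightarrow> \<forall>S\<in>P. S \<subseteq> Y \<Longrightarrow> inj_on (\<lambda>S. \<phi> ` S) P"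
  by (rule inj_onI) (metis inj_on_image_eq_iff)

lemma copies_k_sets:
  assumes "\<phi> \<in> injections Y n" "P \<subseteq> k_sets Y k"
  shows "copies P \<phi> \<subseteq> k_sets {..<n} k" "copies P \<phi> \<subseteq> k_sets (\<phi> ` Y) k" "card (copies P \<phi>) = card P"
proof -
  note \<phi> = injections_image[OF assms(1)]
  show *: "copies P \<phi> \<subseteq> k_sets (\<phi> ` Y) k"
  proof
    fix U assume "U \<in> copies P \<phi>"
    then obtain S where S: "U = \<phi> ` S" "S \<in> P" by (auto simp: copies_def)
    then have "S \<subseteq> Y" "card S = k" using assms(2) by (auto simp: k_sets_def)
    moreover from this have "card U = k" using S \<phi>(2) by (simp add: card_image inj_on_subset)
    ultimately show "U \<in> k_sets (\<phi> ` Y) k" using S by (auto simp: k_sets_def)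
  qed
  also have "k_sets (\<phi> ` Y) k \<subseteq> k_sets {..<n} k" by (rule k_sets_mono[OF \<phi>(1)])
  finally show "copies P \<phi> \<subseteq> k_sets {..<n} k" .
  have "inj_on (\<lambda>S. \<phi> ` S) P" by (rule inj_on_image_sets[OF \<phi>(2)]) (use assms(2) in \<open>auto simp: k_sets_def\<close>)
  then show "card (copies P \<phi>) = card P" by (simp add: copies_def card_image)
qed

lemma card_injections_lower:
  assumes "finite Y" "2 * card Y \<le> n"
  shows "(real n / 2) ^ card Y \<le> card (injections Y n)"
proof -
  have "card (injections Y n) = (\<Prod>i\<in>{0..<card Y}. n - i)"
    unfolding injections_def using card_inj_on_subset_funcset[OF assms(1), of "{..<n}" Y] by simp
  then have "real (card (injections Y n)) = (\<Prod>i\<in>{0..<card Y}. real (n - i))" by simp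
  moreover have "(\<Prod>i\<in>{0..<card Y}. real n / 2) \<le> (\<Prod>i\<in>{0..<card Y}. real (n - i))"
    by (rule prod_mono) (use assms(2) in auto)
  ultimately show ?thesis by simp
qed

lemma exists_permutation_image:
  fixes X :: "'a set"
  assumes "finite X" "S \<in> k_sets X k" "S' \<in> k_sets X k"
  obtains \<sigma> where "bij_betw \<sigma> X X" "\<sigma> ` S = S'"
proof -
  have fin: "finite S" "finite S'" using assms finite_subset unfolding k_sets_def by auto
  have S: "S \<subseteq> X" "S' \<subseteq> X" "card S = card S'" using assms by (auto simp: k_sets_def)
  obtain f where f: "bij_betw f S S'" using finite_same_card_bij[OF fin S(3)] by blast
  have "card (X - S) = card (X - S')" using S fin by (simp add: card_Diff_subset)
  then obtain g where g: "bij_betw g (X - S) (X - S')"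
    using finite_same_card_bij[of "X - S" "X - S'"] assms(1) by auto
  let ?\<sigma> = "\<lambda>x. if x \<in> S then f x else g x"
  have "bij_betw ?\<sigma> (S \<union> (X - S)) (S' \<union> (X - S'))"
  proof (rule bij_betw_combine)
    show "bij_betw ?\<sigma> S S'" using f by (simp cong: bij_betw_cong)
    show "bij_betw ?\<sigma> (X - S) (X - S')" using g by (rule bij_betw_cong[THEN iffD1, rotated]) auto
  qed auto
  moreover have "S \<union> (X - S) = X" "S' \<union> (X - S') = X" using S by auto
  ultimately have "bij_betw ?\<sigma> X X" by simp
  moreover have "?\<sigma> ` S = S'" using f by (auto simp: bij_betw_def)
  ultimately show ?thesis by (rule that)
qed

text \<open>Composing with a permutation of the points that takes \<open>S\<close> to
  \<open>S'\<close> maps the copies through \<open>S\<close> injectively to copies through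
  \<open>S'\<close>. By symmetry all degrees are equal.\<close>

lemma copies_degree_le:
  assumes Y: "finite Y" "P \<subseteq> k_sets Y k" and S: "S \<in> k_sets {..<n} k" "S' \<in> k_sets {..<n} k"
  shows "card {\<phi> \<in> injections Y n. S \<in> copies P \<phi>} \<le> card {\<phi> \<in> injections Y n. S' \<in> copies P \<phi>}"
proof -
  obtain \<sigma> where \<sigma>: "bij_betw \<sigma> {..<n} {..<n}" "\<sigma> ` S = S'"
    using exists_permutation_image[OF _ S] by auto
  let ?f = "\<lambda>\<phi>. restrict (\<lambda>x. \<sigma> (\<phi> x)) Y"
  have inj\<sigma>: "inj_on \<sigma> {..<n}" and im\<sigma>: "\<sigma> ` {..<n} = {..<n}" using \<sigma>(1) by (auto simp: bij_betw_def)
  show ?thesis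
  proof (rule card_inj_on_le[of ?f])
    show "finite {\<phi> \<in> injections Y n. S' \<in> copies P \<phi>}" using finite_injections[OF Y(1)] by simp
    show "inj_on ?f {\<phi> \<in> injections Y n. S \<in> copies P \<phi>}"
    proof (rule inj_onI)
      fix \<phi> \<psi> assume a: "\<phi> \<in> {\<phi> \<in> injections Y n. S \<in> copies P \<phi>}" "\<psi> \<in> {\<phi> \<in> injections Y n. S \<in> copies P \<phi>}"
        and eq: "?f \<phi> = ?f \<psi>"
      then have PiE: "\<phi> \<in> Y \<rightarrow>\<^sub>E {..<n}" "\<psi> \<in> Y \<rightarrow>\<^sub>E {..<n}" by (auto simp: injections_def)
      show "\<phi> = \<psi>"
      proof (rule PiE_ext[OF PiE])
        fix x assume x: "x \<in> Y"
        have "\<sigma> (\<phi> x) = \<sigma> (\<psi> x)" using fun_cong[OF eq, of x] x by simp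
        then show "\<phi> x = \<psi> x" using inj\<sigma> PiE x by (meson PiE_mem inj_onD)
      qed
    qed
    show "?f ` {\<phi> \<in> injections Y n. S \<in> copies P \<phi>} \<subseteq> {\<phi> \<in> injections Y n. S' \<in> copies P \<phi>}"
    proof
      fix \<psi> assume "\<psi> \<in> ?f ` {\<phi> \<in> injections Y n. S \<in> copies P \<phi>}"
      then obtain \<phi> where \<phi>: "\<phi> \<in> injections Y n" "S \<in> copies P \<phi>" and \<psi>: "\<psi> = ?f \<phi>" by blast
      note im = injections_image[OF \<phi>(1)]
      have "inj_on (\<lambda>x. \<sigma> (\<phi> x)) Y"
        using comp_inj_on[OF im(2) inj_on_subset[OF inj\<sigma> im(1)]] by (simp add: comp_def)
      then have "inj_on \<psi> Y" unfolding \<psi> by (simp add: inj_on_restrict_eq)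
      moreover have "\<sigma> (\<phi> x) < n" if "x \<in> Y" for x using im\<sigma> im(1) that by blast
      then have "\<psi> \<in> Y \<rightarrow>\<^sub>E {..<n}" unfolding \<psi> by auto
      ultimately have "\<psi> \<in> injections Y n" by (simp add: injections_def)
      moreover have "S' \<in> copies P \<psi>"
      proof -
        obtain T where T: "T \<in> P" "S = \<phi> ` T" using \<phi>(2) by (auto simp: copies_def)
        then have "T \<subseteq> Y" using Y(2) by (auto simp: k_sets_def)
        then have "\<psi> ` T = \<sigma> ` \<phi> ` T" unfolding \<psi> image_image by (intro image_cong) auto
        then have "S' = \<psi> ` T" using \<sigma>(2) T(2) by simp
        then show ?thesis using T(1) by (auto simp: copies_def)
      qed
      ultimately show "\<psi> \<in> {\<phi> \<in> injections Y n. S' \<in> copies P \<phi>}" by simp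
    qed
  qed
qed

lemma copies_degree:
  assumes Y: "finite Y" "P \<subseteq> k_sets Y k" and S: "S \<in> k_sets {..<n} k"
  shows "(n choose k) * card {\<phi> \<in> injections Y n. S \<in> copies P \<phi>} = card P * card (injections Y n)"
proof -
  let ?d = "\<lambda>S. card {\<phi> \<in> injections Y n. S \<in> copies P \<phi>}"
  have "(n choose k) * ?d S = (\<Sum>S'\<in>k_sets {..<n} k. ?d S)" by (simp add: card_k_sets)
  also have "\<dots> = (\<Sum>S'\<in>k_sets {..<n} k. ?d S')"
    by (rule sum.cong[OF refl], rule antisym) (intro copies_degree_le[OF Y] S, assumption)+
  also have "\<dots> = (\<Sum>S'\<in>k_sets {..<n} k. \<Sum>\<phi> | \<phi> \<in> injections Y n \<and> S' \<in> copies P \<phi>. 1)" by simp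
  also have "\<dots> = (\<Sum>\<phi>\<in>injections Y n. \<Sum>S' | S' \<in> k_sets {..<n} k \<and> S' \<in> copies P \<phi>. 1)"
    by (rule sum.swap_restrict) (simp_all add: k_sets_finite finite_injections Y)
  also have "\<dots> = (\<Sum>\<phi>\<in>injections Y n. card P)"
  proof (rule sum.cong[OF refl])
    fix \<phi> assume \<phi>: "\<phi> \<in> injections Y n"
    have "{S'. S' \<in> k_sets {..<n} k \<and> S' \<in> copies P \<phi>} = copies P \<phi>"
      using copies_k_sets(1)[OF \<phi> Y(2)] by blast
    then show "(\<Sum>S' | S' \<in> k_sets {..<n} k \<and> S' \<in> copies P \<phi>. 1) = card P"
      using copies_k_sets(3)[OF \<phi> Y(2)] by simp
  qed
  finally show ?thesis by (simp add: mult.commute)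
qed

section \<open>Random reservation and selection of copies\<close>

text \<open>A point \<open>Inl S\<close> of the sample space reserves the \<open>k\<close>-set \<open>S\<close>, a point \<open>Inr \<phi>\<close> selects the copy \<open>\<phi>\<close>.
  A selected copy is active if its images of \<open>P\<close> are unreserved and all other \<open>k\<close>-sets in it are reserved;
  \<open>D\<close> is the expected number of active copies through an unreserved \<open>k\<close>-set.\<close>

locale random_copies =
  fixes Y :: "'g set" and P :: "'g set set" and k n m :: nat and p \<rho> D :: real
  assumes Y: "finite Y" and P: "P \<subseteq> k_sets Y k" "card P \<ge> 2" and k: "1 \<le> k" "k < card Y"
    and m: "m \<ge> 2" and p: "0 \<le> p" "p \<le> 1" and \<rho>: "0 < \<rho>" "\<rho> < 1" and D: "D > 0"
    and degree: "\<And>S. S \<in> k_sets {..<n} k \<Longrightarrow>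
      real (card {\<phi> \<in> injections Y n. S \<in> copies P \<phi>}) * (p * \<rho> ^ card (k_sets Y k - P) * (1 - \<rho>) ^ (card P - 1)) = D"
begin

abbreviation "K \<equiv> k_sets {..<n} k"
abbreviation "I \<equiv> injections Y n"
abbreviation "pos \<equiv> copies P"
abbreviation "neg \<equiv> copies (k_sets Y k - P)"
abbreviation "a \<equiv> card (k_sets Y k - P)"

definition \<Omega> :: "(nat set + ('g \<Rightarrow> nat)) set" where "\<Omega> = Inr ` I \<union> Inl ` K"

definition prb :: "nat set + ('g \<Rightarrow> nat) \<Rightarrow> real" where "prb = case_sum (\<lambda>_. \<rho>) (\<lambda>_. p)"

definition expect :: "((nat set + ('g \<Rightarrow> nat)) set \<Rightarrow> real) \<Rightarrow> real" where "expect = bern prb \<Omega>"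

text \<open>Stated as a box event, one set contained and another avoided, so that
  \<open>expect_box\<close> applies to it directly.\<close>

definition active :: "('g \<Rightarrow> nat) \<Rightarrow> (nat set + ('g \<Rightarrow> nat)) set \<Rightarrow> bool" where
  "active \<phi> X \<longleftrightarrow> Inr ` {\<phi>} \<union> Inl ` neg \<phi> \<subseteq> X \<and> X \<inter> Inl ` pos \<phi> = {}"

lemma finite_K: "finite K" and finite_I: "finite I" and finite_\<Omega>: "finite \<Omega>"
  by (simp_all add: \<Omega>_def k_sets_finite finite_injections Y)

lemma prb_bounds: "0 \<le> prb i \<and> prb i \<le> 1"
  using p \<rho> by (simp add: prb_def split: sum.split)

lemma pos: "\<phi> \<in> I \<Longrightarrow> pos \<phi> \<subseteq> K \<and> pos \<phi> \<subseteq> k_sets (\<phi> ` Y) k \<and> card (pos \<phi>) = card P \<and> finite (pos \<phi>)"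
  using copies_k_sets[OF _ P(1)] finite_subset[OF _ finite_K] by blast

lemma neg: "\<phi> \<in> I \<Longrightarrow> neg \<phi> \<subseteq> K \<and> neg \<phi> \<subseteq> k_sets (\<phi> ` Y) k \<and> card (neg \<phi>) = a \<and> finite (neg \<phi>)"
  using copies_k_sets[of _ Y n "k_sets Y k - P" k] finite_subset[OF _ finite_K] by blast

lemma pos_neg:
  assumes "\<phi> \<in> I"
  shows "pos \<phi> \<inter> neg \<phi> = {}"
proof (rule ccontr)
  assume "pos \<phi> \<inter> neg \<phi> \<noteq> {}"
  then obtain S T where ST: "S \<in> P" "T \<in> k_sets Y k - P" "\<phi> ` S = \<phi> ` T" by (auto simp: copies_def)
  moreover have "S \<subseteq> Y" "T \<subseteq> Y" using ST P(1) by (auto simp: k_sets_def)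
  ultimately show False using inj_on_image_eq_iff[OF injections_image(2)[OF assms]] by blast
qed

lemma expect_box:
  assumes "A \<subseteq> I" "B \<subseteq> K" "C \<subseteq> K" "B \<inter> C = {}"
  shows "expect (\<lambda>X. of_bool (Inr ` A \<union> Inl ` B \<subseteq> X \<and> X \<inter> Inl ` C = {})) = p ^ card A * \<rho> ^ card B * (1 - \<rho>) ^ card C"
proof -
  have fin: "finite A" "finite B" "finite C"
    using assms finite_I finite_K finite_subset by metis+
  have "expect (\<lambda>X. of_bool (Inr ` A \<union> Inl ` B \<subseteq> X \<and> X \<inter> Inl ` C = {}))
      = (\<Prod>i\<in>Inr ` A \<union> Inl ` B. prb i) * (\<Prod>i\<in>Inl ` C. 1 - prb i)"
    unfolding expect_def by (rule bern_avoid[OF finite_\<Omega>]) (use assms in \<open>auto simp: \<Omega>_def\<close>)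
  also have "(\<Prod>i\<in>Inr ` A \<union> Inl ` B. prb i) = (\<Prod>i\<in>Inr ` A. prb i) * (\<Prod>i\<in>Inl ` B. prb i)"
    by (rule prod.union_disjoint) (use fin in auto)
  finally show ?thesis by (simp add: prod.reindex prb_def)
qed

lemma expect_active:
  assumes "\<phi> \<in> I"
  shows "expect (\<lambda>X. of_bool (active \<phi> X)) = p * \<rho> ^ a * (1 - \<rho>) ^ card P"
proof -
  have "expect (\<lambda>X. of_bool (active \<phi> X)) = p ^ card {\<phi>} * \<rho> ^ card (neg \<phi>) * (1 - \<rho>) ^ card (pos \<phi>)"
    unfolding active_def by (rule expect_box) (use assms pos neg pos_neg in blast)+
  then show ?thesis using pos[OF assms] neg[OF assms] by simp
qed

lemma expect_active_pair_le:
  assumes "\<phi> \<in> I" "\<psi> \<in> I" "\<phi> \<noteq> \<psi>"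
  shows "expect (\<lambda>X. of_bool (active \<phi> X \<and> active \<psi> X)) \<le> p\<^sup>2"
proof -
  have "expect (\<lambda>X. of_bool (active \<phi> X \<and> active \<psi> X))
      \<le> expect (\<lambda>X. of_bool (Inr ` {\<phi>, \<psi>} \<union> Inl ` {} \<subseteq> X \<and> X \<inter> Inl ` {} = {}))"
    unfolding expect_def by (rule bern_mono) (auto simp: prb_bounds active_def)
  also have "\<dots> = p ^ card {\<phi>, \<psi>} * \<rho> ^ card ({} :: nat set set) * (1 - \<rho>) ^ card ({} :: nat set set)"
    by (rule expect_box) (use assms in auto)
  finally show ?thesis using assms(3) by (simp add: power2_eq_square)
qed

text \<open>The \<open>k\<close>-set \<open>S\<close> lies in both images, so these meet exactly in
  \<open>S\<close>, which is then their only common \<open>k\<close>-set. Hence the conditions on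
  the two copies are independent apart from \<open>S\<close> being unreserved, which is counted
  once: exponent \<open>2 * card P - 1\<close>.\<close>

lemma expect_active_pair:
  assumes \<phi>: "\<phi> \<in> I" and \<psi>: "\<psi> \<in> I" and ne: "\<phi> \<noteq> \<psi>" and S: "S \<in> pos \<phi>" "S \<in> pos \<psi>"
    and int: "card (\<phi> ` Y \<inter> \<psi> ` Y) \<le> k"
  shows "expect (\<lambda>X. of_bool (active \<phi> X \<and> active \<psi> X)) \<le> p\<^sup>2 * \<rho> ^ (2 * a) * (1 - \<rho>) ^ (2 * card P - 1)"
proof -
  have SS: "card S = k" "S \<subseteq> \<phi> ` Y \<inter> \<psi> ` Y" using S pos[OF \<phi>] pos[OF \<psi>] by (auto simp: k_sets_def)
  have fin: "finite (\<phi> ` Y \<inter> \<psi> ` Y)" using Y by simp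
  have only: "T = S" if "T \<in> k_sets (\<phi> ` Y) k" "T \<in> k_sets (\<psi> ` Y) k" for T
  proof -
    have "S = \<phi> ` Y \<inter> \<psi> ` Y" using SS int card_seteq[OF fin] by simp
    moreover have "T = \<phi> ` Y \<inter> \<psi> ` Y"
      by (rule card_seteq[OF fin]) (use that int in \<open>auto simp: k_sets_def\<close>)
    ultimately show ?thesis by simp
  qed
  have negs: "card (neg \<phi> \<union> neg \<psi>) = 2 * a"
  proof -
    have "neg \<phi> \<inter> neg \<psi> = {}"
      using only neg[OF \<phi>] neg[OF \<psi>] S pos_neg[OF \<phi>] by blast
    then show ?thesis using neg[OF \<phi>] neg[OF \<psi>] by (simp add: card_Un_disjoint)
  qed
  have poss: "card (pos \<phi> \<union> pos \<psi>) = 2 * card P - 1"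
  proof -
    have "pos \<phi> \<inter> pos \<psi> = {S}" using only pos[OF \<phi>] pos[OF \<psi>] S by blast
    then show ?thesis using card_Un_Int[of "pos \<phi>" "pos \<psi>"] pos[OF \<phi>] pos[OF \<psi>] by simp
  qed
  have eq: "(active \<phi> X \<and> active \<psi> X) \<longleftrightarrow>
     (Inr ` {\<phi>, \<psi>} \<union> Inl ` (neg \<phi> \<union> neg \<psi>) \<subseteq> X \<and> X \<inter> Inl ` (pos \<phi> \<union> pos \<psi>) = {})" for X
  proof -
    have *: "Inr ` A \<union> Inl ` B \<subseteq> X \<and> X \<inter> Inl ` C = {} \<longleftrightarrow>
        (\<forall>\<theta>\<in>A. Inr \<theta> \<in> X) \<and> (\<forall>T\<in>B. Inl T \<in> X) \<and> (\<forall>T\<in>C. Inl T \<notin> X)" for A B C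
      by blast
    show ?thesis unfolding active_def * ball_Un by (simp only: ball_simps conj_ac simp_thms)
  qed
  show ?thesis
  proof (cases "(neg \<phi> \<union> neg \<psi>) \<inter> (pos \<phi> \<union> pos \<psi>) = {}")
    case True
    have "expect (\<lambda>X. of_bool (active \<phi> X \<and> active \<psi> X)) = p ^ card {\<phi>, \<psi>} * \<rho> ^ card (neg \<phi> \<union> neg \<psi>) * (1 - \<rho>) ^ card (pos \<phi> \<union> pos \<psi>)"
      unfolding eq by (rule expect_box) (use \<phi> \<psi> pos[OF \<phi>] pos[OF \<psi>] neg[OF \<phi>] neg[OF \<psi>] True in simp_all)
    then show ?thesis using ne negs poss by (simp add: power2_eq_square)
  next
    case False
    then have *: "\<not> (active \<phi> X \<and> active \<psi> X)" for X unfolding eq by blast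
    then have "expect (\<lambda>X. of_bool (active \<phi> X \<and> active \<psi> X)) = 0"
      unfolding expect_def by (simp only: of_bool_eq * bern_const[OF finite_\<Omega>])
    then show ?thesis using p \<rho> by simp
  qed
qed

definition deg :: "nat set \<Rightarrow> (nat set + ('g \<Rightarrow> nat)) set \<Rightarrow> real" where
  "deg S X = (\<Sum>\<phi> | \<phi> \<in> I \<and> S \<in> pos \<phi>. of_bool (active \<phi> X))"

definition overlaps :: "(('g \<Rightarrow> nat) \<times> ('g \<Rightarrow> nat)) set" where
  "overlaps = {(\<phi>, \<psi>) \<in> I \<times> I. \<phi> \<noteq> \<psi> \<and> k < card (\<phi> ` Y \<inter> \<psi> ` Y)}"

lemma finite_overlaps: "finite overlaps"
  by (rule finite_subset[of _ "I \<times> I"]) (use finite_I in \<open>auto simp: overlaps_def\<close>)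

text \<open>\<open>v\<close> is the probability that a copy through \<open>S\<close> is active given
  that \<open>S\<close> is unreserved, whence the exponent \<open>card P - 1\<close> and
  \<open>D = card J * v\<close>. For well-separated copies the main terms cancel and only the
  diagonal, of order \<open>1 / D\<close>, survives; pairs sharing more than \<open>k\<close> points
  are bounded by \<open>p^2\<close> each.\<close>

lemma expect_deviation:
  assumes S: "S \<in> K"
  shows "expect (\<lambda>X. of_bool (Inl S \<notin> X) * (deg S X / D - 1)\<^sup>2)
    \<le> 1 / D + p\<^sup>2 / D\<^sup>2 * card {x \<in> overlaps. S \<in> pos (fst x) \<and> S \<in> pos (snd x)}"
proof -
  define J where "J = {\<phi> \<in> I. S \<in> pos \<phi>}"
  define W where "W = {x \<in> overlaps. S \<in> pos (fst x) \<and> S \<in> pos (snd x)}"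
  define v where "v = p * \<rho> ^ a * (1 - \<rho>) ^ (card P - 1)"
  let ?A = "\<lambda>\<phi> X. of_bool (active \<phi> X) :: real"
  let ?B = "\<lambda>\<phi> \<psi> X. of_bool (active \<phi> X \<and> active \<psi> X) :: real"
  let ?u = "\<lambda>X. of_bool (Inl S \<notin> X) :: real"
  have finJ: "finite J" using finite_I by (simp add: J_def)
  have J: "\<phi> \<in> I" "S \<in> pos \<phi>" if "\<phi> \<in> J" for \<phi> using that by (auto simp: J_def)
  have Dv: "card J * v = D" using degree[OF S] by (simp add: J_def v_def)
  have v0: "v \<ge> 0" using p \<rho> by (simp add: v_def)
  have single: "expect (?A \<phi>) = v * (1 - \<rho>)" if "\<phi> \<in> J" for \<phi>
    using expect_active[OF J(1)[OF that]] P(2)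
    by (simp add: v_def flip: power_Suc2)
  have pair: "expect (?B \<phi> \<psi>) \<le> of_bool (\<phi> = \<psi>) * (v * (1 - \<rho>)) + v\<^sup>2 * (1 - \<rho>) + p\<^sup>2 * of_bool ((\<phi>, \<psi>) \<in> W)"
    if \<phi>: "\<phi> \<in> J" and \<psi>: "\<psi> \<in> J" for \<phi> \<psi>
  proof (cases "\<phi> = \<psi>")
    case True
    then show ?thesis using single[OF \<phi>] \<rho> p v0 by simp
  next
    case ne: False
    show ?thesis
    proof (cases "card (\<phi> ` Y \<inter> \<psi> ` Y) \<le> k")
      case True
      have "2 * card P - 1 = 2 * (card P - 1) + 1" using P(2) by simp
      then have "p\<^sup>2 * \<rho> ^ (2 * a) * (1 - \<rho>) ^ (2 * card P - 1) = v\<^sup>2 * (1 - \<rho>)"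
        by (simp add: v_def power_mult_distrib power_add power_mult mult.commute[of 2])
      then have "expect (?B \<phi> \<psi>) \<le> v\<^sup>2 * (1 - \<rho>)"
        using expect_active_pair[OF J(1)[OF \<phi>] J(1)[OF \<psi>] ne J(2)[OF \<phi>] J(2)[OF \<psi>] True] by simp
      then show ?thesis using ne by (simp add: add_increasing2)
    next
      case False
      then have "(\<phi>, \<psi>) \<in> W" using \<phi> \<psi> ne by (auto simp: W_def overlaps_def J_def)
      moreover have "0 \<le> v\<^sup>2 * (1 - \<rho>)" using \<rho> by simp
      ultimately show ?thesis
        using expect_active_pair_le[OF J(1)[OF \<phi>] J(1)[OF \<psi>] ne] ne by simp
    qed
  qed
  have sumW: "(\<Sum>\<phi>\<in>J. \<Sum>\<psi>\<in>J. of_bool ((\<phi>, \<psi>) \<in> W) :: real) = card W"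
  proof -
    have "(\<Sum>\<phi>\<in>J. \<Sum>\<psi>\<in>J. of_bool ((\<phi>, \<psi>) \<in> W) :: real) = (\<Sum>x\<in>J \<times> J. of_bool (x \<in> W))"
      by (simp add: sum.cartesian_product case_prod_unfold)
    also have "\<dots> = card ((J \<times> J) \<inter> W)"
      using finJ by (simp add: of_bool_def sum.If_cases)
    also have "(J \<times> J) \<inter> W = W" by (auto simp: W_def overlaps_def J_def)
    finally show ?thesis .
  qed
  have pairs: "(\<Sum>\<phi>\<in>J. \<Sum>\<psi>\<in>J. expect (?B \<phi> \<psi>)) \<le> (1 - \<rho>) * D + (1 - \<rho>) * D\<^sup>2 + p\<^sup>2 * card W"
  proof -
    have "(\<Sum>\<phi>\<in>J. \<Sum>\<psi>\<in>J. expect (?B \<phi> \<psi>))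
      \<le> (\<Sum>\<phi>\<in>J. \<Sum>\<psi>\<in>J. of_bool (\<phi> = \<psi>) * (v * (1 - \<rho>)) + v\<^sup>2 * (1 - \<rho>) + p\<^sup>2 * of_bool ((\<phi>, \<psi>) \<in> W))"
      by (intro sum_mono pair)
    also have "\<dots> = (\<Sum>\<phi>\<in>J. \<Sum>\<psi>\<in>J. of_bool (\<phi> = \<psi>) * (v * (1 - \<rho>))) + card J * (card J * (v\<^sup>2 * (1 - \<rho>))) + p\<^sup>2 * card W"
      by (simp add: sum.distrib sumW flip: sum_distrib_left)
    also have "(\<Sum>\<phi>\<in>J. \<Sum>\<psi>\<in>J. of_bool (\<phi> = \<psi>) * (v * (1 - \<rho>))) = (\<Sum>\<phi>\<in>J. v * (1 - \<rho>))"
    proof (rule sum.cong[OF refl])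
      fix \<phi> assume "\<phi> \<in> J"
      then have "(\<Sum>\<psi>\<in>J. (if \<phi> = \<psi> then v * (1 - \<rho>) else 0)) = v * (1 - \<rho>)" using finJ by simp
      moreover have "(\<Sum>\<psi>\<in>J. of_bool (\<phi> = \<psi>) * (v * (1 - \<rho>))) = (\<Sum>\<psi>\<in>J. (if \<phi> = \<psi> then v * (1 - \<rho>) else 0))"
        by (rule sum.cong) auto
      ultimately show "(\<Sum>\<psi>\<in>J. of_bool (\<phi> = \<psi>) * (v * (1 - \<rho>))) = v * (1 - \<rho>)" by simp
    qed
    also have "(\<Sum>\<phi>\<in>J. v * (1 - \<rho>)) = (card J * v) * (1 - \<rho>)" by simp
    also have "card J * (card J * (v\<^sup>2 * (1 - \<rho>))) = (card J * v)\<^sup>2 * (1 - \<rho>)"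
      by (simp add: power2_eq_square)
    finally show ?thesis unfolding Dv by (simp only: mult.commute)
  qed
  have singles: "(\<Sum>\<phi>\<in>J. expect (?A \<phi>)) = (1 - \<rho>) * D"
  proof -
    have "(\<Sum>\<phi>\<in>J. expect (?A \<phi>)) = (card J * v) * (1 - \<rho>)" using single by simp
    then show ?thesis unfolding Dv by (simp only: mult.commute)
  qed
  have one: "expect ?u = 1 - \<rho>"
  proof -
    have "expect (\<lambda>X. of_bool (Inr ` {} \<union> Inl ` {} \<subseteq> X \<and> X \<inter> Inl ` {S} = {}))
        = p ^ card ({} :: ('g \<Rightarrow> nat) set) * \<rho> ^ card ({} :: nat set set) * (1 - \<rho>) ^ card {S}"
      by (rule expect_box) (use S in auto)
    then show ?thesis by simp
  qed
  have expand: "?u X * (deg S X / D - 1)\<^sup>2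
      = 1 / D\<^sup>2 * (\<Sum>\<phi>\<in>J. \<Sum>\<psi>\<in>J. ?B \<phi> \<psi> X) - 2 / D * (\<Sum>\<phi>\<in>J. ?A \<phi> X) + ?u X" for X
  proof -
    have d: "deg S X = (\<Sum>\<phi>\<in>J. ?A \<phi> X)" by (simp add: deg_def J_def)
    have sq: "(\<Sum>\<phi>\<in>J. \<Sum>\<psi>\<in>J. ?B \<phi> \<psi> X) = deg S X * deg S X"
      unfolding d sum_product by (simp only: of_bool_conj)
    \<comment> \<open>A reserved \<open>S\<close> deactivates every copy through it.\<close>
    have ud: "?u X * deg S X = deg S X"
    proof (cases "Inl S \<in> X")
      case True
      then have "\<not> active \<phi> X" if "\<phi> \<in> J" for \<phi> using J(2)[OF that] by (auto simp: active_def)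
      then have "deg S X = 0" unfolding d by (intro sum.neutral) auto
      then show ?thesis by simp
    qed simp
    have "?u X * (deg S X / D - 1)\<^sup>2 = (?u X * deg S X) * deg S X / D\<^sup>2 - 2 * (?u X * deg S X) / D + ?u X"
      using D by (simp add: power2_eq_square field_simps)
    also have "\<dots> = 1 / D\<^sup>2 * (\<Sum>\<phi>\<in>J. \<Sum>\<psi>\<in>J. ?B \<phi> \<psi> X) - 2 / D * (\<Sum>\<phi>\<in>J. ?A \<phi> X) + ?u X"
      unfolding ud sq by (simp add: d)
    finally show ?thesis .
  qed
  have "expect (\<lambda>X. ?u X * (deg S X / D - 1)\<^sup>2)
     = 1 / D\<^sup>2 * (\<Sum>\<phi>\<in>J. \<Sum>\<psi>\<in>J. expect (?B \<phi> \<psi>)) - 2 / D * (\<Sum>\<phi>\<in>J. expect (?A \<phi>)) + expect ?u"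
    unfolding expand expect_def by (simp only: bern_add bern_diff bern_cmult bern_sum)
  also have "\<dots> \<le> 1 / D\<^sup>2 * ((1 - \<rho>) * D + (1 - \<rho>) * D\<^sup>2 + p\<^sup>2 * card W) - 2 / D * ((1 - \<rho>) * D) + (1 - \<rho>)"
    unfolding singles one by (intro add_right_mono diff_right_mono mult_left_mono pairs) simp
  also have "\<dots> = (1 - \<rho>) / D + p\<^sup>2 / D\<^sup>2 * card W"
    using D by (simp add: field_simps power2_eq_square)
  also have "\<dots> \<le> 1 / D + p\<^sup>2 / D\<^sup>2 * card W"
    using D \<rho> by (simp add: divide_right_mono)
  finally show ?thesis by (simp only: W_def)
qed

section \<open>Dense configurations and the total loss\<close>

definition dense :: "('g \<Rightarrow> nat) set set" where
  "dense = dense_configs (card Y) k m (\<lambda>\<phi>. \<phi> ` Y) I"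

lemma finite_dense: "finite dense"
  unfolding dense_def by (rule finite_dense_configs[OF finite_I])

lemma overlap_dense:
  assumes "\<phi> \<in> I" "\<psi> \<in> I" "\<phi> \<noteq> \<psi>" "k < card (\<phi> ` Y \<inter> \<psi> ` Y)"
  shows "{\<phi>, \<psi>} \<in> dense"
proof -
  have "card (\<phi> ` Y) + card (\<psi> ` Y) = card (\<phi> ` Y \<union> \<psi> ` Y) + card (\<phi> ` Y \<inter> \<psi> ` Y)"
    by (rule card_Un_Int) (use Y in auto)
  then have "card (\<phi> ` Y \<union> \<psi> ` Y) + k < 2 * card Y"
    using injections_image(3)[OF assms(1)] injections_image(3)[OF assms(2)] assms(4) by simp
  then show ?thesis using assms m by (simp add: dense_def dense_configs_def)
qed

text \<open>Two copies sharing more than \<open>k\<close> points are a dense configuration of size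
  2, so the weight bound for dense configurations serves here too. The factor 4 is the size of
  \<open>J \<times> J\<close>.\<close>

lemma overlaps_weight: "p\<^sup>2 * card overlaps \<le> 4 * (\<Sum>J\<in>dense. p ^ card J)"
proof -
  define D2 where "D2 = {J \<in> dense. card J = 2}"
  have fin: "finite D2" using finite_dense by (simp add: D2_def)
  have D2: "finite J" "card J = 2" if "J \<in> D2" for J
    using that by (auto simp: D2_def dense_def dense_configs_def)
  have "overlaps \<subseteq> (\<Union>J\<in>D2. J \<times> J)"
  proof
    fix x assume "x \<in> overlaps"
    then obtain \<phi> \<psi> where x: "x = (\<phi>, \<psi>)" "\<phi> \<in> I" "\<psi> \<in> I" "\<phi> \<noteq> \<psi>" "k < card (\<phi> ` Y \<inter> \<psi> ` Y)"
      by (auto simp: overlaps_def)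
    then have "{\<phi>, \<psi>} \<in> D2" using overlap_dense by (simp add: D2_def)
    then show "x \<in> (\<Union>J\<in>D2. J \<times> J)" using x(1) by blast
  qed
  then have "card overlaps \<le> card (\<Union>J\<in>D2. J \<times> J)"
    by (rule card_mono[rotated]) (use fin D2 in auto)
  also have "\<dots> \<le> (\<Sum>J\<in>D2. card (J \<times> J))" by (rule card_UN_le[OF fin])
  also have "\<dots> = (\<Sum>J\<in>D2. 4)" by (rule sum.cong) (use D2 in \<open>simp_all add: card_cartesian_product\<close>)
  also have "\<dots> = card D2 * 4" by simp
  finally have "real (card overlaps) \<le> real (card D2 * 4)" by (rule of_nat_mono)
  then have "p\<^sup>2 * card overlaps \<le> p\<^sup>2 * real (card D2 * 4)" by (rule mult_left_mono) simp
  also have "\<dots> = 4 * (\<Sum>J\<in>D2. p ^ card J)" using D2 by simp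
  also have "\<dots> \<le> 4 * (\<Sum>J\<in>dense. p ^ card J)"
    using p finite_dense by (intro mult_left_mono sum_mono2) (auto simp: D2_def)
  finally show ?thesis .
qed

lemma sum_overlaps:
  "(\<Sum>S\<in>K. real (card {x \<in> overlaps. S \<in> pos (fst x) \<and> S \<in> pos (snd x)})) \<le> card P * card overlaps"
proof -
  have "(\<Sum>S\<in>K. card {x \<in> overlaps. S \<in> pos (fst x) \<and> S \<in> pos (snd x)})
      = (\<Sum>S\<in>K. \<Sum>x | x \<in> overlaps \<and> S \<in> pos (fst x) \<and> S \<in> pos (snd x). 1)" by simp
  also have "\<dots> = (\<Sum>x\<in>overlaps. \<Sum>S | S \<in> K \<and> S \<in> pos (fst x) \<and> S \<in> pos (snd x). 1)"
    by (rule sum.swap_restrict[OF finite_K finite_overlaps])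
  also have "\<dots> \<le> (\<Sum>x\<in>overlaps. card P)"
  proof (rule sum_mono)
    fix x assume "x \<in> overlaps"
    then have x: "fst x \<in> I" by (auto simp: overlaps_def)
    have "card {S. S \<in> K \<and> S \<in> pos (fst x) \<and> S \<in> pos (snd x)} \<le> card (pos (fst x))"
      by (rule card_mono) (use pos[OF x] in auto)
    then show "(\<Sum>S | S \<in> K \<and> S \<in> pos (fst x) \<and> S \<in> pos (snd x). 1) \<le> card P" using pos[OF x] by simp
  qed
  finally have "(\<Sum>S\<in>K. card {x \<in> overlaps. S \<in> pos (fst x) \<and> S \<in> pos (snd x)}) \<le> card P * card overlaps"
    by (simp add: mult.commute)
  then show ?thesis by (simp only: of_nat_sum[symmetric] of_nat_mult[symmetric] of_nat_le_iff)
qed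

text \<open>Everything the packing can waste: reserved \<open>k\<close>-sets, and \<open>b\<close>
  times the error of the matching bound, where bad copies are overestimated by \<open>m\<close> per
  selected dense configuration.\<close>

definition loss :: "real \<Rightarrow> (nat set + ('g \<Rightarrow> nat)) set \<Rightarrow> real" where
  "loss b X = (\<Sum>S\<in>K. of_bool (Inl S \<in> X)) + b * ((\<Sum>S\<in>K. of_bool (Inl S \<notin> X) * (deg S X / D - 1)\<^sup>2)
     + m / D * (\<Sum>J\<in>dense. of_bool (Inr ` J \<subseteq> X)))"

lemma expect_loss:
  fixes c :: real
  assumes b: "b \<ge> 0" and c: "(\<Sum>J\<in>dense. p ^ card J) \<le> c"
  shows "expect (loss b) \<le> \<rho> * (n choose k) + b * ((n choose k) / D + 4 * card P / D\<^sup>2 * c + m / D * c)"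
proof -
  let ?W = "\<lambda>S. real (card {x \<in> overlaps. S \<in> pos (fst x) \<and> S \<in> pos (snd x)})"
  have K: "card K = n choose k" by (simp add: card_k_sets)
  have 1: "expect (\<lambda>X. of_bool (Inl S \<in> X)) = \<rho>" if "S \<in> K" for S
  proof -
    have "expect (\<lambda>X. of_bool (Inr ` {} \<union> Inl ` {S} \<subseteq> X \<and> X \<inter> Inl ` {} = {}))
        = p ^ card ({} :: ('g \<Rightarrow> nat) set) * \<rho> ^ card {S} * (1 - \<rho>) ^ card ({} :: nat set set)"
      by (rule expect_box) (use that in auto)
    then show ?thesis by simp
  qed
  have 2: "expect (\<lambda>X. of_bool (Inr ` J \<subseteq> X)) = p ^ card J" if "J \<in> dense" for J
  proof -
    have "expect (\<lambda>X. of_bool (Inr ` J \<union> Inl ` {} \<subseteq> X \<and> X \<inter> Inl ` {} = {}))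
        = p ^ card J * \<rho> ^ card ({} :: nat set set) * (1 - \<rho>) ^ card ({} :: nat set set)"
      by (rule expect_box) (use that in \<open>auto simp: dense_def dense_configs_def\<close>)
    then show ?thesis by simp
  qed
  have 3: "(\<Sum>S\<in>K. expect (\<lambda>X. of_bool (Inl S \<notin> X) * (deg S X / D - 1)\<^sup>2)) \<le> (n choose k) / D + 4 * card P / D\<^sup>2 * c"
  proof -
    have "(\<Sum>S\<in>K. expect (\<lambda>X. of_bool (Inl S \<notin> X) * (deg S X / D - 1)\<^sup>2)) \<le> (\<Sum>S\<in>K. 1 / D + p\<^sup>2 / D\<^sup>2 * ?W S)"
      by (rule sum_mono) (rule expect_deviation)
    also have "\<dots> = (n choose k) / D + p\<^sup>2 / D\<^sup>2 * (\<Sum>S\<in>K. ?W S)"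
      by (simp add: sum.distrib K sum_distrib_left)
    also have "\<dots> \<le> (n choose k) / D + p\<^sup>2 / D\<^sup>2 * (card P * card overlaps)"
      using sum_overlaps by (intro add_left_mono mult_left_mono) auto
    also have "\<dots> = (n choose k) / D + card P / D\<^sup>2 * (p\<^sup>2 * card overlaps)" by simp
    also have "\<dots> \<le> (n choose k) / D + card P / D\<^sup>2 * (4 * c)"
      using overlaps_weight c by (intro add_left_mono mult_left_mono) auto
    finally show ?thesis by (simp add: mult.assoc mult.left_commute)
  qed
  have "expect (loss b) = (\<Sum>S\<in>K. expect (\<lambda>X. of_bool (Inl S \<in> X)))
      + b * ((\<Sum>S\<in>K. expect (\<lambda>X. of_bool (Inl S \<notin> X) * (deg S X / D - 1)\<^sup>2))
      + m / D * (\<Sum>J\<in>dense. expect (\<lambda>X. of_bool (Inr ` J \<subseteq> X))))"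
    unfolding loss_def expect_def by (simp only: bern_add bern_cmult bern_sum)
  also have "(\<Sum>S\<in>K. expect (\<lambda>X. of_bool (Inl S \<in> X))) = \<rho> * (n choose k)" using 1 by (simp add: K)
  also have "(\<Sum>J\<in>dense. expect (\<lambda>X. of_bool (Inr ` J \<subseteq> X))) = (\<Sum>J\<in>dense. p ^ card J)"
    by (rule sum.cong[OF refl]) (rule 2)
  also have "\<rho> * (n choose k) + b * ((\<Sum>S\<in>K. expect (\<lambda>X. of_bool (Inl S \<notin> X) * (deg S X / D - 1)\<^sup>2))
      + m / D * (\<Sum>J\<in>dense. p ^ card J))
     \<le> \<rho> * (n choose k) + b * (((n choose k) / D + 4 * card P / D\<^sup>2 * c) + m / D * c)"
    using b c D 3 by (intro add_left_mono mult_left_mono add_mono) auto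
  finally show ?thesis by simp
qed

text \<open>\<open>matching\<close> is the nibble result for this \<open>D\<close>, applied to the
  unreserved \<open>k\<close>-sets with \<open>pos \<phi>\<close> as edges. Bad indices are the
  active copies in selected dense configurations; the others pairwise share at most \<open>k\<close>
  points, hence at most one \<open>k\<close>-set. In the result, shadows are disjoint by the
  matching, and a shadow misses the other \<open>k\<close>-sets of a copy because those are
  reserved.\<close>

lemma sparse_packing:
  fixes \<alpha> b c :: real
  assumes b: "b \<ge> 0" and c: "(\<Sum>J\<in>dense. p ^ card J) \<le> c"
    and matching: "\<And>(V :: nat set set) (I :: ('g \<Rightarrow> nat) set) h B.
      finite V \<Longrightarrow> finite I \<Longrightarrow> (\<And>i. i \<in> I \<Longrightarrow> h i \<subseteq> V \<and> card (h i) = card P) \<Longrightarrow> B \<subseteq> I \<Longrightarrow>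
      (\<And>i j. i \<in> I - B \<Longrightarrow> j \<in> I - B \<Longrightarrow> i \<noteq> j \<Longrightarrow> card (h i \<inter> h j) \<le> 1) \<Longrightarrow>
      \<exists>J\<subseteq>I - B. disjoint_family_on h J \<and>
        real (card V) - real (card P) * real (card J)
        \<le> \<alpha> * real (card V) + b * ((\<Sum>v\<in>V. (card {i \<in> I. v \<in> h i} / D - 1)\<^sup>2) + card B / D)"
    and \<alpha>: "\<alpha> \<ge> 0"
  obtains M where "M \<subseteq> I" "sparse (card Y) k m (\<lambda>\<phi>. \<phi> ` Y) M"
    and "\<And>\<phi> \<psi>. \<phi> \<in> M \<Longrightarrow> \<psi> \<in> M \<Longrightarrow> \<phi> \<noteq> \<psi> \<Longrightarrow> pos \<phi> \<inter> copies (k_sets Y k) \<psi> = {}"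
    and "(n choose k) - card P * real (card M)
      \<le> \<alpha> * (n choose k) + (\<rho> * (n choose k) + b * ((n choose k) / D + 4 * card P / D\<^sup>2 * c + m / D * c))"
proof -
  have K: "card K = n choose k" by (simp add: card_k_sets)
  obtain X where X: "X \<subseteq> \<Omega>"
    "loss b X \<le> \<rho> * (n choose k) + b * ((n choose k) / D + 4 * card P / D\<^sup>2 * c + m / D * c)"
    using bern_le_witness[OF finite_\<Omega> prb_bounds expect_loss[OF b c, unfolded expect_def]] by metis
  define V where "V = {S \<in> K. Inl S \<notin> X}"
  define I' where "I' = {\<phi> \<in> I. active \<phi> X}"
  define B where "B = I' \<inter> \<Union>{J \<in> dense. Inr ` J \<subseteq> X}"
  have fin: "finite V" "finite I'" using finite_K finite_I by (auto simp: V_def I'_def)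
  have act: "Inr \<phi> \<in> X" "\<And>S. S \<in> neg \<phi> \<Longrightarrow> Inl S \<in> X" "\<And>S. S \<in> pos \<phi> \<Longrightarrow> Inl S \<notin> X" if "\<phi> \<in> I'" for \<phi>
    using that by (auto simp: I'_def active_def)
  \<comment> \<open>All members of a dense configuration of active copies are selected, so each of
    them is in \<open>B\<close> and none remains.\<close>
  have bad: "J \<inter> (I' - B) = {}" if J: "J \<in> dense" "J \<subseteq> I'" for J
  proof -
    have "Inr ` J \<subseteq> X" using act(1) J(2) by blast
    then show ?thesis using J by (auto simp: B_def)
  qed
  have "\<exists>J\<subseteq>I' - B. disjoint_family_on pos J \<and>
        real (card V) - real (card P) * real (card J)
        \<le> \<alpha> * real (card V) + b * ((\<Sum>v\<in>V. (card {i \<in> I'. v \<in> pos i} / D - 1)\<^sup>2) + card B / D)"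
  proof (rule matching[OF fin])
    show "pos i \<subseteq> V \<and> card (pos i) = card P" if "i \<in> I'" for i
      using that pos[of i] act(3)[OF that] by (auto simp: V_def I'_def)
    show "B \<subseteq> I'" by (simp add: B_def)
    fix \<phi> \<psi> assume \<phi>: "\<phi> \<in> I' - B" and \<psi>: "\<psi> \<in> I' - B" and ne: "\<phi> \<noteq> \<psi>"
    have I: "\<phi> \<in> I" "\<psi> \<in> I" using \<phi> \<psi> by (auto simp: I'_def)
    have "card (\<phi> ` Y \<inter> \<psi> ` Y) \<le> k"
    proof (rule ccontr)
      assume "\<not> card (\<phi> ` Y \<inter> \<psi> ` Y) \<le> k"
      then have "{\<phi>, \<psi>} \<in> dense" using overlap_dense[OF I ne] by simp
      then show False using bad[of "{\<phi>, \<psi>}"] \<phi> \<psi> by auto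
    qed
    moreover have "finite (\<phi> ` Y \<inter> \<psi> ` Y)" using Y by simp
    ultimately have "T = \<phi> ` Y \<inter> \<psi> ` Y" if "T \<in> pos \<phi> \<inter> pos \<psi>" for T
      using that pos[OF I(1)] pos[OF I(2)] by (intro card_seteq) (auto simp: k_sets_def)
    then have "pos \<phi> \<inter> pos \<psi> \<subseteq> {\<phi> ` Y \<inter> \<psi> ` Y}" by blast
    then have "card (pos \<phi> \<inter> pos \<psi>) \<le> card {\<phi> ` Y \<inter> \<psi> ` Y}" by (intro card_mono) auto
    then show "card (pos \<phi> \<inter> pos \<psi>) \<le> 1" by simp
  qed
  then obtain M where M: "M \<subseteq> I' - B" "disjoint_family_on pos M"
    "real (card V) - real (card P) * real (card M)
        \<le> \<alpha> * real (card V) + b * ((\<Sum>v\<in>V. (card {i \<in> I'. v \<in> pos i} / D - 1)\<^sup>2) + card B / D)" by blast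
  show ?thesis
  proof (rule that[of M])
    show "M \<subseteq> I" using M(1) by (auto simp: I'_def)
    show "sparse (card Y) k m (\<lambda>\<phi>. \<phi> ` Y) M"
      unfolding sparse_def
    proof (rule ccontr)
      assume "dense_configs (card Y) k m (\<lambda>\<phi>. \<phi> ` Y) M \<noteq> {}"
      then obtain J where J: "J \<in> dense_configs (card Y) k m (\<lambda>\<phi>. \<phi> ` Y) M" by blast
      then have JM: "J \<subseteq> M" "J \<noteq> {}" by (auto simp: dense_configs_def)
      have "M \<subseteq> I" using M(1) by (auto simp: I'_def)
      then have "J \<in> dense" using J JM by (auto simp: dense_def dense_configs_def)
      then show False using bad[of J] JM M(1) by blast
    qed
    fix \<phi> \<psi> assume \<phi>: "\<phi> \<in> M" and \<psi>: "\<psi> \<in> M" and ne: "\<phi> \<noteq> \<psi>"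
    have "pos \<phi> \<inter> pos \<psi> = {}" using M(2) \<phi> \<psi> ne by (auto simp: disjoint_family_on_def)
    moreover have "pos \<phi> \<inter> neg \<psi> = {}" using act(2)[of \<psi>] act(3)[of \<phi>] \<phi> \<psi> M(1) by blast
    moreover have "copies (k_sets Y k) \<psi> = pos \<psi> \<union> neg \<psi>" using P(1) by (auto simp: copies_def)
    ultimately show "pos \<phi> \<inter> copies (k_sets Y k) \<psi> = {}" by blast
  next
    let ?S = "\<Sum>S\<in>K. of_bool (Inl S \<in> X) :: real"
    have cV: "real (card V) = (n choose k) - ?S"
    proof -
      have "K \<inter> {S. Inl S \<in> X} = K - V" by (auto simp: V_def)
      then have "?S = card (K - V)" using finite_K by (simp add: of_bool_def sum.If_cases)
      also have "\<dots> = real (n choose k) - card V"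
      proof -
        have VK: "V \<subseteq> K" by (auto simp: V_def)
        then have "card (K - V) = (n choose k) - card V" "card V \<le> n choose k"
          using card_Diff_subset[OF fin(1) VK] card_mono[OF finite_K VK] by (simp_all only: K)
        then show ?thesis by (simp only: of_nat_diff)
      qed
      finally show ?thesis by simp
    qed
    have degV: "(\<Sum>v\<in>V. (card {i \<in> I'. v \<in> pos i} / D - 1)\<^sup>2)
        = (\<Sum>S\<in>K. of_bool (Inl S \<notin> X) * (deg S X / D - 1)\<^sup>2)"
    proof (rule sum.mono_neutral_cong_left[OF finite_K])
      show "V \<subseteq> K" by (auto simp: V_def)
      show "\<forall>i\<in>K - V. of_bool (Inl i \<notin> X) * (deg i X / D - 1)\<^sup>2 = 0" by (auto simp: V_def)
      fix S assume S: "S \<in> V"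
      have "{\<phi>. \<phi> \<in> I \<and> S \<in> pos \<phi>} \<inter> {\<phi>. active \<phi> X} = {i \<in> I'. S \<in> pos i}" by (auto simp: I'_def)
      then have "deg S X = card {i \<in> I'. S \<in> pos i}"
        unfolding deg_def using finite_I by (simp add: of_bool_def sum.If_cases)
      then show "(card {i \<in> I'. S \<in> pos i} / D - 1)\<^sup>2 = of_bool (Inl S \<notin> X) * (deg S X / D - 1)\<^sup>2"
        using S by (simp add: V_def)
    qed
    have cB: "real (card B) \<le> m * (\<Sum>J\<in>dense. of_bool (Inr ` J \<subseteq> X))"
    proof -
      have "card B \<le> card (\<Union>{J \<in> dense. Inr ` J \<subseteq> X})"
      proof (rule card_mono)
        have "\<Union>{J \<in> dense. Inr ` J \<subseteq> X} \<subseteq> I" by (auto simp: dense_def dense_configs_def)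
        then show "finite (\<Union>{J \<in> dense. Inr ` J \<subseteq> X})" using finite_I by (rule finite_subset)
      qed (simp add: B_def)
      also have "\<dots> \<le> (\<Sum>J\<in>{J \<in> dense. Inr ` J \<subseteq> X}. card J)" by (rule card_Union_le_sum_card)
      also have "\<dots> \<le> (\<Sum>J\<in>{J \<in> dense. Inr ` J \<subseteq> X}. m)"
        by (rule sum_mono) (auto simp: dense_def dense_configs_def)
      also have "\<dots> = m * card {J \<in> dense. Inr ` J \<subseteq> X}" by simp
      finally have "real (card B) \<le> real (m * card {J \<in> dense. Inr ` J \<subseteq> X})" by (rule of_nat_mono)
      also have "\<dots> = m * (\<Sum>J\<in>dense. of_bool (Inr ` J \<subseteq> X))"
        using finite_dense by (simp add: of_bool_def sum.If_cases Int_def)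
      finally show ?thesis .
    qed
    have "\<alpha> * real (card V) \<le> \<alpha> * (n choose k)"
      using \<alpha> by (intro mult_left_mono) (auto simp: cV sum_nonneg)
    moreover have "card B / D \<le> m / D * (\<Sum>J\<in>dense. of_bool (Inr ` J \<subseteq> X))"
      using cB D by (simp add: divide_right_mono)
    then have "b * ((\<Sum>v\<in>V. (card {i \<in> I'. v \<in> pos i} / D - 1)\<^sup>2) + card B / D)
        \<le> b * ((\<Sum>S\<in>K. of_bool (Inl S \<notin> X) * (deg S X / D - 1)\<^sup>2) + m / D * (\<Sum>J\<in>dense. of_bool (Inr ` J \<subseteq> X)))"
      unfolding degV by (intro mult_left_mono add_left_mono b)
    ultimately have "(n choose k) - card P * real (card M) \<le> \<alpha> * (n choose k) + loss b X"
      using M(3) cV unfolding loss_def by linarith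
    then show "(n choose k) - card P * real (card M)
      \<le> \<alpha> * (n choose k) + (\<rho> * (n choose k) + b * ((n choose k) / D + 4 * card P / D\<^sup>2 * c + m / D * c))"
      using X(2) by linarith
  qed
qed

end

lemma (in random_copies) dense_weight:
  assumes n: "m * card Y \<le> n" and \<kappa>: "p * real n ^ (card Y - k) \<le> \<kappa>"
  shows "(\<Sum>J\<in>dense. p ^ card J) \<le> (\<Sum>j\<le>m. \<kappa> ^ j) * 2 ^ ((m * card Y) ^ card Y) * real n ^ (k - 1)"
  unfolding dense_def
proof (rule dense_configs_weight[OF finite_I])
  fix U :: "nat set" assume U: "U \<subseteq> {..<n}" "card U \<le> m * card Y"
  have finU: "finite U" using U(1) by (rule finite_subset) simp
  have "{\<phi> \<in> I. \<phi> ` Y \<subseteq> U} \<subseteq> Y \<rightarrow>\<^sub>E U"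
    by (auto simp: injections_def PiE_def)
  then have "card {\<phi> \<in> I. \<phi> ` Y \<subseteq> U} \<le> card (Y \<rightarrow>\<^sub>E U)"
    by (rule card_mono[rotated]) (simp add: finite_PiE Y finU)
  also have "\<dots> = card U ^ card Y" by (rule card_funcsetE[OF Y])
  also have "\<dots> \<le> (m * card Y) ^ card Y" using U(2) by (rule power_mono) simp
  finally show "card {\<phi> \<in> I. \<phi> ` Y \<subseteq> U} \<le> (m * card Y) ^ card Y" .
qed (use injections_image(1) k m n p \<kappa> in \<open>simp_all only: less_imp_le\<close>, simp_all)

text \<open>Four losses of at most \<open>e / 4\<close> each: the matching, the reserved sets, the
  variance term \<open>b / D\<close>, and the dense configurations. The matching bound fixes
  \<open>b\<close> and \<open>D0\<close> first, then \<open>D\<close> is chosen, and only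
  \<open>n\<close> comes after it, so all constants in the last loss are independent of
  \<open>n\<close>.\<close>

lemma packing_exists:
  fixes Y :: "'g set" and e :: real
  assumes Y: "finite Y" and P: "P \<subseteq> k_sets Y k" "card P \<ge> 2" and k: "1 \<le> k" "k < card Y"
    and m: "m \<ge> 2" and e: "e > 0"
  shows "\<forall>\<^sub>F n in sequentially. \<exists>M \<subseteq> injections Y n. sparse (card Y) k m (\<lambda>\<phi>. \<phi> ` Y) M \<and>
    (\<forall>\<phi>\<in>M. \<forall>\<psi>\<in>M. \<phi> \<noteq> \<psi> \<longrightarrow> copies P \<phi> \<inter> copies (k_sets Y k) \<psi> = {}) \<and>
    (1 - e) * (n choose k) \<le> card P * real (card M)"
proof -
  define \<gamma> where "\<gamma> = card Y"
  have e4: "e / 4 > 0" using e by simp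
  show ?thesis
  proof (rule nearly_perfect_matching[OF P(2) e4, where ?'v = "nat set" and ?'i = "'g \<Rightarrow> nat"])
    fix b D0 :: real
    assume b: "b \<ge> 0" and match: "\<And>(V :: nat set set) (I :: ('g \<Rightarrow> nat) set) h B D.
        finite V \<Longrightarrow> finite I \<Longrightarrow> (\<And>i. i \<in> I \<Longrightarrow> h i \<subseteq> V \<and> card (h i) = card P) \<Longrightarrow> B \<subseteq> I \<Longrightarrow>
        (\<And>i j. i \<in> I - B \<Longrightarrow> j \<in> I - B \<Longrightarrow> i \<noteq> j \<Longrightarrow> card (h i \<inter> h j) \<le> 1) \<Longrightarrow> D \<ge> D0 \<Longrightarrow> D > 0 \<Longrightarrow>
        \<exists>J\<subseteq>I - B. disjoint_family_on h J \<and>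
          real (card V) - real (card P) * real (card J)
          \<le> e / 4 * real (card V) + b * ((\<Sum>v\<in>V. (card {i \<in> I. v \<in> h i} / D - 1)\<^sup>2) + card B / D)"
    define \<rho> where "\<rho> = min (e / 4) (1 / 2)"
    define D where "D = max (max D0 1) (4 * b / e)"
    define \<theta> where "\<theta> = \<rho> ^ card (k_sets Y k - P) * (1 - \<rho>) ^ (card P - 1)"
    \<comment> \<open>Every \<open>k\<close>-set lies in at least
      \<open>n ^ (\<gamma> - k) / 2 ^ \<gamma>\<close> copies, so reaching degree \<open>D\<close>
      requires \<open>p * n ^ (\<gamma> - k)\<close> to be at most this constant.\<close>
    define \<kappa> where "\<kappa> = D * 2 ^ \<gamma> / \<theta>"
    define C where "C = (\<Sum>j\<le>m. \<kappa> ^ j) * 2 ^ ((m * \<gamma>) ^ \<gamma>)"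
    define L where "L = b * (4 * card P / D\<^sup>2 * C + m / D * C)"
    have \<rho>: "0 < \<rho>" "\<rho> < 1" "\<rho> \<le> e / 4" using e by (auto simp: \<rho>_def)
    have D: "D \<ge> D0" "D > 0" "b / D \<le> e / 4"
    proof -
      show "D \<ge> D0" "D > 0" by (auto simp: D_def)
      have "4 * b / e \<le> D" by (simp add: D_def)
      then show "b / D \<le> e / 4" using e \<open>D > 0\<close> by (simp add: field_simps)
    qed
    have \<theta>: "\<theta> > 0" using \<rho> by (simp add: \<theta>_def)
    \<comment> \<open>\<open>\<kappa>\<close> ensures \<open>p \<le> 1\<close>; the second entry
      absorbs \<open>L * n ^ (k - 1)\<close> into \<open>e / 4\<close> of the \<open>k\<close>-sets,
      of which there are at least \<open>(n / k) ^ k\<close>; \<open>2 * \<gamma>\<close> serves the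
      lower bound on the number of embeddings.\<close>
    define n0 where "n0 = nat \<lceil>max \<kappa> (4 * L * real k ^ k / e)\<rceil> + m * \<gamma> + 2 * \<gamma> + k + 1"
    show ?thesis
    proof (rule eventually_sequentiallyI[of n0])
      fix n assume "n \<ge> n0"
      then have n: "real n \<ge> \<kappa>" "real n \<ge> 4 * L * real k ^ k / e" "m * \<gamma> \<le> n" "2 * \<gamma> \<le> n" "k \<le> n" "n \<ge> 1"
        unfolding n0_def by linarith+
      define N where "N = real (n choose k)"
      have N: "N > 0" using n(5) by (simp add: N_def)
      define S0 where "S0 = {..<k}"
      have S0: "S0 \<in> k_sets {..<n} k" using n(5) by (auto simp: S0_def k_sets_def)
      define \<Delta> where "\<Delta> = real (card {\<phi> \<in> injections Y n. S0 \<in> copies P \<phi>})"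
      have deg: "real (card {\<phi> \<in> injections Y n. S \<in> copies P \<phi>}) = \<Delta>" if "S \<in> k_sets {..<n} k" for S
        using copies_degree_le[OF Y P(1) S0 that] copies_degree_le[OF Y P(1) that S0] by (simp add: \<Delta>_def)
      have N\<Delta>: "N * \<Delta> = card P * real (card (injections Y n))"
        using arg_cong[OF copies_degree[OF Y P(1) S0], of real] by (simp add: N_def \<Delta>_def)
      have \<Delta>_ge: "real n ^ (\<gamma> - k) \<le> \<Delta> * 2 ^ \<gamma>"
      proof -
        have "real n ^ k * real n ^ (\<gamma> - k) = real n ^ \<gamma>"
          using k by (simp add: \<gamma>_def flip: power_add)
        also have "\<dots> = (real n / 2) ^ \<gamma> * 2 ^ \<gamma>" by (simp add: power_divide)
        also have "\<dots> \<le> 1 * real (card (injections Y n)) * 2 ^ \<gamma>"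
          using card_injections_lower[OF Y, of n] n(4) by (simp add: \<gamma>_def)
        also have "\<dots> \<le> (card P * real (card (injections Y n))) * 2 ^ \<gamma>"
          using P(2) by (intro mult_right_mono) auto
        also have "\<dots> = N * (\<Delta> * 2 ^ \<gamma>)" by (simp add: N\<Delta>[symmetric])
        also have "\<dots> \<le> real n ^ k * (\<Delta> * 2 ^ \<gamma>)"
        proof (rule mult_right_mono)
          have "real (n choose k) \<le> real (n ^ k)" using binomial_le_pow[OF n(5)] by (rule of_nat_mono)
          then show "N \<le> real n ^ k" by (simp add: N_def)
        qed (simp add: \<Delta>_def)
        finally show ?thesis using n(6) by simp
      qed
      moreover have npos: "real n ^ (\<gamma> - k) > 0" using n(6) by simp
      ultimately have "0 < \<Delta> * 2 ^ \<gamma>" by linarith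
      then have \<Delta>: "\<Delta> > 0" by (simp only: zero_less_mult_pos2[of \<Delta> "2 ^ \<gamma>"] zero_less_power zero_less_numeral)
      \<comment> \<open>Solves the degree equation of \<open>random_copies\<close> for
        \<open>p\<close>.\<close>
      define p where "p = D / (\<Delta> * \<theta>)"
      have p0: "p > 0" using D \<Delta> \<theta> by (simp add: p_def)
      have pn: "p * real n ^ (\<gamma> - k) \<le> \<kappa>"
      proof -
        have "p * real n ^ (\<gamma> - k) \<le> p * (\<Delta> * 2 ^ \<gamma>)" using \<Delta>_ge p0 by (intro mult_left_mono) auto
        also have "\<dots> = \<kappa>" using \<Delta> \<theta> by (simp add: p_def \<kappa>_def)
        finally show ?thesis .
      qed
      have "p \<le> 1"
      proof -
        have "real n ^ 1 \<le> real n ^ (\<gamma> - k)" using k n(6) by (intro power_increasing) (auto simp: \<gamma>_def)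
        then have "\<kappa> \<le> real n ^ (\<gamma> - k)" unfolding power_one_right by (rule order_trans[OF n(1)])
        then have "p * real n ^ (\<gamma> - k) \<le> 1 * real n ^ (\<gamma> - k)" using pn by linarith
        then show ?thesis using npos by (simp only: mult_le_cancel_right_pos)
      qed
      interpret rc: random_copies Y P k n m p \<rho> D
      proof unfold_locales
        fix S assume "S \<in> k_sets {..<n} k"
        then show "real (card {\<phi> \<in> injections Y n. S \<in> copies P \<phi>}) * (p * \<rho> ^ card (k_sets Y k - P) * (1 - \<rho>) ^ (card P - 1)) = D"
          using \<Delta> \<theta> by (simp only: deg mult.assoc \<theta>_def[symmetric]) (simp add: p_def)
      qed (use Y P k m p0 \<open>p \<le> 1\<close> \<rho> D in auto)
      have w: "(\<Sum>J\<in>rc.dense. p ^ card J) \<le> C * real n ^ (k - 1)"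
        using rc.dense_weight[of \<kappa>] n(3) pn unfolding C_def \<gamma>_def by blast
      show "\<exists>M \<subseteq> injections Y n. sparse (card Y) k m (\<lambda>\<phi>. \<phi> ` Y) M \<and>
        (\<forall>\<phi>\<in>M. \<forall>\<psi>\<in>M. \<phi> \<noteq> \<psi> \<longrightarrow> copies P \<phi> \<inter> copies (k_sets Y k) \<psi> = {}) \<and>
        (1 - e) * (n choose k) \<le> card P * real (card M)"
      proof (rule rc.sparse_packing[OF b w match[OF _ _ _ _ _ D(1,2)] less_imp_le[OF e4], folded N_def])
        fix M assume M: "M \<subseteq> injections Y n" "sparse (card Y) k m (\<lambda>\<phi>. \<phi> ` Y) M"
          "\<And>\<phi> \<psi>. \<phi> \<in> M \<Longrightarrow> \<psi> \<in> M \<Longrightarrow> \<phi> \<noteq> \<psi> \<Longrightarrow> copies P \<phi> \<inter> copies (k_sets Y k) \<psi> = {}"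
          "N - card P * real (card M)
            \<le> e / 4 * N + (\<rho> * N + b * (N / D + 4 * card P / D\<^sup>2 * (C * real n ^ (k - 1)) + m / D * (C * real n ^ (k - 1))))"
        have "b * (N / D + 4 * card P / D\<^sup>2 * (C * real n ^ (k - 1)) + m / D * (C * real n ^ (k - 1)))
            = b / D * N + L * real n ^ (k - 1)"
          by (simp add: L_def algebra_simps)
        moreover have "b / D * N \<le> e / 4 * N" using D N by (intro mult_right_mono) auto
        moreover have "\<rho> * N \<le> e / 4 * N" using \<rho> N by (intro mult_right_mono) auto
        moreover have "L * real n ^ (k - 1) \<le> e / 4 * N"
        proof -
          have "(real n / real k) ^ k \<le> N"
            using binomial_ge_n_over_k_pow_k[of k n, where 'a=real] n(5) by (simp add: N_def)
          then have "e / 4 * (real n ^ k / real k ^ k) \<le> e / 4 * N"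
            using e by (intro mult_left_mono) (auto simp: power_divide)
          moreover have "L * real n ^ (k - 1) \<le> e / 4 * (real n ^ k / real k ^ k)"
          proof -
            have "4 * L * real k ^ k \<le> real n * e" using n(2) e by (simp add: field_simps)
            then have "4 * L * real k ^ k * real n ^ (k - 1) \<le> real n * e * real n ^ (k - 1)" by (intro mult_right_mono) auto
            also have "\<dots> = e * real n ^ k" using k by (cases k) auto
            finally show ?thesis using k by (simp add: field_simps)
          qed
          ultimately show ?thesis by linarith
        qed
        ultimately have "N - card P * real (card M) \<le> e * N" using M(4) by linarith
        then have "(1 - e) * N \<le> card P * real (card M)" by (simp add: algebra_simps)
        then show "\<exists>M \<subseteq> injections Y n. sparse (card Y) k m (\<lambda>\<phi>. \<phi> ` Y) M \<and>
          (\<forall>\<phi>\<in>M. \<forall>\<psi>\<in>M. \<phi> \<noteq> \<psi> \<longrightarrow> copies P \<phi> \<inter> copies (k_sets Y k) \<psi> = {}) \<and>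
          (1 - e) * (n choose k) \<le> card P * real (card M)"
          using M(1-3) unfolding N_def by blast
      qed
    qed
  qed
qed

section \<open>The main theorem\<close>

lemma sparse_inj_image:
  assumes s: "sparse r k m (\<lambda>B. B) \<G>" and inj: "inj_on \<phi> (\<Union>\<G>)"
  shows "sparse r k m (\<lambda>B. B) ((\<lambda>B. \<phi> ` B) ` \<G>)"
  unfolding sparse_def
proof (rule ccontr)
  assume "dense_configs r k m (\<lambda>B. B) ((\<lambda>B. \<phi> ` B) ` \<G>) \<noteq> {}"
  then obtain J where J: "J \<subseteq> (\<lambda>B. \<phi> ` B) ` \<G>" "finite J" "J \<noteq> {}" "card J \<le> m"
    "card (\<Union>J) + card J * k < card J * r + k"
    by (auto simp: dense_configs_def)
  then obtain J' where J': "J' \<subseteq> \<G>" "J = (\<lambda>B. \<phi> ` B) ` J'" by (auto simp: subset_image_iff)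
  have injJ: "inj_on (\<lambda>B. \<phi> ` B) J'"
    using inj_on_image_sets[OF inj, of J'] J'(1) by blast
  have cJ: "card J = card J'" using J'(2) card_image[OF injJ] by simp
  have finJ': "finite J'" using J(2) injJ unfolding J'(2) by (simp only: finite_image_iff)
  have "\<Union>J = \<phi> ` \<Union>J'" unfolding J'(2) by blast
  moreover have "inj_on \<phi> (\<Union>J')" using inj by (rule inj_on_subset) (use J'(1) in blast)
  ultimately have cU: "card (\<Union>J) = card (\<Union>J')" by (simp add: card_image)
  have "J' \<noteq> {}" using J(3) J'(2) by blast
  then have "card J' * r + k \<le> card (\<Union>J') + card J' * k"
    using sparseD[OF s J'(1) finJ'] J(4) cJ by simp
  then show False using J(5) cJ cU by simp
qed

lemma max_cancellative_ge:
  assumes "uniform_hypergraph {..<n} r H" "cancellative s H"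
  shows "card H \<le> max_cancellative s n r"
  unfolding max_cancellative_def by (rule Max_ge[OF finite_cancellative_sizes]) (use assms in blast)

lemma max_cancellative_attained:
  obtains H where "uniform_hypergraph {..<n} r H" "cancellative s H" "card H = max_cancellative s n r"
proof -
  have "max_cancellative s n r \<in> {card H | H. uniform_hypergraph {..<n} r H \<and> cancellative s H}"
    unfolding max_cancellative_def
    by (rule Max_in[OF finite_cancellative_sizes]) (use zero_in_cancellative_sizes in blast)
  then show ?thesis using that by auto
qed

lemma packing_cancellative:
  fixes \<G> :: "'g set set" and Y
  assumes t: "t \<ge> 2" and k: "k \<ge> 1"
    and fin: "finite \<G>" and size: "\<And>B. B \<in> \<G> \<Longrightarrow> finite B \<and> card B = t * k"
    and own: "\<And>B. B \<in> \<G> \<Longrightarrow> \<exists>x\<in>B. \<forall>A\<in>\<G>. x \<in> A \<longrightarrow> A = B"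
    and inner: "sparse (t * k) k (2 * t) (\<lambda>B. B) \<G>"
    and Y: "Y = \<Union>\<G>"
    and M: "M \<subseteq> injections Y n" and outer: "sparse (card Y) k (2 * t) (\<lambda>\<phi>. \<phi> ` Y) M"
    and cross: "\<And>\<phi> \<psi>. \<phi> \<in> M \<Longrightarrow> \<psi> \<in> M \<Longrightarrow> \<phi> \<noteq> \<psi> \<Longrightarrow>
      copies (\<Union>B\<in>\<G>. k_sets B k) \<phi> \<inter> copies (k_sets Y k) \<psi> = {}"
  shows "card M * card \<G> \<le> max_cancellative (2 * (t - 1)) n (t * k)"
proof -
  define G where "G \<phi> = (\<lambda>B. \<phi> ` B) ` \<G>" for \<phi> :: "'g \<Rightarrow> nat"
  have finY: "finite Y" using fin size by (auto simp: Y)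
  have sub: "B \<subseteq> Y" if "B \<in> \<G>" for B using that by (auto simp: Y)
  have inj: "inj_on \<phi> Y" and im: "\<phi> ` Y \<subseteq> {..<n}" and cim: "card (\<phi> ` Y) = card Y" if "\<phi> \<in> M" for \<phi>
    using injections_image[of \<phi> Y n] M that by auto
  interpret gadget_family t k "card Y" M "\<lambda>\<phi>. \<phi> ` Y" G
  proof
    show "t \<ge> 2" "k \<ge> 1" by fact+
    show "sparse (card Y) k (2 * t) (\<lambda>\<phi>. \<phi> ` Y) M" by fact
    fix \<phi> assume \<phi>: "\<phi> \<in> M"
    show "finite (\<phi> ` Y) \<and> card (\<phi> ` Y) = card Y" using finY cim[OF \<phi>] by simp
    show "sparse (t * k) k (2 * t) (\<lambda>B. B) (G \<phi>)"
      unfolding G_def by (rule sparse_inj_image[OF inner]) (use inj[OF \<phi>] in \<open>simp add: Y\<close>)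
    { fix A assume "A \<in> G \<phi>"
      then obtain B where B: "B \<in> \<G>" "A = \<phi> ` B" by (auto simp: G_def)
      have "inj_on \<phi> B" using inj[OF \<phi>] by (rule inj_on_subset) (rule sub[OF B(1)])
      then show "A \<subseteq> \<phi> ` Y \<and> card A = t * k"
        using B size[OF B(1)] sub[OF B(1)] by (auto simp: card_image)
      obtain x where x: "x \<in> B" "\<And>A. A \<in> \<G> \<Longrightarrow> x \<in> A \<Longrightarrow> A = B" using own[OF B(1)] by blast
      show "\<exists>x\<in>A. \<forall>A'\<in>G \<phi>. x \<in> A' \<longrightarrow> A' = A"
      proof (intro bexI[of _ "\<phi> x"] ballI impI)
        show "\<phi> x \<in> A" using x(1) B(2) by blast
        fix A' assume A': "A' \<in> G \<phi>" "\<phi> x \<in> A'"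
        then obtain B' where B': "B' \<in> \<G>" "A' = \<phi> ` B'" by (auto simp: G_def)
        then obtain y where y: "y \<in> B'" "\<phi> y = \<phi> x" using A'(2) by auto
        have "y = x" using inj_onD[OF inj[OF \<phi>] y(2)] sub[OF B'(1)] sub[OF B(1)] y(1) x(1) by blast
        then have "B' = B" using x(2)[OF B'(1)] y(1) by blast
        then show "A' = A" using B' B by simp
      qed }
    \<comment> \<open>Any \<open>k\<close> common points would form a \<open>k\<close>-set in the
      shadow of the copy \<open>\<psi>\<close> and inside the image of \<open>\<phi>\<close>, which
      the packing excludes.\<close>
    fix \<psi> A assume \<psi>: "\<psi> \<in> M" and ne: "\<phi> \<noteq> \<psi>" and A: "A \<in> G \<psi>"
    show "card (A \<inter> \<phi> ` Y) < k"
    proof (rule ccontr)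
      assume "\<not> card (A \<inter> \<phi> ` Y) < k"
      then have "k \<le> card (A \<inter> \<phi> ` Y)" by simp
      then obtain S where S: "S \<subseteq> A \<inter> \<phi> ` Y" "card S = k"
        by (rule obtain_subset_with_card_n)
      obtain B where B: "B \<in> \<G>" "A = \<psi> ` B" using A by (auto simp: G_def)
      have "S \<subseteq> \<psi> ` B" "S \<subseteq> \<phi> ` Y" using S(1) B(2) by simp_all
      then obtain S1 S2 where S1: "S1 \<subseteq> B" "S = \<psi> ` S1" and S2: "S2 \<subseteq> Y" "S = \<phi> ` S2"
        unfolding subset_image_iff by blast
      have "inj_on \<psi> S1" by (rule inj_on_subset[OF inj[OF \<psi>] order_trans[OF S1(1) sub[OF B(1)]]])
      then have "card S1 = k" using S(2) unfolding S1(2) by (simp add: card_image)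
      then have "S \<in> copies (\<Union>B\<in>\<G>. k_sets B k) \<psi>" using S1 B(1) unfolding copies_def k_sets_def by blast
      moreover have "inj_on \<phi> S2" by (rule inj_on_subset[OF inj[OF \<phi>] S2(1)])
      then have "card S2 = k" using S(2) unfolding S2(2) by (simp add: card_image)
      then have "S \<in> copies (k_sets Y k) \<phi>" using S2 unfolding copies_def k_sets_def by blast
      ultimately show False using cross[OF \<psi> \<phi>] ne by blast
    qed
  qed
  let ?H = "\<Union>\<phi>\<in>M. G \<phi>"
  have finM: "finite M" using finite_injections[OF finY] M by (rule finite_subset[rotated])
  have "uniform_hypergraph {..<n} (t * k) ?H"
    unfolding uniform_hypergraph_def
  proof (intro conjI ballI)
    fix A assume "A \<in> ?H"
    then obtain \<phi> where \<phi>: "\<phi> \<in> M" "A \<in> G \<phi>" by (rule UN_E)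
    show "A \<subseteq> {..<n}" using edges[OF \<phi>] im[OF \<phi>(1)] by (auto dest: subsetD)
    show "card A = t * k" using edges[OF \<phi>] by simp
  qed simp
  moreover have "cancellative (2 * (t - 1)) ?H" by (rule cancellative_gadgets)
  ultimately have "card ?H \<le> max_cancellative (2 * (t - 1)) n (t * k)" by (rule max_cancellative_ge)
  moreover have "card ?H = (\<Sum>\<phi>\<in>M. card (G \<phi>))"
  proof (rule card_UN_disjoint[OF finM])
    show "\<forall>\<phi>\<in>M. finite (G \<phi>)" using fin by (simp add: G_def)
    show "\<forall>\<phi>\<in>M. \<forall>\<psi>\<in>M. \<phi> \<noteq> \<psi> \<longrightarrow> G \<phi> \<inter> G \<psi> = {}" using disjoint_gadgets by blast
  qed
  moreover have "(\<Sum>\<phi>\<in>M. card (G \<phi>)) = (\<Sum>\<phi>\<in>M. card \<G>)"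
  proof (rule sum.cong[OF refl])
    fix \<phi> assume "\<phi> \<in> M"
    then have "inj_on (\<lambda>B. \<phi> ` B) \<G>" using inj_on_image_sets[OF inj, of \<phi> \<G>] sub by blast
    then show "card (G \<phi>) = card \<G>" by (simp add: G_def card_image)
  qed
  ultimately show ?thesis by simp
qed

lemma max_cancellative_lower:
  fixes e :: real
  assumes t: "t \<ge> 2" and k: "k \<ge> 2" and e: "0 < e" "e < 1"
  shows "\<forall>\<^sub>F n in sequentially. (1 - e) * (n choose k)
    \<le> ((t * k - 1) choose (k - 1)) * real (max_cancellative (2 * (t - 1)) n (t * k))"
proof -
  define c where "c = real ((t * k - 1) choose (k - 1))"
  have tk: "2 * k \<le> t * k" using t by (rule mult_right_mono) simp
  then have "k - 1 \<le> t * k - 1" by linarith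
  then have c: "c > 0" by (simp add: c_def)
  \<comment> \<open>The gadget costs a factor \<open>1 + e / 2\<close> and the packing a factor
    \<open>1 - e / 2\<close>; these combine by
    \<open>(1 + e / 2) * (1 - e) \<le> 1 - e / 2\<close>.\<close>
  then have ce: "c * e / 2 > 0" using e by simp
  show ?thesis
  proof (rule gadget_exists[OF t k ce])
    fix \<G> :: "(nat + nat set) set set"
    assume \<G>: "finite \<G>" "\<G> \<noteq> {}" "\<And>B. B \<in> \<G> \<Longrightarrow> finite B \<and> card B = t * k"
      "\<And>B. B \<in> \<G> \<Longrightarrow> \<exists>x\<in>B. \<forall>A\<in>\<G>. x \<in> A \<longrightarrow> A = B"
      "sparse (t * k) k (2 * t) (\<lambda>B. B) \<G>"
      "card (\<Union>B\<in>\<G>. k_sets B k) \<le> card \<G> * (((t * k - 1) choose (k - 1)) + c * e / 2)"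
    define Y where "Y = \<Union>\<G>"
    define P where "P = (\<Union>B\<in>\<G>. k_sets B k)"
    have finY: "finite Y" using \<G>(1,3) by (auto simp: Y_def)
    have PY: "P \<subseteq> k_sets Y k" using k_sets_mono[of _ Y k] unfolding P_def Y_def by blast
    obtain B where B: "B \<in> \<G>" using \<G>(2) by blast
    have "card (k_sets B k) = (t * k) choose k" using \<G>(3)[OF B] by (simp add: card_k_sets)
    also have "\<dots> = t * ((t * k - 1) choose (k - 1))" by (rule choose_multiple) (use t k in auto)
    finally have cB: "card (k_sets B k) = t * ((t * k - 1) choose (k - 1))" .
    \<comment> \<open>The packing treats shadows as edges and needs size at least 2; a single gadget
      edge already contributes enough \<open>k\<close>-sets.\<close>
    have "2 * 1 \<le> t * ((t * k - 1) choose (k - 1))"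
      using t c by (intro mult_mono) (auto simp: c_def Suc_le_eq)
    moreover have "card (k_sets B k) \<le> card P"
      by (rule card_mono) (use \<G>(1,3) B k_sets_finite in \<open>auto simp: P_def\<close>)
    ultimately have P2: "card P \<ge> 2" using cB by simp
    have "card B \<le> card Y" by (rule card_mono[OF finY]) (use B in \<open>auto simp: Y_def\<close>)
    then have kY: "k < card Y" using \<G>(3)[OF B] tk k by linarith
    have "\<forall>\<^sub>F n in sequentially. \<exists>M \<subseteq> injections Y n. sparse (card Y) k (2 * t) (\<lambda>\<phi>. \<phi> ` Y) M \<and>
      (\<forall>\<phi>\<in>M. \<forall>\<psi>\<in>M. \<phi> \<noteq> \<psi> \<longrightarrow> copies P \<phi> \<inter> copies (k_sets Y k) \<psi> = {}) \<and>
      (1 - e / 2) * (n choose k) \<le> card P * real (card M)"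
      by (rule packing_exists[OF finY PY P2 _ kY]) (use k t e in auto)
    then show ?thesis
    proof (rule eventually_mono)
      fix n
      assume "\<exists>M \<subseteq> injections Y n. sparse (card Y) k (2 * t) (\<lambda>\<phi>. \<phi> ` Y) M \<and>
        (\<forall>\<phi>\<in>M. \<forall>\<psi>\<in>M. \<phi> \<noteq> \<psi> \<longrightarrow> copies P \<phi> \<inter> copies (k_sets Y k) \<psi> = {}) \<and>
        (1 - e / 2) * (n choose k) \<le> card P * real (card M)"
      then obtain M where M: "M \<subseteq> injections Y n" "sparse (card Y) k (2 * t) (\<lambda>\<phi>. \<phi> ` Y) M"
        "\<And>\<phi> \<psi>. \<phi> \<in> M \<Longrightarrow> \<psi> \<in> M \<Longrightarrow> \<phi> \<noteq> \<psi> \<Longrightarrow> copies P \<phi> \<inter> copies (k_sets Y k) \<psi> = {}"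
        "(1 - e / 2) * (n choose k) \<le> card P * real (card M)" by blast
      define X where "X = real (max_cancellative (2 * (t - 1)) n (t * k))"
      have "card M * card \<G> \<le> max_cancellative (2 * (t - 1)) n (t * k)"
        using packing_cancellative[OF t _ \<G>(1,3,4,5) Y_def M(1,2)] M(3) k unfolding P_def by simp
      then have X: "real (card M) * card \<G> \<le> X"
        unfolding X_def of_nat_mult[symmetric] of_nat_le_iff .
      have "(1 - e / 2) * (n choose k) \<le> card P * real (card M)" by (rule M(4))
      also have "\<dots> \<le> (card \<G> * (c + c * e / 2)) * real (card M)"
        using \<G>(6) unfolding P_def c_def by (intro mult_right_mono) auto
      also have "\<dots> = (c + c * e / 2) * (real (card M) * card \<G>)" by simp
      also have "\<dots> \<le> (c + c * e / 2) * X" using X c e by (intro mult_left_mono) auto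
      also have "\<dots> = (1 + e / 2) * (c * X)" by (simp add: algebra_simps)
      finally have main: "(1 - e / 2) * (n choose k) \<le> (1 + e / 2) * (c * X)" .
      have "(1 + e / 2) * ((1 - e) * (n choose k)) \<le> (1 - e / 2) * (n choose k)"
      proof -
        have "(1 + e / 2) * (1 - e) \<le> 1 - e / 2" using e by (simp add: algebra_simps)
        then show ?thesis unfolding mult.assoc[symmetric] by (rule mult_right_mono) simp
      qed
      also note main
      finally show "(1 - e) * (n choose k) \<le> ((t * k - 1) choose (k - 1)) * real (max_cancellative (2 * (t - 1)) n (t * k))"
        unfolding c_def[symmetric] X_def[symmetric] using e by (simp add: mult_le_cancel_left_pos)
    qed
  qed
qed

text \<open>The charging bound needs \<open>2 * t\<close> edges. With fewer, the left side is
  bounded independently of \<open>n\<close>, and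
  \<open>n choose k \<ge> (n / k) ^ k \<ge> n / k\<close> overtakes it.\<close>

lemma max_cancellative_upper:
  assumes t: "t \<ge> 1" and k: "k \<ge> 1"
  shows "\<forall>\<^sub>F n in sequentially.
    max_cancellative (2 * (t - 1)) n (t * k) * ((t * k - 1) choose (k - 1)) \<le> n choose k"
proof (rule eventually_sequentiallyI)
  let ?c = "(t * k - 1) choose (k - 1)"
  fix n assume n: "n \<ge> k + k * (2 * t * ?c)"
  obtain H where H: "uniform_hypergraph {..<n} (t * k) H" "cancellative (2 * (t - 1)) H"
    "card H = max_cancellative (2 * (t - 1)) n (t * k)" by (rule max_cancellative_attained)
  have "card H * ?c \<le> n choose k"
  proof (cases "2 * t \<le> card H")
    case True
    then show ?thesis using cancellative_upper_bound[OF t k H(1,2)] by simp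
  next
    case False
    then have "card H * ?c \<le> 2 * t * ?c" by (intro mult_right_mono) auto
    then have "real (card H * ?c) \<le> real (2 * t * ?c)" by (rule of_nat_mono)
    also have "\<dots> \<le> real n / real k"
    proof -
      have "k * (2 * t * ?c) \<le> n" using n by simp
      then have "real (k * (2 * t * ?c)) \<le> real n" by (rule of_nat_mono)
      then show ?thesis using k by (simp add: field_simps)
    qed
    also have "\<dots> \<le> (real n / real k) ^ k"
      using n k by (intro self_le_power) auto
    also have "\<dots> \<le> real (n choose k)"
      using binomial_ge_n_over_k_pow_k[of k n, where 'a=real] n by simp
    finally show ?thesis by (simp only: of_nat_le_iff)
  qed
  then show "max_cancellative (2 * (t - 1)) n (t * k) * ?c \<le> n choose k" by (simp only: H(3))
qed

theorem theorem1p1: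
  fixes t k :: nat
  assumes "t \<ge> 2" and "k \<ge> 2"
  shows "asymp_equiv (\<lambda>n. real (max_cancellative (2 * (t - 1)) n (t * k))) sequentially
           (\<lambda>n. real (n choose k) / real ((t * k - 1) choose (k - 1)))"
proof (rule asymp_equivI', rule tendstoI)
  fix e :: real assume e: "e > 0"
  define c where "c = (t * k - 1) choose (k - 1)"
  \<comment> \<open>The cap \<open>1 / 2\<close> keeps \<open>e' < 1\<close>, as the lower bound
    requires; \<open>e / 2\<close> makes the final inequality strict.\<close>
  define e' where "e' = min (e / 2) (1 / 2)"
  have e': "0 < e'" "e' < 1" "e' < e" using e by (auto simp: e'_def)
  have "1 * k \<le> t * k" by (rule mult_right_mono) (use assms in auto)
  then have c: "c > 0" by (simp add: c_def diff_le_mono)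
  have "\<forall>\<^sub>F n in sequentially. max_cancellative (2 * (t - 1)) n (t * k) * c \<le> n choose k"
    unfolding c_def by (rule max_cancellative_upper) (use assms in auto)
  moreover have "\<forall>\<^sub>F n in sequentially. (1 - e') * (n choose k) \<le> c * real (max_cancellative (2 * (t - 1)) n (t * k))"
    unfolding c_def by (rule max_cancellative_lower[OF assms e'(1,2)])
  moreover have "\<forall>\<^sub>F n in sequentially. k \<le> n" by (rule eventually_ge_at_top)
  ultimately show "\<forall>\<^sub>F n in sequentially.
    dist (real (max_cancellative (2 * (t - 1)) n (t * k)) / (real (n choose k) / real ((t * k - 1) choose (k - 1)))) 1 < e"
  proof eventually_elim
    case (elim n)
    define N where "N = real (n choose k)"
    define X where "X = real (max_cancellative (2 * (t - 1)) n (t * k))"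
    have N: "N > 0" using elim(3) by (simp add: N_def)
    have "real (max_cancellative (2 * (t - 1)) n (t * k) * c) \<le> real (n choose k)"
      using elim(1) by (rule of_nat_mono)
    then have up: "X * c / N \<le> 1" using N by (simp add: X_def N_def)
    have "(1 - e') * N / N \<le> X * c / N"
      using elim(2) N by (intro divide_right_mono) (auto simp: X_def N_def mult.commute)
    then have "1 - e' \<le> X * c / N" using N by simp
    with up e' have "\<bar>X * c / N - 1\<bar> < e" by linarith
    then show ?case by (simp add: dist_real_def X_def N_def c_def)
  qed
qed

end
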